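(* Let $T\in C^{\ast}_{\mathcal{E}}(\mathcal{D})$ be normal. Then the character space $\mathcal{M}_{\mathcal{A}[T]}$ of the unital locally $C^{\ast}$-algebra $\mathcal{A}[T]$ generated by $T$ is homeomorphic to the local spectrum $\sigma_{loc}(T)$ (both spaces carrying the inductive limit topologies described in the context).
   Context: Let $(\Lambda,\le)$ be a directed partially ordered set and $\mathcal{E}=\{\mathcal{H}_\alpha\}_{\alpha\in\Lambda}$ a family of nonzero closed subspaces of a complex Hilbert space $\mathcal{H}$ with $\mathcal{H}_\alpha\subseteq\mathcal{H}_\beta$ for $\alpha\le\beta$, such that $\mathcal{D}=\bigcup_\alpha\mathcal{H}_\alpha$ is dense in $\mathcal{H}$. Let $P_\alpha$ be the orthogonal projection of $\mathcal{H}$ onto $\mathcal{H}_\alpha$. $C^{\ast}_{\mathcal{E}}(\mathcal{D})$ is the unital $\ast$-algebra of all linear $T:\mathcal{D}\to\mathcal{D}$ such that for every $\alpha$, $P_\alpha Tx=TP_\alpha x$ for all $x\in\mathcal{D}$ and $T_\alpha:=T|_{\mathcal{H}_\alpha}\in\mathcal{B}(\mathcal{H}_\alpha)$; the involution is determined by $T^{\ast}|_{\mathcal{H}_\alpha}=T_\alpha^{\ast}$, and $T$ is normal if $TT^{\ast}=T^{\ast}T$. The local spectrum $\sigma_{loc}(T)$ is the set of $\lambda\in\mathbb{C}$ such that $\lambda I_{\mathcal{D}}-T$ is not invertible in $C^{\ast}_{\mathcal{E}}(\mathcal{D})$; it equals $\bigcup_\alpha\sigma(T_\alpha)$, with $\sigma(T_\alpha)\subseteq\sigma(T_\beta)$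 for $\alpha\le\beta$. It is equipped with the inductive limit topology: $S\subseteq\sigma_{loc}(T)$ is open iff $S\cap\sigma(T_\alpha)$ is open in $\sigma(T_\alpha)$ (usual topology) for every $\alpha$. For normal $T$, let $C^{\ast}\{I_{\mathcal{H}_\alpha},T_\alpha,T_\alpha^{\ast}\}\subseteq\mathcal{B}(\mathcal{H}_\alpha)$ be the unital $C^{\ast}$-algebra generated by $T_\alpha$. The unital locally $C^{\ast}$-algebra generated by $T$ is $\mathcal{A}[T]=\{R\in C^{\ast}_{\mathcal{E}}(\mathcal{D}): R|_{\mathcal{H}_\alpha}\in C^{\ast}\{I_{\mathcal{H}_\alpha},T_\alpha,T_\alpha^{\ast}\}\text{ for all }\alpha\in\Lambda\}$, with the locally convex topology given by the $C^{\ast}$-seminorms $s_\alpha(R)=\|R|_{\mathcal{H}_\alpha}\|$; it is commutative. Put $\mathcal{I}_\alpha=\{R\in\mathcal{A}[T]:s_\alpha(R)=0\}$, $\pi_\alpha:\mathcal{A}[T]\to\mathcal{A}[T]/\mathcal{I}_\alpha$ the quotient map onto the $C^{\ast}$-algebra $\mathcal{A}[T]/\mathcal{I}_\alpha$ with norm induced by $s_\alpha$, and $\mathcal{M}_{\mathcal{A}[T]/\mathcal{I}_\alpha}$ its space of nonzero multiplicative linear functionals with the weak$^{\ast}$-topology. The character space is $\mathcal{M}_{\mathcal{A}[T]}=\bigcup_\alpha\mathcal{Z}_\alpha$, $\mathcal{Z}_\alpha=\{\varphi\circ\pi_\alpha:\varphi\in\mathcal{M}_{\mathcal{A}[T]/\mathcal{I}_\alpha}\}$,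 where the open sets of $\mathcal{Z}_\alpha$ are $\{\varphi\circ\pi_\alpha:\varphi\in\mathcal{O}\}$ with $\mathcal{O}$ open in $\mathcal{M}_{\mathcal{A}[T]/\mathcal{I}_\alpha}$, and $S\subseteq\mathcal{M}_{\mathcal{A}[T]}$ is open iff $S\cap\mathcal{Z}_\alpha$ is open in $\mathcal{Z}_\alpha$ for all $\alpha$. *)

theory Defs
  imports "HOL-Analysis.Analysis"
begin

text \<open>
  Complex Hilbert spaces: the complex structure extends a complete real inner product space,
  so that the library's norm, limits, closed sets and closures apply. The inner product is linear
  in its first argument.
\<close>

class complex_hilbert_space = real_inner + complete_space +
  fixes scaleC :: "complex \<Rightarrow> 'a \<Rightarrow> 'a" (infixr "*\<^sub>C" 75)
    and cinner :: "'a \<Rightarrow> 'a \<Rightarrow> complex"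
  assumes scaleC_add_right: "c *\<^sub>C (x + y) = c *\<^sub>C x + c *\<^sub>C y"
    and scaleC_add_left: "(b + c) *\<^sub>C x = b *\<^sub>C x + c *\<^sub>C x"
    and scaleC_scaleC: "b *\<^sub>C c *\<^sub>C x = (b * c) *\<^sub>C x"
    and scaleC_one: "1 *\<^sub>C x = x"
    and scaleR_scaleC: "r *\<^sub>R x = complex_of_real r *\<^sub>C x"
    and cinner_add_left: "cinner (x + y) z = cinner x z + cinner y z"
    and cinner_scaleC_left: "cinner (c *\<^sub>C x) y = c * cinner x y"
    and cinner_commute: "cinner x y = cnj (cinner y x)"
    and inner_eq_Re_cinner: "inner x y = Re (cinner x y)"

definition closed_csubspace :: "'h::complex_hilbert_space set \<Rightarrow> bool" where
  "closed_csubspace M \<longleftrightarrow> closed M \<and> 0 \<in> M \<and> (\<forall>x\<in>M. \<forall>y\<in>M. x + y \<in> M) \<and>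
     (\<forall>c. \<forall>x\<in>M. c *\<^sub>C x \<in> M)"

definition orth_proj :: "'h::complex_hilbert_space set \<Rightarrow> 'h \<Rightarrow> 'h" where
  "orth_proj M x = (THE y. y \<in> M \<and> (\<forall>z\<in>M. cinner (x - y) z = 0))"


section \<open>Operators on subspaces\<close>

text \<open>
  An operator on a subspace \<open>M\<close> is represented by a total function that vanishes off \<open>M\<close>;
  thus equality of functions is equality of operators, and sums, scalar multiples and products
  of operators on \<open>M\<close> are pointwise sums, pointwise multiples and function composition.
\<close>

definition linear_ops :: "'h::complex_hilbert_space set \<Rightarrow> ('h \<Rightarrow> 'h) set" where
  "linear_ops M = {A. (\<forall>x\<in>M. A x \<in> M) \<and> (\<forall>x\<in>M. \<forall>y\<in>M. A (x + y) = A x + A y) \<and>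
     (\<forall>c. \<forall>x\<in>M. A (c *\<^sub>C x) = c *\<^sub>C A x) \<and> (\<forall>x. x \<notin> M \<longrightarrow> A x = 0)}"

definition op_restrict :: "'h::complex_hilbert_space set \<Rightarrow> ('h \<Rightarrow> 'h) \<Rightarrow> 'h \<Rightarrow> 'h" where
  "op_restrict M A = (\<lambda>x. if x \<in> M then A x else 0)"

definition op_id :: "'h::complex_hilbert_space set \<Rightarrow> 'h \<Rightarrow> 'h" where
  "op_id M = op_restrict M (\<lambda>x. x)"

definition op_add :: "('h::complex_hilbert_space \<Rightarrow> 'h) \<Rightarrow> ('h \<Rightarrow> 'h) \<Rightarrow> 'h \<Rightarrow> 'h" where
  "op_add A B = (\<lambda>x. A x + B x)"

definition op_diff :: "('h::complex_hilbert_space \<Rightarrow> 'h) \<Rightarrow> ('h \<Rightarrow> 'h) \<Rightarrow> 'h \<Rightarrow> 'h" where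
  "op_diff A B = (\<lambda>x. A x - B x)"

definition op_scale :: "complex \<Rightarrow> ('h::complex_hilbert_space \<Rightarrow> 'h) \<Rightarrow> 'h \<Rightarrow> 'h" where
  "op_scale c A = (\<lambda>x. c *\<^sub>C A x)"

definition bounded_ops :: "'h::complex_hilbert_space set \<Rightarrow> ('h \<Rightarrow> 'h) set" where
  "bounded_ops M = {A \<in> linear_ops M. \<exists>K. \<forall>x\<in>M. norm (A x) \<le> K * norm x}"

definition op_norm :: "'h::complex_hilbert_space set \<Rightarrow> ('h \<Rightarrow> 'h) \<Rightarrow> real" where
  "op_norm M A = (SUP x\<in>{x \<in> M. norm x \<le> 1}. norm (A x))"

definition op_adj :: "'h::complex_hilbert_space set \<Rightarrow> ('h \<Rightarrow> 'h) \<Rightarrow> 'h \<Rightarrow> 'h" where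
  "op_adj M A = (THE B. B \<in> bounded_ops M \<and> (\<forall>x\<in>M. \<forall>y\<in>M. cinner (A x) y = cinner x (B y)))"

text \<open>The spectrum of \<open>A\<close> relative to an algebra \<open>C\<close> of operators on \<open>M\<close> with unit \<open>op_id M\<close>.\<close>

definition spectrum_in ::
    "'h::complex_hilbert_space set \<Rightarrow> ('h \<Rightarrow> 'h) set \<Rightarrow> ('h \<Rightarrow> 'h) \<Rightarrow> complex set" where
  "spectrum_in M C A = {z. \<not> (\<exists>B\<in>C. B \<circ> op_diff (op_scale z (op_id M)) A = op_id M \<and>
                               op_diff (op_scale z (op_id M)) A \<circ> B = op_id M)}"

definition unital_cstar_subalgebra ::
    "'h::complex_hilbert_space set \<Rightarrow> ('h \<Rightarrow> 'h) set \<Rightarrow> bool" where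
  "unital_cstar_subalgebra M C \<longleftrightarrow> C \<subseteq> bounded_ops M \<and> op_id M \<in> C \<and>
     (\<forall>A\<in>C. \<forall>B\<in>C. op_add A B \<in> C \<and> A \<circ> B \<in> C) \<and>
     (\<forall>c. \<forall>A\<in>C. op_scale c A \<in> C) \<and>
     (\<forall>A\<in>C. op_adj M A \<in> C) \<and>
     (\<forall>A\<in>bounded_ops M. (\<forall>e>0. \<exists>B\<in>C. op_norm M (op_diff A B) < e) \<longrightarrow> A \<in> C)"

definition cstar_generated ::
    "'h::complex_hilbert_space set \<Rightarrow> ('h \<Rightarrow> 'h) \<Rightarrow> ('h \<Rightarrow> 'h) set" where
  "cstar_generated M A = \<Inter>{C. unital_cstar_subalgebra M C \<and> A \<in> C}"


section \<open>The algebra of a directed family of closed subspaces\<close>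

definition directed_family :: "('l::order \<Rightarrow> 'h::complex_hilbert_space set) \<Rightarrow> bool" where
  "directed_family H \<longleftrightarrow> (\<forall>\<alpha> \<beta>::'l. \<exists>\<gamma>. \<alpha> \<le> \<gamma> \<and> \<beta> \<le> \<gamma>) \<and>
     (\<forall>\<alpha>. closed_csubspace (H \<alpha>) \<and> H \<alpha> \<noteq> {0}) \<and>
     (\<forall>\<alpha> \<beta>. \<alpha> \<le> \<beta> \<longrightarrow> H \<alpha> \<subseteq> H \<beta>) \<and>
     closure (\<Union>\<alpha>. H \<alpha>) = UNIV"

definition dom_union :: "('l::order \<Rightarrow> 'h::complex_hilbert_space set) \<Rightarrow> 'h set" where
  "dom_union H = (\<Union>\<alpha>. H \<alpha>)"

definition local_ops :: "('l::order \<Rightarrow> 'h::complex_hilbert_space set) \<Rightarrow> ('h \<Rightarrow> 'h) set" where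
  "local_ops H = {T \<in> linear_ops (dom_union H). \<forall>\<alpha>.
     (\<forall>x\<in>dom_union H. orth_proj (H \<alpha>) (T x) = T (orth_proj (H \<alpha>) x)) \<and>
     op_restrict (H \<alpha>) T \<in> bounded_ops (H \<alpha>)}"

definition local_adj ::
    "('l::order \<Rightarrow> 'h::complex_hilbert_space set) \<Rightarrow> ('h \<Rightarrow> 'h) \<Rightarrow> 'h \<Rightarrow> 'h" where
  "local_adj H T = (THE S. S \<in> local_ops H \<and>
     (\<forall>\<alpha>. op_restrict (H \<alpha>) S = op_adj (H \<alpha>) (op_restrict (H \<alpha>) T)))"

definition local_normal ::
    "('l::order \<Rightarrow> 'h::complex_hilbert_space set) \<Rightarrow> ('h \<Rightarrow> 'h) \<Rightarrow> bool" where
  "local_normal H T \<longleftrightarrow> T \<circ> local_adj H T = local_adj H T \<circ> T"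


section \<open>Inductive limit topologies\<close>

definition inductive_limit_topology :: "'a set \<Rightarrow> ('l \<Rightarrow> 'a topology) \<Rightarrow> 'a topology" where
  "inductive_limit_topology Y X =
     topology (\<lambda>S. S \<subseteq> Y \<and> (\<forall>\<alpha>. openin (X \<alpha>) (S \<inter> topspace (X \<alpha>))))"

lemma openin_inductive_limit_topology:
  "openin (inductive_limit_topology Y X) S \<longleftrightarrow>
     S \<subseteq> Y \<and> (\<forall>\<alpha>. openin (X \<alpha>) (S \<inter> topspace (X \<alpha>)))"
proof -
  have "istopology (\<lambda>S. S \<subseteq> Y \<and> (\<forall>\<alpha>. openin (X \<alpha>) (S \<inter> topspace (X \<alpha>))))"
    unfolding istopology_def
  proof (intro conjI allI impI)
    fix S U \<alpha>
    assume "S \<subseteq> Y \<and> (\<forall>\<alpha>. openin (X \<alpha>) (S \<inter> topspace (X \<alpha>)))"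
      and "U \<subseteq> Y \<and> (\<forall>\<alpha>. openin (X \<alpha>) (U \<inter> topspace (X \<alpha>)))"
    then have "openin (X \<alpha>) ((S \<inter> topspace (X \<alpha>)) \<inter> (U \<inter> topspace (X \<alpha>)))" by blast
    then show "openin (X \<alpha>) (S \<inter> U \<inter> topspace (X \<alpha>))" by (simp add: Int_ac)
  next
    fix \<K> \<alpha>
    assume "\<forall>K\<in>\<K>. K \<subseteq> Y \<and> (\<forall>\<alpha>. openin (X \<alpha>) (K \<inter> topspace (X \<alpha>)))"
    then have "openin (X \<alpha>) (\<Union>K\<in>\<K>. K \<inter> topspace (X \<alpha>))" by blast
    then show "openin (X \<alpha>) (\<Union>\<K> \<inter> topspace (X \<alpha>))" by (simp add: Int_commute Int_Union)
  qed auto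
  then show ?thesis by (simp add: inductive_limit_topology_def)
qed

text \<open>The topology on \<open>f ` topspace X\<close> whose open sets are the images of the open sets of \<open>X\<close>.\<close>

definition image_topology :: "('a \<Rightarrow> 'b) \<Rightarrow> 'a topology \<Rightarrow> 'b topology" where
  "image_topology f X = topology (\<lambda>S. \<exists>U. openin X U \<and> S = f ` U)"

lemma openin_image_topology:
  assumes "inj_on f (topspace X)"
  shows "openin (image_topology f X) S \<longleftrightarrow> (\<exists>U. openin X U \<and> S = f ` U)"
proof -
  have "istopology (\<lambda>S. \<exists>U. openin X U \<and> S = f ` U)"
    unfolding istopology_def
  proof (intro conjI allI impI)
    fix S S' assume "\<exists>U. openin X U \<and> S = f ` U" "\<exists>U. openin X U \<and> S' = f ` U"
    then obtain U U' where "openin X U" "S = f ` U" "openin X U'" "S' = f ` U'" by blast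
    then show "\<exists>U. openin X U \<and> S \<inter> S' = f ` U"
      using assms by (intro exI[of _ "U \<inter> U'"])
        (auto simp: inj_on_image_Int openin_subset)
  next
    fix \<K> assume "\<forall>K\<in>\<K>. \<exists>U. openin X U \<and> K = f ` U"
    then obtain g where "\<forall>K\<in>\<K>. openin X (g K) \<and> K = f ` g K" by metis
    then show "\<exists>U. openin X U \<and> \<Union>\<K> = f ` U"
      by (intro exI[of _ "\<Union>(g ` \<K>)"]) (auto simp: image_UN)
  qed
  then show ?thesis by (simp add: image_topology_def)
qed


section \<open>The local spectrum\<close>

definition spectrum_at ::
    "('l::order \<Rightarrow> 'h::complex_hilbert_space set) \<Rightarrow> ('h \<Rightarrow> 'h) \<Rightarrow> 'l \<Rightarrow> complex set" where
  "spectrum_at H T \<alpha> = spectrum_in (H \<alpha>) (bounded_ops (H \<alpha>)) (op_restrict (H \<alpha>) T)"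

definition local_spectrum ::
    "('l::order \<Rightarrow> 'h::complex_hilbert_space set) \<Rightarrow> ('h \<Rightarrow> 'h) \<Rightarrow> complex set" where
  "local_spectrum H T = spectrum_in (dom_union H) (local_ops H) T"

definition local_spectrum_topology ::
    "('l::order \<Rightarrow> 'h::complex_hilbert_space set) \<Rightarrow> ('h \<Rightarrow> 'h) \<Rightarrow> complex topology" where
  "local_spectrum_topology H T =
     inductive_limit_topology (local_spectrum H T) (\<lambda>\<alpha>. top_of_set (spectrum_at H T \<alpha>))"


section \<open>The generated locally C*-algebra and its character space\<close>

definition gen_alg ::
    "('l::order \<Rightarrow> 'h::complex_hilbert_space set) \<Rightarrow> ('h \<Rightarrow> 'h) \<Rightarrow> ('h \<Rightarrow> 'h) set" where
  "gen_alg H T = {R \<in> local_ops H.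
     \<forall>\<alpha>. op_restrict (H \<alpha>) R \<in> cstar_generated (H \<alpha>) (op_restrict (H \<alpha>) T)}"

definition cstar_seminorm ::
    "('l::order \<Rightarrow> 'h::complex_hilbert_space set) \<Rightarrow> 'l \<Rightarrow> ('h \<Rightarrow> 'h) \<Rightarrow> real" where
  "cstar_seminorm H \<alpha> R = op_norm (H \<alpha>) (op_restrict (H \<alpha>) R)"

definition null_ideal ::
    "('l::order \<Rightarrow> 'h::complex_hilbert_space set) \<Rightarrow> ('h \<Rightarrow> 'h) \<Rightarrow> 'l \<Rightarrow> ('h \<Rightarrow> 'h) set" where
  "null_ideal H T \<alpha> = {R \<in> gen_alg H T. cstar_seminorm H \<alpha> R = 0}"

definition quot_map ::
    "('l::order \<Rightarrow> 'h::complex_hilbert_space set) \<Rightarrow> ('h \<Rightarrow> 'h) \<Rightarrow> 'l \<Rightarrow> ('h \<Rightarrow> 'h) \<Rightarrow> ('h \<Rightarrow> 'h) set"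
  where
  "quot_map H T \<alpha> R = {S \<in> gen_alg H T. op_diff S R \<in> null_ideal H T \<alpha>}"

definition quot_carrier ::
    "('l::order \<Rightarrow> 'h::complex_hilbert_space set) \<Rightarrow> ('h \<Rightarrow> 'h) \<Rightarrow> 'l \<Rightarrow> ('h \<Rightarrow> 'h) set set" where
  "quot_carrier H T \<alpha> = quot_map H T \<alpha> ` gen_alg H T"

text \<open>
  The operations of the quotient algebra. Each union ranges over representatives and all its
  members are the same coset.
\<close>

definition quot_add ::
    "('l::order \<Rightarrow> 'h::complex_hilbert_space set) \<Rightarrow> ('h \<Rightarrow> 'h) \<Rightarrow> 'l \<Rightarrow>
      ('h \<Rightarrow> 'h) set \<Rightarrow> ('h \<Rightarrow> 'h) set \<Rightarrow> ('h \<Rightarrow> 'h) set" where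
  "quot_add H T \<alpha> X Y = (\<Union>R\<in>X. \<Union>S\<in>Y. quot_map H T \<alpha> (op_add R S))"

definition quot_scale ::
    "('l::order \<Rightarrow> 'h::complex_hilbert_space set) \<Rightarrow> ('h \<Rightarrow> 'h) \<Rightarrow> 'l \<Rightarrow>
      complex \<Rightarrow> ('h \<Rightarrow> 'h) set \<Rightarrow> ('h \<Rightarrow> 'h) set" where
  "quot_scale H T \<alpha> c X = (\<Union>R\<in>X. quot_map H T \<alpha> (op_scale c R))"

definition quot_mult ::
    "('l::order \<Rightarrow> 'h::complex_hilbert_space set) \<Rightarrow> ('h \<Rightarrow> 'h) \<Rightarrow> 'l \<Rightarrow>
      ('h \<Rightarrow> 'h) set \<Rightarrow> ('h \<Rightarrow> 'h) set \<Rightarrow> ('h \<Rightarrow> 'h) set" where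
  "quot_mult H T \<alpha> X Y = (\<Union>R\<in>X. \<Union>S\<in>Y. quot_map H T \<alpha> (R \<circ> S))"

text \<open>
  Nonzero multiplicative linear functionals on the quotient. Functionals live in
  \<open>extensional\<close> of the carrier, so that equality is equality on the carrier and the weak*
  topology is the subspace topology of the product topology (pointwise convergence).
\<close>

definition quot_characters ::
    "('l::order \<Rightarrow> 'h::complex_hilbert_space set) \<Rightarrow> ('h \<Rightarrow> 'h) \<Rightarrow> 'l \<Rightarrow>
      (('h \<Rightarrow> 'h) set \<Rightarrow> complex) set" where
  "quot_characters H T \<alpha> = {\<phi> \<in> extensional (quot_carrier H T \<alpha>).
     (\<forall>X\<in>quot_carrier H T \<alpha>. \<forall>Y\<in>quot_carrier H T \<alpha>.
        \<phi> (quot_add H T \<alpha> X Y) = \<phi> X + \<phi> Y \<and> \<phi> (quot_mult H T \<alpha> X Y) = \<phi> X * \<phi> Y) \<and>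
     (\<forall>c. \<forall>X\<in>quot_carrier H T \<alpha>. \<phi> (quot_scale H T \<alpha> c X) = c * \<phi> X) \<and>
     (\<exists>X\<in>quot_carrier H T \<alpha>. \<phi> X \<noteq> 0)}"

definition weak_star_topology ::
    "('l::order \<Rightarrow> 'h::complex_hilbert_space set) \<Rightarrow> ('h \<Rightarrow> 'h) \<Rightarrow> 'l \<Rightarrow>
      (('h \<Rightarrow> 'h) set \<Rightarrow> complex) topology" where
  "weak_star_topology H T \<alpha> =
     subtopology (product_topology (\<lambda>_. euclidean) (quot_carrier H T \<alpha>)) (quot_characters H T \<alpha>)"

text \<open>\<open>char_pullback H T \<alpha> \<phi>\<close> is \<open>\<phi> \<circ> \<pi>\<^sub>\<alpha>\<close>, as an extensional function on the algebra.\<close>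

definition char_pullback ::
    "('l::order \<Rightarrow> 'h::complex_hilbert_space set) \<Rightarrow> ('h \<Rightarrow> 'h) \<Rightarrow> 'l \<Rightarrow>
      (('h \<Rightarrow> 'h) set \<Rightarrow> complex) \<Rightarrow> ('h \<Rightarrow> 'h) \<Rightarrow> complex" where
  "char_pullback H T \<alpha> \<phi> = compose (gen_alg H T) \<phi> (quot_map H T \<alpha>)"

lemma inj_on_char_pullback:
  "inj_on (char_pullback H T \<alpha>) (topspace (weak_star_topology H T \<alpha>))"
proof (rule inj_onI)
  fix \<phi> \<psi>
  assume mem: "\<phi> \<in> topspace (weak_star_topology H T \<alpha>)" "\<psi> \<in> topspace (weak_star_topology H T \<alpha>)"
    and eq: "char_pullback H T \<alpha> \<phi> = char_pullback H T \<alpha> \<psi>"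
  show "\<phi> = \<psi>"
  proof (rule extensionalityI[of _ "quot_carrier H T \<alpha>"])
    show "\<phi> \<in> extensional (quot_carrier H T \<alpha>)" "\<psi> \<in> extensional (quot_carrier H T \<alpha>)"
      using mem by (auto simp: weak_star_topology_def quot_characters_def)
    fix X assume "X \<in> quot_carrier H T \<alpha>"
    then obtain R where "R \<in> gen_alg H T" "X = quot_map H T \<alpha> R"
      by (auto simp: quot_carrier_def)
    then show "\<phi> X = \<psi> X"
      using fun_cong[OF eq, of R] by (simp add: char_pullback_def compose_def)
  qed
qed

definition char_layer ::
    "('l::order \<Rightarrow> 'h::complex_hilbert_space set) \<Rightarrow> ('h \<Rightarrow> 'h) \<Rightarrow> 'l \<Rightarrow> (('h \<Rightarrow> 'h) \<Rightarrow> complex) set"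
  where
  "char_layer H T \<alpha> = char_pullback H T \<alpha> ` quot_characters H T \<alpha>"

definition char_layer_topology ::
    "('l::order \<Rightarrow> 'h::complex_hilbert_space set) \<Rightarrow> ('h \<Rightarrow> 'h) \<Rightarrow> 'l \<Rightarrow>
      (('h \<Rightarrow> 'h) \<Rightarrow> complex) topology" where
  "char_layer_topology H T \<alpha> = image_topology (char_pullback H T \<alpha>) (weak_star_topology H T \<alpha>)"

definition character_space ::
    "('l::order \<Rightarrow> 'h::complex_hilbert_space set) \<Rightarrow> ('h \<Rightarrow> 'h) \<Rightarrow> (('h \<Rightarrow> 'h) \<Rightarrow> complex) set"
  where
  "character_space H T = (\<Union>\<alpha>. char_layer H T \<alpha>)"

definition character_space_topology ::
    "('l::order \<Rightarrow> 'h::complex_hilbert_space set) \<Rightarrow> ('h \<Rightarrow> 'h) \<Rightarrow>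
      (('h \<Rightarrow> 'h) \<Rightarrow> complex) topology" where
  "character_space_topology H T =
     inductive_limit_topology (character_space H T) (char_layer_topology H T)"

lemma topspace_char_layer_topology: "topspace (char_layer_topology H T \<alpha>) = char_layer H T \<alpha>"
proof -
  have top: "topspace (weak_star_topology H T \<alpha>) = quot_characters H T \<alpha>"
    by (auto simp: weak_star_topology_def quot_characters_def PiE_def)
  have op: "openin (char_layer_topology H T \<alpha>) S \<longleftrightarrow>
      (\<exists>U. openin (weak_star_topology H T \<alpha>) U \<and> S = char_pullback H T \<alpha> ` U)" for S
    unfolding char_layer_topology_def by (rule openin_image_topology[OF inj_on_char_pullback])
  show ?thesis
  proof
    obtain U where U: "openin (weak_star_topology H T \<alpha>) U"
      "topspace (char_layer_topology H T \<alpha>) = char_pullback H T \<alpha> ` U"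
      using op openin_topspace by blast
    from U(1) have "U \<subseteq> quot_characters H T \<alpha>"
      unfolding top[symmetric] by (rule openin_subset)
    with U(2) show "topspace (char_layer_topology H T \<alpha>) \<subseteq> char_layer H T \<alpha>"
      by (simp add: char_layer_def image_mono)
    have "openin (weak_star_topology H T \<alpha>) (quot_characters H T \<alpha>)"
      unfolding top[symmetric] by (rule openin_topspace)
    then have "openin (char_layer_topology H T \<alpha>) (char_layer H T \<alpha>)"
      using op by (auto simp: char_layer_def)
    then show "char_layer H T \<alpha> \<subseteq> topspace (char_layer_topology H T \<alpha>)"
      by (rule openin_subset)
  qed
qed

lemma topspace_character_space_topology:
  "topspace (character_space_topology H T) = character_space H T"
proof
  show "topspace (character_space_topology H T) \<subseteq> character_space H T"
    using openin_topspace[of "character_space_topology H T"]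
    unfolding character_space_topology_def openin_inductive_limit_topology by blast
  have "character_space H T \<inter> topspace (char_layer_topology H T \<alpha>)
      = topspace (char_layer_topology H T \<alpha>)" for \<alpha>
    by (auto simp: topspace_char_layer_topology character_space_def)
  then have "openin (character_space_topology H T) (character_space H T)"
    by (simp add: character_space_topology_def openin_inductive_limit_topology)
  then show "character_space H T \<subseteq> topspace (character_space_topology H T)"
    by (rule openin_subset)
qed

end

theory Submission
  imports Defs
begin

text \<open>
  Evaluation at \<open>T\<close> identifies each layer of the character space with \<open>\<sigma>(T\<^sub>\<alpha>)\<close>. If \<open>z \<in> \<sigma>(T\<^sub>\<alpha>)\<close>, the
  normal operator \<open>T\<^sub>\<alpha>\<close> has approximate eigenvectors for \<open>z\<close>; these are also approximate eigenvectors
  of every operator in the \<open>C\<^sup>*\<close>-algebra generated by \<open>T\<^sub>\<alpha>\<close>, and the eigenvalue is a character in the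
  operator and continuous in \<open>z\<close>. Conversely a character \<open>\<psi>\<close> kills
  \<open>S = (T - \<psi> T)\<^sup>* (T - \<psi> T) + (R - \<psi> R)\<^sup>* (R - \<psi> R)\<close>, so \<open>S\<close> is not bounded below on \<open>H \<alpha>\<close> and
  \<open>\<psi> R\<close> is the approximate eigenvalue of \<open>R\<close> belonging to \<open>\<psi> T\<close>. The layers increase with \<open>\<alpha>\<close>,
  hence evaluation at \<open>T\<close> is injective on their union, and the inductive limit topologies correspond.
\<close>

section \<open>Complex Hilbert spaces\<close>

text \<open>The obstacle is that \<open>S\<close> is bounded below on \<open>H \<alpha>\<close>
  only. Its restriction has an inverse in the C*-algebra of that layer, but nothing extends this
  inverse to \<open>dom_union H\<close>, so \<open>\<psi> S \<noteq> 0\<close> cannot be read off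
  from it. Being coercive on the whole domain does give an inverse in \<open>gen_alg H T\<close>,
  since inverses in the layers are unique and hence fit together. The proof therefore builds
  globally defined elements: \<open>S (1 + S)^-1\<close> is a global contraction, and the absolute
  value of a shift of it, reached by an iteration that a scalar sequence dominates in all layers at
  once, produces another global contraction whose values on \<open>H \<alpha>\<close> are
  prescribed. If \<open>\<psi>\<close> killed \<open>S\<close>, it would send this contraction to a
  number above 1, which invertibility forbids. Characters here are merely algebraic, neither assumed
  continuous nor compatible with the involution: \<open>\<psi>\<close> kills \<open>S\<close>
  because each summand has a factor killed by \<open>\<psi>\<close>, and every estimate on
  \<open>\<psi>\<close> comes from an inverse. The two squares sit in one \<open>S\<close> so that a
  single unit vector serves \<open>T\<close> and \<open>R\<close>; this ties \<open>\<psi> R\<close>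
  to \<open>\<psi> T\<close>.\<close>

lemma scaleC_zero_left [simp]: "0 *\<^sub>C (x::'h::complex_hilbert_space) = 0"
  using scaleR_scaleC[of 0 x] by simp

lemma scaleC_minus_one: "(-1) *\<^sub>C (x::'h::complex_hilbert_space) = - x"
  using scaleR_scaleC[of "-1" x] by simp

lemma scaleC_zero_right [simp]: "c *\<^sub>C (0::'h::complex_hilbert_space) = 0"
  using scaleC_add_right[of c 0 "0::'h"] by simp

lemma scaleC_minus_right: "c *\<^sub>C (- x) = - (c *\<^sub>C (x::'h::complex_hilbert_space))"
  by (metis add.right_inverse add_eq_0_iff scaleC_add_right scaleC_zero_right)

lemma scaleC_minus_left: "(- c) *\<^sub>C x = - (c *\<^sub>C (x::'h::complex_hilbert_space))"
  by (metis add.right_inverse add_eq_0_iff scaleC_add_left scaleC_zero_left)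

lemma scaleC_diff_right: "c *\<^sub>C (x - y) = c *\<^sub>C x - c *\<^sub>C (y::'h::complex_hilbert_space)"
  using scaleC_add_right[of c x "- y"] by (simp add: scaleC_minus_right)

lemma scaleC_diff_left: "(b - c) *\<^sub>C x = b *\<^sub>C x - c *\<^sub>C (x::'h::complex_hilbert_space)"
  using scaleC_add_left[of b "- c" x] by (simp add: scaleC_minus_left)

lemma cinner_add_right: "cinner x (y + z) = cinner x y + cinner x (z::'h::complex_hilbert_space)"
  by (metis cinner_add_left cinner_commute complex_cnj_add)

lemma cinner_scaleC_right: "cinner x (c *\<^sub>C y) = cnj c * cinner x (y::'h::complex_hilbert_space)"
  by (metis cinner_commute cinner_scaleC_left complex_cnj_mult)

lemma cinner_minus_left: "cinner (- x) y = - cinner x (y::'h::complex_hilbert_space)"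
  using cinner_scaleC_left[of "-1" x y] by (simp add: scaleC_minus_one)

lemma cinner_minus_right: "cinner x (- y) = - cinner x (y::'h::complex_hilbert_space)"
  using cinner_scaleC_right[of x "-1" y] by (simp add: scaleC_minus_one)

lemma cinner_diff_left: "cinner (x - y) z = cinner x z - cinner y (z::'h::complex_hilbert_space)"
  using cinner_add_left[of x "- y" z] by (simp add: cinner_minus_left)

lemma cinner_diff_right: "cinner x (y - z) = cinner x y - cinner x (z::'h::complex_hilbert_space)"
  using cinner_add_right[of x y "- z"] by (simp add: cinner_minus_right)

lemma cinner_zero_left [simp]: "cinner 0 (x::'h::complex_hilbert_space) = 0"
  using cinner_scaleC_left[of 0 x x] by simp

lemma cinner_zero_right [simp]: "cinner (x::'h::complex_hilbert_space) 0 = 0"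
  using cinner_scaleC_right[of x 0 x] by simp

lemmas cinner_simps = cinner_add_left cinner_add_right cinner_diff_left cinner_diff_right
  cinner_scaleC_left cinner_scaleC_right cinner_minus_left cinner_minus_right

lemmas scaleC_simps = scaleC_add_left scaleC_add_right scaleC_diff_left scaleC_diff_right
  scaleC_minus_left scaleC_minus_right scaleC_scaleC scaleC_one

lemma cinner_self: "cinner x x = complex_of_real ((norm (x::'h::complex_hilbert_space))\<^sup>2)"
proof (rule complex_eqI)
  show "Re (cinner x x) = Re (complex_of_real ((norm x)\<^sup>2))"
    by (simp add: inner_eq_Re_cinner[symmetric] power2_norm_eq_inner)
  show "Im (cinner x x) = Im (complex_of_real ((norm x)\<^sup>2))"
    using arg_cong[OF cinner_commute[of x x], of Im] by simp
qed

lemma norm_scaleC [simp]: "norm (c *\<^sub>C (x::'h::complex_hilbert_space)) = cmod c * norm x"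
proof -
  have "complex_of_real ((norm (c *\<^sub>C x))\<^sup>2) = (c * cnj c) * complex_of_real ((norm x)\<^sup>2)"
    unfolding cinner_self[symmetric] by (simp add: cinner_simps)
  also have "\<dots> = complex_of_real ((cmod c)\<^sup>2 * (norm x)\<^sup>2)"
    by (simp only: complex_norm_square of_real_mult)
  finally have "(norm (c *\<^sub>C x))\<^sup>2 = (cmod c * norm x)\<^sup>2"
    unfolding power_mult_distrib using of_real_eq_iff by blast
  then show ?thesis by (simp add: power2_eq_iff_nonneg)
qed

lemma Re_cinner_le: "\<bar>Re (cinner x y)\<bar> \<le> norm x * norm (y::'h::complex_hilbert_space)"
  using Cauchy_Schwarz_ineq2[of x y] by (simp add: inner_eq_Re_cinner)

text \<open>Multiplying \<open>x\<close> by the conjugate phase of the inner product makes it real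
  and nonnegative, which reduces the claim to the real Cauchy-Schwarz inequality.\<close>

lemma norm_cinner_le: "cmod (cinner x y) \<le> norm x * norm (y::'h::complex_hilbert_space)"
proof (cases "cinner x y = 0")
  case False
  define u where "u = cnj (cinner x y) / cmod (cinner x y)"
  have u: "cmod u = 1" using False by (simp add: u_def norm_divide)
  have "u * cinner x y = complex_of_real (cmod (cinner x y))"
    using False complex_norm_square[of "cinner x y"]
    by (simp add: u_def field_simps power2_eq_square)
  then have "cmod (cinner x y) = Re (cinner (u *\<^sub>C x) y)"
    by (simp add: cinner_simps)
  also have "\<dots> \<le> norm x * norm y"
    using Re_cinner_le[of "u *\<^sub>C x" y] u by simp
  finally show ?thesis .
qed simp

lemma norm_diff_square:
  "(norm (x - y))\<^sup>2 = (norm x)\<^sup>2 - 2 * Re (cinner x y) + (norm (y::'h::complex_hilbert_space))\<^sup>2"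
  by (simp add: power2_norm_eq_inner inner_simps inner_commute flip: inner_eq_Re_cinner)

lemma norm_add_square:
  "(norm (x + y))\<^sup>2 = (norm x)\<^sup>2 + 2 * Re (cinner x y) + (norm (y::'h::complex_hilbert_space))\<^sup>2"
  by (simp add: power2_norm_eq_inner inner_simps inner_commute flip: inner_eq_Re_cinner)

section \<open>Closed subspaces: Riesz representation and orthogonal projection\<close>

lemma closed_csubspaceD:
  assumes "closed_csubspace M"
  shows "closed M" "0 \<in> M" "\<And>x y. x \<in> M \<Longrightarrow> y \<in> M \<Longrightarrow> x + y \<in> M"
    "\<And>c x. x \<in> M \<Longrightarrow> c *\<^sub>C x \<in> M" "\<And>x. x \<in> M \<Longrightarrow> - x \<in> M"
    "\<And>x y. x \<in> M \<Longrightarrow> y \<in> M \<Longrightarrow> x - y \<in> M" "\<And>r x. x \<in> M \<Longrightarrow> r *\<^sub>R x \<in> M"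
proof -
  show add: "x + y \<in> M" if "x \<in> M" "y \<in> M" for x y
    using assms that by (simp add: closed_csubspace_def)
  show scale: "c *\<^sub>C x \<in> M" if "x \<in> M" for c x
    using assms that by (simp add: closed_csubspace_def)
  show neg: "- x \<in> M" if "x \<in> M" for x
    using scale[OF that, of "-1"] by (simp add: scaleC_minus_one)
  show "x - y \<in> M" if "x \<in> M" "y \<in> M" for x y
    using add[OF that(1) neg[OF that(2)]] by simp
  show "r *\<^sub>R x \<in> M" if "x \<in> M" for r x
    by (simp add: scaleR_scaleC scale that)
qed (use assms in \<open>auto simp: closed_csubspace_def\<close>)

text \<open>Minimise \<open>\<parallel>x\<parallel>\<^sup>2 - 2 Re (f x)\<close>: minimising sequences are Cauchy by the parallelogram law.\<close>

lemma riesz_representation: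
  fixes f :: "'h::complex_hilbert_space \<Rightarrow> complex"
  assumes M: "closed_csubspace M"
    and add: "\<And>x y. x \<in> M \<Longrightarrow> y \<in> M \<Longrightarrow> f (x + y) = f x + f y"
    and scale: "\<And>c x. x \<in> M \<Longrightarrow> f (c *\<^sub>C x) = c * f x"
    and bdd: "\<And>x. x \<in> M \<Longrightarrow> cmod (f x) \<le> K * norm x"
  obtains y where "y \<in> M" "\<And>x. x \<in> M \<Longrightarrow> f x = cinner x y"
proof -
  note [simp] = closed_csubspaceD(2-)[OF M]
  define g where "g x = Re (f x)" for x
  define J where "J x = (norm x)\<^sup>2 - 2 * g x" for x
  have g_add: "g (x + y) = g x + g y" if "x \<in> M" "y \<in> M" for x y
    using add[OF that] by (simp add: g_def)
  have g_scale: "g (r *\<^sub>R x) = r * g x" if "x \<in> M" for r x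
    using scale[OF that, of "complex_of_real r"] by (simp add: g_def scaleR_scaleC)
  have g_bdd: "\<bar>g x\<bar> \<le> K * norm x" if "x \<in> M" for x
    using bdd[OF that] abs_Re_le_cmod[of "f x"] by (simp add: g_def)
  have J_bdd: "- K\<^sup>2 \<le> J x" if "x \<in> M" for x
  proof -
    have "0 \<le> (norm x - K)\<^sup>2" by simp
    then show ?thesis using g_bdd[OF that] unfolding J_def
      by (simp add: power2_eq_square algebra_simps)
  qed
  define m where "m = (INF x\<in>M. J x)"
  have bdd_J: "bdd_below (J ` M)" using J_bdd by (auto intro!: bdd_belowI)
  have m_le: "m \<le> J x" if "x \<in> M" for x
    unfolding m_def using that bdd_J by (rule cINF_lower[rotated])
  have "\<exists>x\<in>M. J x < m + 1 / real (Suc n)" for n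
  proof -
    have "Inf (J ` M) < m + 1 / real (Suc n)" by (simp add: m_def)
    then show ?thesis
      using cInf_lessD[of "J ` M" "m + 1 / real (Suc n)"] closed_csubspaceD(2)[OF M] by blast
  qed
  then obtain s where s: "\<And>n. s n \<in> M" "\<And>n. J (s n) < m + 1 / real (Suc n)" by metis
  \<comment> \<open>The infimum is compared with the value of \<open>J\<close> at the midpoint of
    \<open>x\<close> and \<open>y\<close>; the linear terms cancel because \<open>g\<close> is
    additive.\<close>
  have par: "(norm (x - y))\<^sup>2 \<le> 2 * (J x - m) + 2 * (J y - m)" if "x \<in> M" "y \<in> M" for x y
  proof -
    have mid: "(1/2) *\<^sub>R (x + y) \<in> M" using that by simp
    have "J ((1/2) *\<^sub>R (x + y)) = (norm (x + y))\<^sup>2 / 4 - (g x + g y)"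
    proof -
      have "(norm ((1/2) *\<^sub>R (x + y)))\<^sup>2 = (norm (x + y))\<^sup>2 / 4"
        by (simp only: norm_scaleR) (simp add: power_divide)
      moreover have "g ((1/2) *\<^sub>R (x + y)) = (g x + g y) / 2"
        using g_scale[of "x + y" "1/2"] g_add[OF that] that by (simp only: closed_csubspaceD(3)[OF M])
      ultimately show ?thesis unfolding J_def by simp
    qed
    with m_le[OF mid] have "4 * m \<le> (norm (x + y))\<^sup>2 - 4 * (g x + g y)" by simp
    moreover have "(norm (x + y))\<^sup>2 + (norm (x - y))\<^sup>2 = 2 * (norm x)\<^sup>2 + 2 * (norm y)\<^sup>2"
      by (simp add: norm_add_square norm_diff_square)
    ultimately show ?thesis by (simp add: J_def)
  qed
  have "Cauchy s"
  proof (rule metric_CauchyI)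
    fix e :: real assume "e > 0"
    \<comment> \<open>Two gaps of at most \<open>1 / Suc N\<close> each enter \<open>par\<close>
      with factor 2, hence the 4.\<close>
    obtain N :: nat where "4 / e\<^sup>2 < real N" using reals_Archimedean2 by blast
    then have N: "4 / real (Suc N) < e\<^sup>2"
      using \<open>e > 0\<close> by (simp add: field_simps) (smt (verit) zero_less_power)
    have "dist (s i) (s j) < e" if "i \<ge> N" "j \<ge> N" for i j
    proof -
      have "1 / real (Suc i) \<le> 1 / real (Suc N)" "1 / real (Suc j) \<le> 1 / real (Suc N)"
        using that by (auto simp: field_simps)
      then have "(norm (s i - s j))\<^sup>2 < e\<^sup>2"
        using par[OF s(1)[of i] s(1)[of j]] s(2)[of i] s(2)[of j] N by simp
      then show ?thesis using \<open>e > 0\<close> by (simp add: dist_norm power_less_imp_less_base)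
    qed
    then show "\<exists>N. \<forall>i\<ge>N. \<forall>j\<ge>N. dist (s i) (s j) < e" by blast
  qed
  then obtain y where y: "s \<longlonglongrightarrow> y" using Cauchy_convergent convergent_def by blast
  have yM: "y \<in> M" using closed_sequentially[OF closed_csubspaceD(1)[OF M]] s(1) y by blast
  have g_lim: "(\<lambda>n. g (s n)) \<longlonglongrightarrow> g y"
  proof (rule LIMSEQ_I)
    fix r :: real assume "r > 0"
    have "(\<lambda>n. K * norm (s n - y)) \<longlonglongrightarrow> K * norm (y - y)" by (intro tendsto_intros y)
    then have "(\<lambda>n. K * norm (s n - y)) \<longlonglongrightarrow> 0" by simp
    from LIMSEQ_D[OF this \<open>r > 0\<close>] obtain N where N: "\<And>n. n \<ge> N \<Longrightarrow> \<bar>K * norm (s n - y)\<bar> < r"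
      by auto
    have "norm (g (s n) - g y) < r" if "n \<ge> N" for n
    proof -
      have "g (s n - y) + g y = g (s n)" using g_add[of "s n - y" y] s(1) yM by simp
      then have "\<bar>g (s n) - g y\<bar> \<le> K * norm (s n - y)" using g_bdd[of "s n - y"] s(1) yM by simp
      then show ?thesis using N[OF that] by simp
    qed
    then show "\<exists>N. \<forall>n\<ge>N. norm (g (s n) - g y) < r" by blast
  qed
  have "(\<lambda>n. J (s n)) \<longlonglongrightarrow> J y" unfolding J_def by (intro tendsto_intros g_lim y)
  moreover have "(\<lambda>n. m + 1 / real (Suc n)) \<longlonglongrightarrow> m + 0"
    by (intro tendsto_intros LIMSEQ_Suc[OF lim_const_over_n])
  ultimately have "J y \<le> m + 0"
    by (rule LIMSEQ_le) (use s(2) less_imp_le in blast)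
  then have y_min: "J y \<le> J z" if "z \<in> M" for z using m_le[OF that] by simp
  have g_eq: "g z = Re (cinner z y)" if z: "z \<in> M" for z
  proof -
    define d where "d = Re (cinner z y) - g z"
    \<comment> \<open>First variation at the minimiser: a quadratic in \<open>t\<close> without
      constant term stays nonnegative only if its linear coefficient vanishes.\<close>
    have "0 \<le> 2 * t * d + t\<^sup>2 * (norm z)\<^sup>2" for t
    proof -
      have "J (y + t *\<^sub>R z) = J y + 2 * t * d + t\<^sup>2 * (norm z)\<^sup>2"
      proof -
        have "Re (cinner y (t *\<^sub>R z)) = t * Re (cinner z y)"
          by (simp add: scaleR_scaleC cinner_simps cinner_commute[of y z])
        then show ?thesis
          using z yM by (simp add: J_def norm_add_square g_add g_scale d_def algebra_simps
              power_mult_distrib)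
      qed
      then show ?thesis using y_min[of "y + t *\<^sub>R z"] z yM by simp
    qed
    \<comment> \<open>The test value is \<open>t = - d / q\<close>; the summand 1 in
      \<open>q\<close> keeps the denominator positive for \<open>z = 0\<close>.\<close>
    then have "0 \<le> 2 * (- d / q) * d + (- d / q)\<^sup>2 * (norm z)\<^sup>2" for q by blast
    moreover define q where "q = (norm z)\<^sup>2 + 1"
    moreover have q: "q > 0" by (simp add: q_def add_nonneg_pos)
    moreover have "(- d / q)\<^sup>2 * (norm z)\<^sup>2 \<le> (- d / q)\<^sup>2 * q"
      by (rule mult_left_mono) (simp_all add: q_def)
    moreover have "2 * (- d / q) * d + (- d / q)\<^sup>2 * q = - (d\<^sup>2 / q)"
      using q by (simp add: field_simps power2_eq_square)
    ultimately have "d\<^sup>2 / q \<le> 0" by (smt (verit))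
    then have "d = 0" using q by (simp add: divide_le_0_iff)
    then show ?thesis by (simp add: d_def)
  qed
  have "f z = cinner z y" if z: "z \<in> M" for z
  proof (rule complex_eqI)
    show "Re (f z) = Re (cinner z y)" using g_eq[OF z] by (simp add: g_def)
    \<comment> \<open>Complex linearity recovers imaginary parts from real ones:
      \<open>Re (\<i> * w) = - Im w\<close>.\<close>
    have "Re (f (\<i> *\<^sub>C z)) = Re (cinner (\<i> *\<^sub>C z) y)" using g_eq[of "\<i> *\<^sub>C z"] z by (simp add: g_def)
    then show "Im (f z) = Im (cinner z y)" using z by (simp add: scale cinner_simps)
  qed
  with yM show ?thesis by (rule that)
qed

text \<open>The projection is the Riesz representative of \<open>\<lambda>z. cinner z x\<close> on
  \<open>M\<close>. Uniqueness of that vector is what makes the definite description in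
  \<open>orth_proj\<close> meaningful.\<close>

lemma orth_proj:
  assumes M: "closed_csubspace (M :: 'h::complex_hilbert_space set)"
  shows "orth_proj M x \<in> M" "\<And>z. z \<in> M \<Longrightarrow> cinner (orth_proj M x) z = cinner x z"
    "\<And>z. z \<in> M \<Longrightarrow> cinner z (orth_proj M x) = cinner z x"
proof -
  obtain y where y: "y \<in> M" "\<And>z. z \<in> M \<Longrightarrow> cinner z x = cinner z y"
    by (rule riesz_representation[OF M, of "\<lambda>z. cinner z x" "norm x"])
      (auto simp: cinner_simps norm_cinner_le mult.commute[of "norm x"])
  have yz: "cinner (x - y) z = 0" if "z \<in> M" for z
    using y(2)[OF that] cinner_commute[of x z] cinner_commute[of y z] by (simp add: cinner_simps)
  have "\<exists>!y. y \<in> M \<and> (\<forall>z\<in>M. cinner (x - y) z = 0)"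
  proof (rule ex1I[of _ y])
    fix w assume w: "w \<in> M \<and> (\<forall>z\<in>M. cinner (x - w) z = 0)"
    then have "w - y \<in> M" using y(1) closed_csubspaceD(6)[OF M] by blast
    then have "cinner (x - y) (w - y) - cinner (x - w) (w - y) = 0" using w yz by simp
    moreover have "cinner (x - y) (w - y) - cinner (x - w) (w - y) = cinner (w - y) (w - y)"
      by (simp add: cinner_simps)
    ultimately have "cinner (w - y) (w - y) = 0" by simp
    then show "w = y" by (simp add: cinner_self)
  qed (use y(1) yz in blast)
  from theI'[OF this] have *: "orth_proj M x \<in> M" "\<And>z. z \<in> M \<Longrightarrow> cinner (x - orth_proj M x) z = 0"
    unfolding orth_proj_def by blast+
  show "orth_proj M x \<in> M" by fact
  show 1: "cinner (orth_proj M x) z = cinner x z" if "z \<in> M" for z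
    using *(2)[OF that] by (simp add: cinner_simps)
  show "cinner z (orth_proj M x) = cinner z x" if "z \<in> M" for z
    using 1[OF that] by (metis cinner_commute)
qed

lemma cinner_self_eq_0D: "cinner x x = 0 \<Longrightarrow> (x::'h::complex_hilbert_space) = 0"
  by (simp add: cinner_self)

lemma orth_proj_ident:
  assumes M: "closed_csubspace (M :: 'h::complex_hilbert_space set)" and x: "x \<in> M"
  shows "orth_proj M x = x"
proof -
  have "orth_proj M x - x \<in> M" using orth_proj(1)[OF M] x closed_csubspaceD(6)[OF M] by blast
  then have "cinner (orth_proj M x - x) (orth_proj M x - x) = 0"
    using orth_proj(2)[OF M] by (simp add: cinner_diff_left)
  then show ?thesis using cinner_self_eq_0D by fastforce
qed

section \<open>Bounded operators on a closed subspace\<close>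

lemma linear_opsD:
  assumes "A \<in> linear_ops M"
  shows "\<And>x. x \<in> M \<Longrightarrow> A x \<in> M" "\<And>x y. x \<in> M \<Longrightarrow> y \<in> M \<Longrightarrow> A (x + y) = A x + A y"
    "\<And>c x. x \<in> M \<Longrightarrow> A (c *\<^sub>C x) = c *\<^sub>C A x" "\<And>x. x \<notin> M \<Longrightarrow> A x = 0"
  using assms by (auto simp: linear_ops_def)

lemma bounded_ops_linear: "A \<in> bounded_ops M \<Longrightarrow> A \<in> linear_ops M"
  by (simp add: bounded_ops_def)

lemmas bounded_opsD = linear_opsD[OF bounded_ops_linear]

lemma bounded_opsE:
  assumes "A \<in> bounded_ops M"
  obtains K where "K > 0" "\<And>x. x \<in> M \<Longrightarrow> norm (A x) \<le> K * norm x"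
proof -
  obtain K where K: "\<And>x. x \<in> M \<Longrightarrow> norm (A x) \<le> K * norm x"
    using assms by (auto simp: bounded_ops_def)
  have "norm (A x) \<le> max K 1 * norm x" if "x \<in> M" for x
    using K[OF that] by (smt (verit) mult_right_mono norm_ge_zero max.cobounded1)
  then show ?thesis using that[of "max K 1"] by simp
qed

lemma linear_ops_diff:
  assumes "closed_csubspace M" "A \<in> linear_ops M" "x \<in> M" "y \<in> M"
  shows "A (x - y) = A x - A y"
proof -
  have "A (x - y) + A y = A (x - y + y)"
    using linear_opsD(2)[OF assms(2)] closed_csubspaceD(6)[OF assms(1)] assms(3,4) by metis
  then show ?thesis by (simp add: algebra_simps)
qed

lemma op_eqI:
  assumes "\<And>x. x \<notin> M \<Longrightarrow> A x = 0" "\<And>x. x \<notin> M \<Longrightarrow> B x = 0" "\<And>x. x \<in> M \<Longrightarrow> A x = B x"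
  shows "A = B"
  using assms by (metis ext)

lemma op_diff_eq_add: "op_diff A B = op_add A (op_scale (-1) (B :: 'h::complex_hilbert_space \<Rightarrow> 'h))"
  by (simp add: op_diff_def op_add_def op_scale_def scaleC_minus_one fun_eq_iff)

text \<open>Serves to carry identities over to uniform limits: \<open>e\<close> is the relative
  approximation error and \<open>c\<close> collects the norms of the fixed vectors involved.\<close>

lemma eq_if_norm_le_all:
  fixes u v :: "'b::real_normed_vector"
  assumes "\<And>e::real. e > 0 \<Longrightarrow> norm (u - v) \<le> e * c"
  shows "u = v"
proof (rule ccontr)
  assume "u \<noteq> v"
  then have pos: "norm (u - v) > 0" "\<bar>c\<bar> + 1 > 0" by auto
  then have "norm (u - v) / (\<bar>c\<bar> + 1) > 0" by simp
  then have "norm (u - v) \<le> norm (u - v) / (\<bar>c\<bar> + 1) * c" by (rule assms)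
  also have "\<dots> < norm (u - v) / (\<bar>c\<bar> + 1) * (\<bar>c\<bar> + 1)"
    using pos by (intro mult_strict_left_mono) auto
  also have "\<dots> = norm (u - v)" using pos by simp
  finally show False by simp
qed

context
  fixes M :: "'h::complex_hilbert_space set"
  assumes M: "closed_csubspace M"
begin

section \<open>Algebra and norm of operators on a fixed closed subspace\<close>

lemma linear_ops_zero: "A \<in> linear_ops M \<Longrightarrow> A 0 = 0"
  using linear_opsD(3)[of A M 0 0] closed_csubspaceD(2)[OF M] by simp

lemma linear_ops_id: "op_id M \<in> linear_ops M"
  using closed_csubspaceD[OF M] by (auto simp: op_id_def op_restrict_def linear_ops_def)

lemma linear_ops_add: "A \<in> linear_ops M \<Longrightarrow> B \<in> linear_ops M \<Longrightarrow> op_add A B \<in> linear_ops M"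
  using closed_csubspaceD[OF M]
  by (auto simp: op_add_def linear_ops_def scaleC_simps)

lemma linear_ops_scale: "A \<in> linear_ops M \<Longrightarrow> op_scale c A \<in> linear_ops M"
  using closed_csubspaceD[OF M]
  by (auto simp: op_scale_def linear_ops_def scaleC_simps mult.commute)

lemma linear_ops_comp: "A \<in> linear_ops M \<Longrightarrow> B \<in> linear_ops M \<Longrightarrow> A \<circ> B \<in> linear_ops M"
  using closed_csubspaceD[OF M] linear_ops_zero[of A]
  by (auto simp: linear_ops_def)

lemma bounded_ops_id: "op_id M \<in> bounded_ops M"
  using linear_ops_id by (auto simp: bounded_ops_def op_id_def op_restrict_def intro: exI[of _ 1])

lemma bounded_ops_add:
  assumes "A \<in> bounded_ops M" "B \<in> bounded_ops M" shows "op_add A B \<in> bounded_ops M"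
proof -
  obtain K L where K: "\<And>x. x \<in> M \<Longrightarrow> norm (A x) \<le> K * norm x"
    and L: "\<And>x. x \<in> M \<Longrightarrow> norm (B x) \<le> L * norm x"
    using assms by (auto simp: bounded_ops_def)
  have "norm (op_add A B x) \<le> (K + L) * norm x" if "x \<in> M" for x
    using norm_triangle_ineq[of "A x" "B x"] K[OF that] L[OF that]
    by (simp add: op_add_def distrib_right)
  then show ?thesis
    using linear_ops_add assms by (auto simp: bounded_ops_def)
qed

lemma bounded_ops_scale:
  assumes "A \<in> bounded_ops M" shows "op_scale c A \<in> bounded_ops M"
proof -
  obtain K where K: "\<And>x. x \<in> M \<Longrightarrow> norm (A x) \<le> K * norm x"
    using assms by (auto simp: bounded_ops_def)
  have "norm (op_scale c A x) \<le> (cmod c * K) * norm x" if "x \<in> M" for x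
    using mult_left_mono[OF K[OF that], of "cmod c"] by (simp add: op_scale_def mult.assoc)
  then show ?thesis
    using linear_ops_scale assms by (auto simp: bounded_ops_def)
qed

lemma bounded_ops_comp:
  assumes "A \<in> bounded_ops M" "B \<in> bounded_ops M" shows "A \<circ> B \<in> bounded_ops M"
proof -
  obtain K where K: "K > 0" "\<And>x. x \<in> M \<Longrightarrow> norm (A x) \<le> K * norm x"
    using bounded_opsE[OF assms(1)] by metis
  obtain L where L: "L > 0" "\<And>x. x \<in> M \<Longrightarrow> norm (B x) \<le> L * norm x"
    using bounded_opsE[OF assms(2)] by metis
  have "norm ((A \<circ> B) x) \<le> (K * L) * norm x" if "x \<in> M" for x
    using K(2)[OF bounded_opsD(1)[OF assms(2) that]] mult_left_mono[OF L(2)[OF that], of K] K(1)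
    by (simp add: mult.assoc) (meson mult_left_mono order.trans less_imp_le)
  then show ?thesis
    using linear_ops_comp assms by (auto simp: bounded_ops_def)
qed

lemma op_norm_le:
  assumes "c \<ge> 0" "\<And>x. x \<in> M \<Longrightarrow> norm (A x) \<le> c * norm x"
  shows "op_norm M A \<le> c"
  unfolding op_norm_def
proof (rule cSUP_least)
  show "{x \<in> M. norm x \<le> 1} \<noteq> {}" using closed_csubspaceD(2)[OF M] by auto
  fix x assume "x \<in> {x \<in> M. norm x \<le> 1}"
  then show "norm (A x) \<le> c"
    using assms(2)[of x] mult_left_mono[of "norm x" 1 c] assms(1) by auto
qed

lemma norm_le_op_norm:
  assumes A: "A \<in> bounded_ops M" and x: "x \<in> M"
  shows "norm (A x) \<le> op_norm M A * norm x"
proof (cases "x = 0")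
  case True then show ?thesis using linear_ops_zero[OF bounded_ops_linear[OF A]] by simp
next
  case False
  obtain K where K: "K > 0" "\<And>x. x \<in> M \<Longrightarrow> norm (A x) \<le> K * norm x"
    using bounded_opsE[OF A] by metis
  define y where "y = complex_of_real (1 / norm x) *\<^sub>C x"
  have y: "y \<in> M" "norm y = 1"
    using False x closed_csubspaceD(4)[OF M] by (auto simp: y_def norm_divide)
  have "bdd_above ((\<lambda>x. norm (A x)) ` {x \<in> M. norm x \<le> 1})"
  proof (rule bdd_aboveI2)
    fix x assume "x \<in> {x \<in> M. norm x \<le> 1}"
    then have "norm (A x) \<le> K * norm x" "K * norm x \<le> K * 1"
      using K by auto
    then show "norm (A x) \<le> K" by simp
  qed
  then have "norm (A y) \<le> op_norm M A"
    unfolding op_norm_def by (rule cSUP_upper[rotated]) (use y in auto)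
  moreover have "A y = complex_of_real (1 / norm x) *\<^sub>C A x"
    using bounded_opsD(3)[OF A x] by (simp add: y_def)
  ultimately show ?thesis using False by (simp add: norm_divide field_simps)
qed

section \<open>Adjoints on a closed subspace\<close>

text \<open>Riesz representation of \<open>\<lambda>x. cinner (A x) y\<close> supplies the value at
  each \<open>y\<close>. Uniqueness of the representing vector gives linearity, and extension by 0
  off \<open>M\<close> gives uniqueness as a total function, so the description in
  \<open>op_adj\<close> is met.\<close>

lemma op_adj:
  assumes A: "A \<in> bounded_ops M"
  shows op_adj_bounded: "op_adj M A \<in> bounded_ops M"
    and cinner_op_adj: "\<And>x y. x \<in> M \<Longrightarrow> y \<in> M \<Longrightarrow> cinner (A x) y = cinner x (op_adj M A y)"
proof -
  obtain K where K: "K > 0" "\<And>x. x \<in> M \<Longrightarrow> norm (A x) \<le> K * norm x"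
    using bounded_opsE[OF A] by metis
  have "\<exists>w. w \<in> M \<and> (\<forall>x\<in>M. cinner (A x) y = cinner x w)" if "y \<in> M" for y
  proof -
    have "cmod (cinner (A x) y) \<le> K * norm y * norm x" if "x \<in> M" for x
      using norm_cinner_le[of "A x" y] mult_right_mono[OF K(2)[OF that], of "norm y"]
      by (simp add: mult_ac)
    then obtain w where "w \<in> M" "\<And>x. x \<in> M \<Longrightarrow> cinner (A x) y = cinner x w"
      by (rule riesz_representation[OF M, of "\<lambda>x. cinner (A x) y" "K * norm y", rotated 2])
        (auto simp: bounded_opsD(2,3)[OF A] cinner_simps)
    then show ?thesis by blast
  qed
  then obtain B0 where B0: "\<And>y. y \<in> M \<Longrightarrow> B0 y \<in> M"
    "\<And>x y. x \<in> M \<Longrightarrow> y \<in> M \<Longrightarrow> cinner (A x) y = cinner x (B0 y)" by metis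
  define B where "B = op_restrict M B0"
  have B: "\<And>y. y \<in> M \<Longrightarrow> B y \<in> M" "\<And>y. y \<notin> M \<Longrightarrow> B y = 0"
    "\<And>x y. x \<in> M \<Longrightarrow> y \<in> M \<Longrightarrow> cinner (A x) y = cinner x (B y)"
    using B0 by (auto simp: B_def op_restrict_def)
  have uniq: "v = w" if "v \<in> M" "w \<in> M" "\<And>x. x \<in> M \<Longrightarrow> cinner x v = cinner x w" for v w
    using that(3)[of "v - w"] closed_csubspaceD(6)[OF M that(1,2)] cinner_self_eq_0D[of "v - w"]
    by (simp add: cinner_diff_right)
  have "B \<in> linear_ops M"
    unfolding linear_ops_def
  proof (intro CollectI conjI ballI allI impI B(1,2))
    fix x y assume "x \<in> M" "y \<in> M"
    then show "B (x + y) = B x + B y"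
      using closed_csubspaceD[OF M] B by (intro uniq) (auto simp: cinner_add_right simp flip: B(3))
  next
    fix c x assume "x \<in> M"
    then show "B (c *\<^sub>C x) = c *\<^sub>C B x"
      using closed_csubspaceD[OF M] B by (intro uniq) (auto simp: cinner_scaleC_right simp flip: B(3))
  qed
  moreover have "norm (B y) \<le> K * norm y" if "y \<in> M" for y
  proof -
    \<comment> \<open>Testing the defining identity with \<open>x = B y\<close> transfers the bound
      \<open>K\<close> from \<open>A\<close> to \<open>B\<close>.\<close>
    have "(norm (B y))\<^sup>2 = Re (cinner (A (B y)) y)"
      using B(3)[OF B(1)[OF that] that] by (simp add: cinner_self)
    also have "\<dots> \<le> norm (A (B y)) * norm y" using Re_cinner_le[of "A (B y)" y] by simp
    also have "\<dots> \<le> K * norm (B y) * norm y"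
      using K(2)[OF B(1)[OF that]] by (simp add: mult_right_mono)
    finally have "norm (B y) * norm (B y) \<le> norm (B y) * (K * norm y)"
      by (simp add: power2_eq_square mult_ac)
    then show ?thesis using K(1) by (cases "norm (B y) = 0") (auto simp: mult_le_cancel_left)
  qed
  ultimately have Bb: "B \<in> bounded_ops M" by (auto simp: bounded_ops_def)
  have "\<exists>!B. B \<in> bounded_ops M \<and> (\<forall>x\<in>M. \<forall>y\<in>M. cinner (A x) y = cinner x (B y))"
  proof (rule ex1I[of _ B])
    fix B' assume B': "B' \<in> bounded_ops M \<and> (\<forall>x\<in>M. \<forall>y\<in>M. cinner (A x) y = cinner x (B' y))"
    then have B'b: "B' \<in> bounded_ops M" by blast
    show "B' = B"
    proof (rule op_eqI[of M])
      fix y assume "y \<in> M"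
      then show "B' y = B y"
        using B' B(3) by (intro uniq bounded_opsD(1)[OF B'b] B(1)) metis+
    qed (use bounded_opsD(4)[OF B'b] B(2) in blast)+
  next
    show "B \<in> bounded_ops M \<and> (\<forall>x\<in>M. \<forall>y\<in>M. cinner (A x) y = cinner x (B y))"
      using Bb B(3) by blast
  qed
  from theI'[OF this] show "op_adj M A \<in> bounded_ops M"
    "\<And>x y. x \<in> M \<Longrightarrow> y \<in> M \<Longrightarrow> cinner (A x) y = cinner x (op_adj M A y)"
    unfolding op_adj_def by blast+
qed

text \<open>Uniqueness of the adjoint at a single vector: each adjoint rule below is proved by
  naming the value and checking it against inner products.\<close>

lemma op_adj_eqI:
  assumes A: "A \<in> bounded_ops M" and "y \<in> M" "w \<in> M" "\<And>x. x \<in> M \<Longrightarrow> cinner (A x) y = cinner x w"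
  shows "op_adj M A y = w"
proof -
  have "op_adj M A y - w \<in> M"
    using bounded_opsD(1)[OF op_adj_bounded[OF A]] assms closed_csubspaceD(6)[OF M] by blast
  then have "cinner (op_adj M A y - w) (op_adj M A y - w) = 0"
    using assms(4) cinner_op_adj[OF A _ assms(2)] by (simp add: cinner_diff_right)
  then show ?thesis using cinner_self_eq_0D by fastforce
qed

lemma cinner_op_adj_left:
  "A \<in> bounded_ops M \<Longrightarrow> x \<in> M \<Longrightarrow> y \<in> M \<Longrightarrow> cinner (op_adj M A x) y = cinner x (A y)"
  using cinner_op_adj[of A y x] by (metis cinner_commute)

lemma op_adj_op_adj: "A \<in> bounded_ops M \<Longrightarrow> x \<in> M \<Longrightarrow> op_adj M (op_adj M A) x = A x"
  by (rule op_adj_eqI) (simp_all add: op_adj_bounded cinner_op_adj_left bounded_opsD(1))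

lemma op_adj_add:
  "A \<in> bounded_ops M \<Longrightarrow> B \<in> bounded_ops M \<Longrightarrow> y \<in> M \<Longrightarrow>
    op_adj M (op_add A B) y = op_adj M A y + op_adj M B y"
  by (rule op_adj_eqI[OF bounded_ops_add])
    (auto simp: bounded_ops_add bounded_opsD(1)[OF op_adj_bounded] closed_csubspaceD[OF M]
      op_add_def cinner_simps cinner_op_adj)

lemma op_adj_scale:
  "A \<in> bounded_ops M \<Longrightarrow> y \<in> M \<Longrightarrow> op_adj M (op_scale c A) y = cnj c *\<^sub>C op_adj M A y"
  by (rule op_adj_eqI[OF bounded_ops_scale])
    (auto simp: bounded_ops_scale bounded_opsD(1)[OF op_adj_bounded] closed_csubspaceD[OF M]
      op_scale_def cinner_simps cinner_op_adj)

lemma op_adj_comp: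
  "A \<in> bounded_ops M \<Longrightarrow> B \<in> bounded_ops M \<Longrightarrow> y \<in> M \<Longrightarrow>
    op_adj M (A \<circ> B) y = op_adj M B (op_adj M A y)"
  by (rule op_adj_eqI[OF bounded_ops_comp])
    (auto simp: bounded_ops_comp bounded_opsD(1)[OF op_adj_bounded] bounded_opsD(1) cinner_op_adj)

lemma op_adj_id: "y \<in> M \<Longrightarrow> op_adj M (op_id M) y = y"
  by (rule op_adj_eqI[OF bounded_ops_id]) (auto simp: bounded_ops_id op_id_def op_restrict_def)

text \<open>Adjoints keep the error of a uniform approximation, by testing with the difference
  \<open>w\<close> itself. This lets the symbols of adjoints follow those of the operators to a norm
  limit.\<close>

lemma op_adj_diff_le:
  assumes A: "A \<in> bounded_ops M" and B: "B \<in> bounded_ops M"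
    and le: "\<And>x. x \<in> M \<Longrightarrow> norm (A x - B x) \<le> e * norm x" and y: "y \<in> M" and "e \<ge> 0"
  shows "norm (op_adj M A y - op_adj M B y) \<le> e * norm y"
proof -
  define w where "w = op_adj M A y - op_adj M B y"
  have w: "w \<in> M"
    using bounded_opsD(1)[OF op_adj_bounded] A B y closed_csubspaceD(6)[OF M] by (auto simp: w_def)
  have "cinner w w = cinner w (op_adj M A y) - cinner w (op_adj M B y)"
    by (simp add: w_def cinner_simps)
  also have "\<dots> = cinner (A w - B w) y"
    using cinner_op_adj[OF A w y] cinner_op_adj[OF B w y] by (simp add: cinner_simps)
  finally have "(norm w)\<^sup>2 = Re (cinner (A w - B w) y)" by (metis cinner_self Re_complex_of_real)
  also have "\<dots> \<le> norm (A w - B w) * norm y" using Re_cinner_le[of "A w - B w" y] by simp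
  also have "\<dots> \<le> e * norm w * norm y" using le[OF w] by (simp add: mult_right_mono)
  finally have "norm w * norm w \<le> norm w * (e * norm y)" by (simp add: power2_eq_square mult_ac)
  then show ?thesis unfolding w_def[symmetric]
    using \<open>e \<ge> 0\<close> by (cases "norm w = 0") (auto simp: mult_le_cancel_left)
qed

section \<open>Norm limits and unital C*-subalgebras\<close>

text \<open>Values stay in \<open>M\<close> because \<open>M\<close> is closed, and each linearity
  identity holds up to a multiple of the arbitrary error \<open>e\<close>, hence exactly.\<close>

lemma bounded_ops_uniform_limit:
  assumes app: "\<And>e::real. e > 0 \<Longrightarrow> \<exists>B\<in>bounded_ops M. \<forall>x\<in>M. norm (A x - B x) \<le> e * norm x"
    and off: "\<And>x. x \<notin> M \<Longrightarrow> A x = 0"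
  shows "A \<in> bounded_ops M"
proof -
  have "A x \<in> M" if x: "x \<in> M" for x
  proof -
    have "A x \<in> closure M" unfolding closure_approachable
    proof (intro allI impI)
      fix e :: real assume "e > 0"
      then have "e / (norm x + 1) > 0" by (simp add: add_nonneg_pos)
      then obtain B where B: "B \<in> bounded_ops M" "norm (A x - B x) \<le> e / (norm x + 1) * norm x"
        using app x by blast
      have "norm x + 1 > 0" by (simp add: add_nonneg_pos)
      then have "e / (norm x + 1) * norm x < e" using \<open>e > 0\<close> by (simp add: field_simps)
      then show "\<exists>y\<in>M. dist y (A x) < e"
        using B bounded_opsD(1)[OF B(1) x] by (metis dist_commute dist_norm le_less_trans)
    qed
    then show ?thesis using closed_csubspaceD(1)[OF M] by simp
  qed
  moreover have "A (x + y) = A x + A y" if "x \<in> M" "y \<in> M" for x y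
  proof (rule eq_if_norm_le_all)
    fix e :: real assume "e > 0"
    then obtain B where B: "B \<in> bounded_ops M" "\<And>x. x \<in> M \<Longrightarrow> norm (A x - B x) \<le> e * norm x"
      using app by blast
    have "A (x + y) - (A x + A y) = (A (x + y) - B (x + y)) - ((A x - B x) + (A y - B y))"
      using bounded_opsD(2)[OF B(1) that] by simp
    also have "norm \<dots> \<le> norm (A (x + y) - B (x + y)) + (norm (A x - B x) + norm (A y - B y))"
      by (smt (verit) norm_triangle_ineq norm_triangle_ineq4)
    also have "\<dots> \<le> e * (norm (x + y) + (norm x + norm y))"
      using B(2)[of "x + y"] B(2)[of x] B(2)[of y] that closed_csubspaceD(3)[OF M]
      by (simp add: distrib_left)
    finally show "norm (A (x + y) - (A x + A y)) \<le> e * (norm (x + y) + (norm x + norm y))" .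
  qed
  moreover have "A (c *\<^sub>C x) = c *\<^sub>C A x" if "x \<in> M" for c x
  proof (rule eq_if_norm_le_all)
    fix e :: real assume "e > 0"
    then obtain B where B: "B \<in> bounded_ops M" "\<And>x. x \<in> M \<Longrightarrow> norm (A x - B x) \<le> e * norm x"
      using app by blast
    have "A (c *\<^sub>C x) - c *\<^sub>C A x = (A (c *\<^sub>C x) - B (c *\<^sub>C x)) - c *\<^sub>C (A x - B x)"
      using bounded_opsD(3)[OF B(1) that] by (simp add: scaleC_simps)
    also have "norm \<dots> \<le> norm (A (c *\<^sub>C x) - B (c *\<^sub>C x)) + cmod c * norm (A x - B x)"
      by (metis norm_scaleC norm_triangle_ineq4)
    also have "\<dots> \<le> e * (norm (c *\<^sub>C x)) + cmod c * (e * norm x)"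
      using B(2)[of "c *\<^sub>C x"] B(2)[of x] that closed_csubspaceD(4)[OF M]
      by (intro add_mono mult_left_mono) auto
    also have "\<dots> = e * (norm (c *\<^sub>C x) + cmod c * norm x)" by (simp add: algebra_simps)
    finally show "norm (A (c *\<^sub>C x) - c *\<^sub>C A x) \<le> e * (norm (c *\<^sub>C x) + cmod c * norm x)" .
  qed
  moreover have "\<exists>K. \<forall>x\<in>M. norm (A x) \<le> K * norm x"
  proof -
    obtain B where B: "B \<in> bounded_ops M" "\<And>x. x \<in> M \<Longrightarrow> norm (A x - B x) \<le> 1 * norm x"
      using app[of 1] by auto
    obtain K where K: "\<And>x. x \<in> M \<Longrightarrow> norm (B x) \<le> K * norm x" using bounded_opsE[OF B(1)] by metis
    have "norm (A x) \<le> (K + 1) * norm x" if "x \<in> M" for x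
      using K[OF that] B(2)[OF that] norm_triangle_sub[of "A x" "B x"] by (simp add: algebra_simps)
    then show ?thesis by blast
  qed
  ultimately show ?thesis using off by (auto simp: bounded_ops_def linear_ops_def)
qed

lemma unital_cstar_subalgebraI:
  assumes "C \<subseteq> bounded_ops M" "op_id M \<in> C"
    "\<And>A B. A \<in> C \<Longrightarrow> B \<in> C \<Longrightarrow> op_add A B \<in> C" "\<And>A B. A \<in> C \<Longrightarrow> B \<in> C \<Longrightarrow> A \<circ> B \<in> C"
    "\<And>c A. A \<in> C \<Longrightarrow> op_scale c A \<in> C" "\<And>A. A \<in> C \<Longrightarrow> op_adj M A \<in> C"
    and lim: "\<And>A. A \<in> bounded_ops M \<Longrightarrow>
      (\<And>e. e > 0 \<Longrightarrow> \<exists>B\<in>C. \<forall>x\<in>M. norm (A x - B x) \<le> e * norm x) \<Longrightarrow> A \<in> C"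
  shows "unital_cstar_subalgebra M C"
  unfolding unital_cstar_subalgebra_def
proof (intro conjI ballI allI impI)
  fix A assume A: "A \<in> bounded_ops M" and *: "\<forall>e>0. \<exists>B\<in>C. op_norm M (op_diff A B) < e"
  show "A \<in> C"
  proof (rule lim[OF A])
    fix e :: real assume "e > 0"
    then obtain B where B: "B \<in> C" "op_norm M (op_diff A B) < e" using * by blast
    have "op_diff A B \<in> bounded_ops M"
      using A B(1) assms(1) by (auto simp: op_diff_eq_add intro!: bounded_ops_add bounded_ops_scale)
    from norm_le_op_norm[OF this] B(2) have "norm (A x - B x) \<le> e * norm x" if "x \<in> M" for x
      using that mult_right_mono[of "op_norm M (op_diff A B)" e "norm x"]
      by (fastforce simp: op_diff_def)
    with B(1) show "\<exists>B\<in>C. \<forall>x\<in>M. norm (A x - B x) \<le> e * norm x" by blast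
  qed
qed (use assms in auto)

lemma unital_cstar_subalgebraD:
  assumes C: "unital_cstar_subalgebra M C"
  shows "\<And>A. A \<in> C \<Longrightarrow> A \<in> bounded_ops M" "op_id M \<in> C"
    "\<And>A B. A \<in> C \<Longrightarrow> B \<in> C \<Longrightarrow> op_add A B \<in> C" "\<And>A B. A \<in> C \<Longrightarrow> B \<in> C \<Longrightarrow> A \<circ> B \<in> C"
    "\<And>c A. A \<in> C \<Longrightarrow> op_scale c A \<in> C" "\<And>A. A \<in> C \<Longrightarrow> op_adj M A \<in> C"
    "\<And>A B. A \<in> C \<Longrightarrow> B \<in> C \<Longrightarrow> op_diff A B \<in> C"
proof -
  show add: "op_add A B \<in> C" if "A \<in> C" "B \<in> C" for A B
    using that C by (auto simp: unital_cstar_subalgebra_def)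
  show scale: "op_scale c A \<in> C" if "A \<in> C" for c A
    using that C by (auto simp: unital_cstar_subalgebra_def)
  show "op_diff A B \<in> C" if "A \<in> C" "B \<in> C" for A B
    using that add scale by (simp add: op_diff_eq_add)
qed (use C in \<open>auto simp: unital_cstar_subalgebra_def\<close>)

text \<open>The closure clause of \<open>unital_cstar_subalgebra\<close> speaks of bounded limits
  and of \<open>op_norm\<close>; here boundedness is derived from the approximation, and the error
  is given pointwise.\<close>

lemma unital_cstar_subalgebra_limit:
  assumes C: "unital_cstar_subalgebra M C"
    and app: "\<And>e::real. e > 0 \<Longrightarrow> \<exists>B\<in>C. \<forall>x\<in>M. norm (A x - B x) \<le> e * norm x"
    and off: "\<And>x. x \<notin> M \<Longrightarrow> A x = 0"
  shows "A \<in> C"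
proof -
  have "A \<in> bounded_ops M"
    by (rule bounded_ops_uniform_limit) (use app unital_cstar_subalgebraD(1)[OF C] off in blast)+
  moreover have "\<exists>B\<in>C. op_norm M (op_diff A B) < e" if "e > 0" for e
  proof -
    \<comment> \<open>The supremum only inherits a weak inequality; halving \<open>e\<close>
      restores the strict one.\<close>
    obtain B where B: "B \<in> C" "\<And>x. x \<in> M \<Longrightarrow> norm (A x - B x) \<le> e / 2 * norm x"
      using app[OF half_gt_zero[OF \<open>e > 0\<close>]] by blast
    have "op_norm M (op_diff A B) \<le> e / 2"
      by (rule op_norm_le) (use B that in \<open>auto simp: op_diff_def\<close>)
    then show ?thesis using B(1) that by (intro bexI[of _ B]) auto
  qed
  ultimately show ?thesis using C by (auto simp: unital_cstar_subalgebra_def)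
qed

lemma unital_cstar_subalgebra_bounded_ops: "unital_cstar_subalgebra M (bounded_ops M)"
  by (rule unital_cstar_subalgebraI)
    (auto simp: bounded_ops_id bounded_ops_add bounded_ops_comp bounded_ops_scale op_adj_bounded)

lemma unital_cstar_subalgebra_cstar_generated:
  assumes A: "A \<in> bounded_ops M"
  shows "unital_cstar_subalgebra M (cstar_generated M A)"
proof (rule unital_cstar_subalgebraI)
  show "cstar_generated M A \<subseteq> bounded_ops M"
    unfolding cstar_generated_def using unital_cstar_subalgebra_bounded_ops A by blast
  fix B assume B: "\<And>e::real. e > 0 \<Longrightarrow> \<exists>B'\<in>cstar_generated M A. \<forall>x\<in>M. norm (B x - B' x) \<le> e * norm x"
    "B \<in> bounded_ops M"
  show "B \<in> cstar_generated M A" unfolding cstar_generated_def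
  proof (rule InterI, clarsimp)
    fix C assume C: "unital_cstar_subalgebra M C" "A \<in> C"
    show "B \<in> C"
    proof (rule unital_cstar_subalgebra_limit[OF C(1)])
      fix e :: real assume "e > 0"
      then show "\<exists>B'\<in>C. \<forall>x\<in>M. norm (B x - B' x) \<le> e * norm x"
        using B(1)[of e] C unfolding cstar_generated_def by blast
    qed (use bounded_opsD(4)[OF B(2)] in blast)
  qed
qed (auto simp: cstar_generated_def unital_cstar_subalgebraD)

text \<open>With \<open>Z = 1 - t U\<close> a contraction for small \<open>t\<close>, the partial sums \<open>W n\<close> of the Neumann series
  satisfy \<open>U (W n) = 1 - Z ^ n\<close>.\<close>

lemma cstar_inverse_coercive:
  assumes C: "unital_cstar_subalgebra M C" and U: "U \<in> C" and c: "c > 0"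
    and coercive: "\<And>x. x \<in> M \<Longrightarrow> c * (norm x)\<^sup>2 \<le> Re (cinner (U x) x)"
  shows "\<exists>V\<in>C. V \<circ> U = op_id M \<and> U \<circ> V = op_id M"
proof -
  note CD = unital_cstar_subalgebraD[OF C]
  have Ub: "U \<in> bounded_ops M" using CD(1) U .
  note U_in = bounded_opsD(1)[OF Ub]
  have lower: "c * norm x \<le> norm (U x)" if "x \<in> M" for x
  proof -
    have "c * (norm x)\<^sup>2 \<le> norm (U x) * norm x"
      using coercive[OF that] Re_cinner_le[of "U x" x] by linarith
    then have "norm x * (c * norm x) \<le> norm x * norm (U x)" by (simp add: power2_eq_square mult_ac)
    then show ?thesis by (cases "norm x = 0") (auto simp: mult_le_cancel_left)
  qed
  obtain K0 where K0: "K0 > 0" "\<And>x. x \<in> M \<Longrightarrow> norm (U x) \<le> K0 * norm x"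
    using bounded_opsE[OF Ub] by metis
  \<comment> \<open>Enlarging the bound to at least \<open>c\<close> makes
    \<open>1 - c^2 / K^2\<close> nonnegative, so \<open>r\<close> below is a genuine root.\<close>
  define K where "K = max K0 c"
  have K: "K > 0" "c \<le> K" "\<And>x. x \<in> M \<Longrightarrow> norm (U x) \<le> K * norm x"
  proof -
    show "norm (U x) \<le> K * norm x" if "x \<in> M" for x
      using K0(2)[OF that] mult_right_mono[of K0 K "norm x"] by (simp add: K_def)
  qed (use K0 in \<open>auto simp: K_def\<close>)
  \<comment> \<open>This \<open>t\<close> minimises \<open>1 - 2 t c + t^2 K^2\<close>, which bounds
    the squared norm of \<open>1 - t U\<close>; the minimum is \<open>r^2\<close>.\<close>
  define t where "t = c / K\<^sup>2"
  define r where "r = sqrt (1 - c\<^sup>2 / K\<^sup>2)"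
  have "c\<^sup>2 \<le> K\<^sup>2" using c K by simp
  then have "0 \<le> 1 - c\<^sup>2 / K\<^sup>2" "1 - c\<^sup>2 / K\<^sup>2 < 1" using c K by auto
  then have r: "0 \<le> r" "r < 1" "r\<^sup>2 = 1 - c\<^sup>2 / K\<^sup>2" by (auto simp: r_def)
  define Z where "Z = op_diff (op_id M) (op_scale (complex_of_real t) U)"
  have Z: "Z \<in> C" unfolding Z_def using CD(2,5,7) U by blast
  have Z_apply: "Z x = x - t *\<^sub>R U x" if "x \<in> M" for x
    using that by (simp add: Z_def op_diff_def op_id_def op_restrict_def op_scale_def scaleR_scaleC)
  note Z_in = bounded_opsD(1)[OF CD(1)[OF Z]]
  have Z_norm: "norm (Z x) \<le> r * norm x" if x: "x \<in> M" for x
  proof -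
    have "(norm (Z x))\<^sup>2 = (norm x)\<^sup>2 - 2 * t * Re (cinner (U x) x) + t\<^sup>2 * (norm (U x))\<^sup>2"
      unfolding Z_apply[OF x] norm_diff_square
      by (simp add: scaleR_scaleC cinner_simps power_mult_distrib cinner_commute[of x "U x"])
    also have "\<dots> \<le> (norm x)\<^sup>2 - 2 * t * (c * (norm x)\<^sup>2) + t\<^sup>2 * (K * norm x)\<^sup>2"
      using coercive[OF x] K(3)[OF x] c K(1)
      by (intro add_mono diff_mono mult_left_mono power_mono) (auto simp: t_def)
    also have "\<dots> = (r * norm x)\<^sup>2"
    proof -
      have *: "2 * t * (c * (norm x)\<^sup>2) = 2 * (c\<^sup>2 / K\<^sup>2 * (norm x)\<^sup>2)"
        "t\<^sup>2 * (K * norm x)\<^sup>2 = c\<^sup>2 / K\<^sup>2 * (norm x)\<^sup>2"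
        using K(1) by (simp_all add: t_def power2_eq_square)
      have "(r * norm x)\<^sup>2 = (1 - c\<^sup>2 / K\<^sup>2) * (norm x)\<^sup>2"
        by (simp only: power_mult_distrib r(3))
      then show ?thesis unfolding * left_diff_distrib by simp
    qed
    finally show ?thesis
      by (rule power2_le_imp_le) (simp add: r(1))
  qed
  \<comment> \<open>The zero operator is written as a multiple of the unit, so that membership in
    \<open>C\<close> follows from the algebra operations alone.\<close>
  define W where "W n = ((\<lambda>w. op_add (op_scale (complex_of_real t) (op_id M)) (Z \<circ> w)) ^^ n) (op_scale 0 (op_id M))"
    for n
  have W0: "W 0 = op_scale 0 (op_id M)"
    and WSuc: "W (Suc n) = op_add (op_scale (complex_of_real t) (op_id M)) (Z \<circ> W n)" for n
    by (simp_all add: W_def)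
  have W: "W n \<in> C" for n
    by (induction n) (auto simp: W0 WSuc intro!: CD(2-5) Z)
  note W_in = bounded_opsD(1)[OF CD(1)[OF W]]
  have Zn: "(Z ^^ n) x \<in> M" "norm ((Z ^^ n) x) \<le> r ^ n * norm x" if x: "x \<in> M" for n x
  proof (induction n)
    case (Suc n)
    case 1 show ?case using Z_in[OF Suc(1)] by simp
    case 2
    have "norm ((Z ^^ Suc n) x) \<le> r * norm ((Z ^^ n) x)" using Z_norm[OF Suc(1)] by simp
    also have "\<dots> \<le> r * (r ^ n * norm x)" using Suc(2) r(1) by (intro mult_left_mono) auto
    finally show ?case by (simp add: mult.assoc)
  qed (use x in auto)
  have UZ: "U (Z x) = Z (U x)" if "x \<in> M" for x
    using that U_in[OF that] closed_csubspaceD(7)[OF M U_in[OF that]]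
    by (simp add: Z_apply linear_ops_diff[OF M bounded_ops_linear[OF Ub]] bounded_opsD(3)[OF Ub] scaleR_scaleC)
  have UW: "U (W n x) = x - (Z ^^ n) x" if x: "x \<in> M" for n x
  proof (induction n)
    case 0 then show ?case
      using x linear_ops_zero[OF bounded_ops_linear[OF Ub]] by (simp add: W0 op_scale_def)
  next
    case (Suc n)
    have "U (W (Suc n) x) = t *\<^sub>R U x + Z (U (W n x))"
      using x UZ[OF W_in[OF x]] Z_in[OF W_in[OF x]] closed_csubspaceD(4)[OF M x]
      by (simp add: WSuc op_add_def op_scale_def op_id_def op_restrict_def scaleR_scaleC
          bounded_opsD(2,3)[OF Ub])
    also have "Z (U (W n x)) = Z x - (Z ^^ Suc n) x"
      using Suc x Zn(1)[OF x] by (simp add: linear_ops_diff[OF M bounded_ops_linear[OF CD(1)[OF Z]]])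
    finally show ?case using Z_apply[OF x] by simp
  qed
  \<comment> \<open>The key estimate, used twice: \<open>y = W m x\<close> shows that the partial
    sums are Cauchy, and \<open>y = V x\<close> shows that they converge to the inverse uniformly
    relative to \<open>norm x\<close>, which keeps the inverse in \<open>C\<close>.\<close>
  have near: "c * norm (y - W n x) \<le> norm (U y - x) + r ^ n * norm x" if "x \<in> M" "y \<in> M" for x y n
  proof -
    have "c * norm (y - W n x) \<le> norm (U (y - W n x))"
      using that W_in closed_csubspaceD(6)[OF M] by (intro lower) auto
    also have "U (y - W n x) = (U y - x) + (Z ^^ n) x"
      using that W_in by (simp add: linear_ops_diff[OF M bounded_ops_linear[OF Ub]] UW)
    also have "norm \<dots> \<le> norm (U y - x) + r ^ n * norm x"
      using norm_triangle_ineq[of "U y - x" "(Z ^^ n) x"] Zn(2)[OF that(1), of n] by simp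
    finally show ?thesis .
  qed
  have r_lim: "(\<lambda>n. r ^ n) \<longlonglongrightarrow> 0" using r by (intro LIMSEQ_realpow_zero) auto
  have "\<exists>v. v \<in> M \<and> U v = x" if x: "x \<in> M" for x
  proof -
    have dist_W: "c * dist (W m x) (W n x) \<le> r ^ m * norm x + r ^ n * norm x" for m n
      using near[OF x W_in[OF x], of m n] Zn(2)[OF x, of m] UW[OF x, of m]
      by (simp add: dist_norm)
    have "Cauchy (\<lambda>n. W n x)"
    proof (rule metric_CauchyI)
      fix e :: real assume "e > 0"
      have "(\<lambda>n. r ^ n * norm x) \<longlonglongrightarrow> 0 * norm x" by (intro tendsto_intros r_lim)
      then have "\<forall>\<^sub>F n in sequentially. r ^ n * norm x < c * e / 2"
        using \<open>e > 0\<close> c by (intro order_tendstoD) auto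
      then obtain N where N: "\<And>n. n \<ge> N \<Longrightarrow> r ^ n * norm x < c * e / 2"
        by (auto simp: eventually_sequentially)
      have "dist (W m x) (W n x) < e" if "m \<ge> N" "n \<ge> N" for m n
      proof -
        have "c * dist (W m x) (W n x) < c * e"
          using dist_W[of m n] N[OF that(1)] N[OF that(2)] by simp
        then show ?thesis using c by simp
      qed
      then show "\<exists>N. \<forall>m\<ge>N. \<forall>n\<ge>N. dist (W m x) (W n x) < e" by blast
    qed
    then obtain v where v: "(\<lambda>n. W n x) \<longlonglongrightarrow> v" using Cauchy_convergent convergent_def by blast
    have vM: "v \<in> M" by (rule closed_sequentially[OF closed_csubspaceD(1)[OF M] W_in[OF x] v])
    have "(\<lambda>n. K * norm (v - W n x) + r ^ n * norm x) \<longlonglongrightarrow> K * norm (v - v) + 0 * norm x"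
      by (intro tendsto_intros v r_lim)
    moreover have "norm (U v - x) \<le> K * norm (v - W n x) + r ^ n * norm x" for n
    proof -
      have "U v - x = U (v - W n x) - (Z ^^ n) x"
        using vM W_in[OF x] by (simp add: linear_ops_diff[OF M bounded_ops_linear[OF Ub]] UW[OF x])
      also have "norm \<dots> \<le> norm (U (v - W n x)) + norm ((Z ^^ n) x)" by (rule norm_triangle_ineq4)
      finally show ?thesis
        using K(3)[of "v - W n x"] Zn(2)[OF x, of n] vM W_in[OF x, of n] closed_csubspaceD(6)[OF M]
        by fastforce
    qed
    ultimately have "norm (U v - x) \<le> 0" by (intro LIMSEQ_le_const) auto
    then show ?thesis using vM by auto
  qed
  then obtain V0 where V0: "\<And>x. x \<in> M \<Longrightarrow> V0 x \<in> M" "\<And>x. x \<in> M \<Longrightarrow> U (V0 x) = x" by metis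
  define V where "V = op_restrict M V0"
  have V: "V x \<in> M" "U (V x) = x" if "x \<in> M" for x using V0 that by (auto simp: V_def op_restrict_def)
  have V_off: "V x = 0" if "x \<notin> M" for x using that by (auto simp: V_def op_restrict_def)
  have "V \<in> C"
  proof (rule unital_cstar_subalgebra_limit[OF C])
    fix e :: real assume "e > 0"
    then have "\<forall>\<^sub>F n in sequentially. r ^ n < c * e"
      using c by (intro order_tendstoD[OF r_lim]) auto
    then obtain n where n: "r ^ n < c * e" by (auto simp: eventually_sequentially)
    have "norm (V x - W n x) \<le> e * norm x" if "x \<in> M" for x
    proof -
      have "c * norm (V x - W n x) \<le> r ^ n * norm x" using near[OF that V(1)[OF that], of n] V(2)[OF that] by simp
      also have "\<dots> \<le> (c * e) * norm x" using n by (intro mult_right_mono) auto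
      finally show ?thesis using c by (simp add: mult.assoc)
    qed
    then show "\<exists>B\<in>C. \<forall>x\<in>M. norm (V x - B x) \<le> e * norm x" using W by blast
  qed (rule V_off)
  moreover have "V (U x) = x" if "x \<in> M" for x
  proof -
    have "c * norm (V (U x) - x) \<le> norm (U (V (U x) - x))"
      using that V(1) U_in closed_csubspaceD(6)[OF M] by (intro lower) auto
    also have "U (V (U x) - x) = 0"
      using that V U_in by (simp add: linear_ops_diff[OF M bounded_ops_linear[OF Ub]])
    finally show ?thesis using c by (simp add: mult_le_0_iff)
  qed
  ultimately show ?thesis
    using V V_off bounded_opsD(4)[OF Ub] linear_ops_zero[OF bounded_ops_linear[OF Ub]]
      linear_ops_zero[OF bounded_ops_linear[OF CD(1)[of V]]]
    by (intro bexI[of _ V]) (auto simp: op_id_def op_restrict_def fun_eq_iff)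
qed

end

section \<open>Approximate eigenvectors of a normal operator\<close>

text \<open>A filter treats all approximate eigenvectors for \<open>z\<close> at once, with no
  sequence to be chosen; symbols of operators can then be described by limits along it.\<close>

definition approx_eigenfilter ::
    "'h::complex_hilbert_space set \<Rightarrow> ('h \<Rightarrow> 'h) \<Rightarrow> complex \<Rightarrow> 'h filter" where
  "approx_eigenfilter M A z =
     inf (filtercomap (\<lambda>x. norm (A x - z *\<^sub>C x)) (nhds 0)) (principal {x \<in> M. norm x = 1})"

text \<open>This is the approximate point spectrum: the filter is proper exactly when some unit
  vectors of \<open>M\<close> have arbitrarily small residual.\<close>

definition approx_spectrum ::
    "'h::complex_hilbert_space set \<Rightarrow> ('h \<Rightarrow> 'h) \<Rightarrow> complex set" where
  "approx_spectrum M A = {z. approx_eigenfilter M A z \<noteq> bot}"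

text \<open>The condition on the adjoint is built in so that the operators having a symbol are
  visibly closed under adjoints.\<close>

definition approx_eigenvalue ::
    "'h::complex_hilbert_space set \<Rightarrow> 'h filter \<Rightarrow> ('h \<Rightarrow> 'h) \<Rightarrow> complex \<Rightarrow> bool" where
  "approx_eigenvalue M F B c \<longleftrightarrow>
     ((\<lambda>x. B x - c *\<^sub>C x) \<longlongrightarrow> 0) F \<and> ((\<lambda>x. op_adj M B x - cnj c *\<^sub>C x) \<longlongrightarrow> 0) F"

lemma eventually_approx_eigenfilter:
  "eventually P (approx_eigenfilter M A z) \<longleftrightarrow>
     (\<exists>d>0. \<forall>x\<in>M. norm x = 1 \<longrightarrow> norm (A x - z *\<^sub>C x) < d \<longrightarrow> P x)"
proof
  assume "eventually P (approx_eigenfilter M A z)"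
  then obtain Q where Q: "eventually Q (nhds (0::real))"
    "\<And>x. Q (norm (A x - z *\<^sub>C x)) \<Longrightarrow> x \<in> M \<Longrightarrow> norm x = 1 \<Longrightarrow> P x"
    by (auto simp: approx_eigenfilter_def eventually_inf_principal eventually_filtercomap)
  then obtain d where "d > 0" "\<And>r. \<bar>r\<bar> < d \<Longrightarrow> Q r"
    by (auto simp: eventually_nhds_metric dist_real_def)
  with Q(2) show "\<exists>d>0. \<forall>x\<in>M. norm x = 1 \<longrightarrow> norm (A x - z *\<^sub>C x) < d \<longrightarrow> P x"
    by (intro exI[of _ d]) auto
next
  assume "\<exists>d>0. \<forall>x\<in>M. norm x = 1 \<longrightarrow> norm (A x - z *\<^sub>C x) < d \<longrightarrow> P x"
  then obtain d where d: "d > 0" "\<forall>x\<in>M. norm x = 1 \<longrightarrow> norm (A x - z *\<^sub>C x) < d \<longrightarrow> P x"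
    by blast
  have "eventually (\<lambda>r. r < d) (nhds (0::real))"
    using d(1) by (intro order_tendstoD(2)[of "\<lambda>r. r" 0]) (simp_all add: filterlim_ident)
  then show "eventually P (approx_eigenfilter M A z)"
    using d(2) unfolding approx_eigenfilter_def eventually_inf_principal eventually_filtercomap
    by (intro exI[of _ "\<lambda>r. r < d"]) auto
qed

lemma eventually_unit_approx_eigenfilter:
  "\<forall>\<^sub>F x in approx_eigenfilter M A z. x \<in> M \<and> norm x = 1"
  unfolding eventually_approx_eigenfilter by (intro exI[of _ 1]) auto

lemma tendsto_0_normI:
  assumes "(g \<longlongrightarrow> (0::real)) F" "\<forall>\<^sub>F x in F. norm (f x) \<le> g x"
  shows "(f \<longlongrightarrow> (0 :: 'b::real_normed_vector)) F"
  using assms by (rule Lim_null_comparison[rotated])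

context
  fixes M :: "'h::complex_hilbert_space set"
  assumes M: "closed_csubspace M"
begin

section \<open>Calculus of approximate eigenvalues\<close>

lemma notin_approx_spectrum_iff:
  assumes A: "A \<in> linear_ops M"
  shows "z \<notin> approx_spectrum M A \<longleftrightarrow> (\<exists>d>0. \<forall>x\<in>M. d * norm x \<le> norm (A x - z *\<^sub>C x))"
proof -
  have "z \<notin> approx_spectrum M A \<longleftrightarrow> (\<exists>d>0. \<forall>x\<in>M. norm x = 1 \<longrightarrow> d \<le> norm (A x - z *\<^sub>C x))"
    by (simp add: approx_spectrum_def trivial_limit_def eventually_approx_eigenfilter) (meson not_less)
  also have "\<dots> \<longleftrightarrow> (\<exists>d>0. \<forall>x\<in>M. d * norm x \<le> norm (A x - z *\<^sub>C x))"
  proof safe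
    fix d :: real assume d: "d > 0" "\<forall>x\<in>M. norm x = 1 \<longrightarrow> d \<le> norm (A x - z *\<^sub>C x)"
    have "d * norm x \<le> norm (A x - z *\<^sub>C x)" if x: "x \<in> M" for x
    proof (cases "x = 0")
      case False
      define c where "c = complex_of_real (1 / norm x)"
      have "d \<le> norm (A (c *\<^sub>C x) - z *\<^sub>C c *\<^sub>C x)"
        using d(2) closed_csubspaceD(4)[OF M x] False by (auto simp: c_def norm_divide)
      also have "A (c *\<^sub>C x) - z *\<^sub>C c *\<^sub>C x = c *\<^sub>C (A x - z *\<^sub>C x)"
        using linear_opsD(3)[OF A x] by (simp add: scaleC_simps mult.commute)
      also have "norm \<dots> = norm (A x - z *\<^sub>C x) / norm x"
        by (simp add: c_def norm_divide)
      finally show ?thesis using False by (simp add: field_simps)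
    qed simp
    then show "\<exists>d>0. \<forall>x\<in>M. d * norm x \<le> norm (A x - z *\<^sub>C x)" using d(1) by blast
  next
    fix d :: real assume "d > 0" "\<forall>x\<in>M. d * norm x \<le> norm (A x - z *\<^sub>C x)"
    then show "\<exists>d>0. \<forall>x\<in>M. norm x = 1 \<longrightarrow> d \<le> norm (A x - z *\<^sub>C x)" by (metis mult.right_neutral)
  qed
  finally show ?thesis .
qed

text \<open>On unit vectors \<open>c - c'\<close> has the size of \<open>(c - c') x\<close>, which
  is \<open>B x - B' x\<close> up to vanishing residuals. With \<open>e = 0\<close> and
  \<open>B = B'\<close> this is uniqueness of the eigenvalue; with \<open>e > 0\<close> it bounds
  the distance of symbols independently of the point of the spectrum.\<close>

lemma approx_eigenvalue_dist_le:
  assumes F: "F \<noteq> bot" "\<forall>\<^sub>F x in F. x \<in> M \<and> norm x = 1"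
    and lim: "((\<lambda>x. B x - c *\<^sub>C x) \<longlongrightarrow> 0) F" "((\<lambda>x. B' x - c' *\<^sub>C x) \<longlongrightarrow> 0) F"
    and le: "\<And>x. x \<in> M \<Longrightarrow> norm (B x - B' x) \<le> e * norm x"
  shows "cmod (c - c') \<le> e"
proof (rule tendsto_lowerbound[OF _ _ F(1)])
  show "((\<lambda>x. norm (B x - c *\<^sub>C x) + norm (B' x - c' *\<^sub>C x) + e) \<longlongrightarrow> e) F"
    using tendsto_add[OF tendsto_add[OF tendsto_norm[OF lim(1)] tendsto_norm[OF lim(2)]] tendsto_const[of e]]
    by simp
  show "\<forall>\<^sub>F x in F. cmod (c - c') \<le> norm (B x - c *\<^sub>C x) + norm (B' x - c' *\<^sub>C x) + e"
    using F(2)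
  proof eventually_elim
    case (elim x)
    have "cmod (c - c') = norm ((c - c') *\<^sub>C x)" using elim by simp
    also have "(c - c') *\<^sub>C x = (B' x - c' *\<^sub>C x) - (B x - c *\<^sub>C x) + (B x - B' x)"
      by (simp add: scaleC_simps)
    also have "norm \<dots> \<le> norm (B x - c *\<^sub>C x) + norm (B' x - c' *\<^sub>C x) + norm (B x - B' x)"
      by (smt (verit) norm_triangle_ineq norm_triangle_ineq4)
    finally show ?case using le[of x] elim by simp
  qed
qed

text \<open>The residual splits as \<open>B (B' x - c' x) + c' (B x - c x)\<close>; boundedness of
  \<open>B\<close> carries the first part to 0.\<close>

lemma approx_eigenvalue_comp:
  assumes F: "\<forall>\<^sub>F x in F. x \<in> M \<and> norm x = 1"
    and B: "B \<in> bounded_ops M" "B' \<in> bounded_ops M"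
    and lim: "((\<lambda>x. B x - c *\<^sub>C x) \<longlongrightarrow> 0) F" "((\<lambda>x. B' x - c' *\<^sub>C x) \<longlongrightarrow> 0) F"
  shows "((\<lambda>x. B (B' x) - (c * c') *\<^sub>C x) \<longlongrightarrow> 0) F"
proof -
  obtain K where K: "K > 0" "\<And>x. x \<in> M \<Longrightarrow> norm (B x) \<le> K * norm x"
    using bounded_opsE[OF B(1)] by metis
  show ?thesis
  proof (rule tendsto_0_normI)
    show "((\<lambda>x. K * norm (B' x - c' *\<^sub>C x) + cmod c' * norm (B x - c *\<^sub>C x)) \<longlongrightarrow> 0) F"
      using tendsto_add[OF tendsto_mult_left[OF tendsto_norm[OF lim(2)], of K]
        tendsto_mult_left[OF tendsto_norm[OF lim(1)], of "cmod c'"]] by simp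
    show "\<forall>\<^sub>F x in F. norm (B (B' x) - (c * c') *\<^sub>C x)
        \<le> K * norm (B' x - c' *\<^sub>C x) + cmod c' * norm (B x - c *\<^sub>C x)"
      using F
    proof eventually_elim
      case (elim x)
      then have x: "x \<in> M" by simp
      have "B (B' x) - (c * c') *\<^sub>C x = B (B' x - c' *\<^sub>C x) + c' *\<^sub>C (B x - c *\<^sub>C x)"
        using x bounded_opsD(1)[OF B(2) x] closed_csubspaceD(4)[OF M x]
        by (simp add: linear_ops_diff[OF M bounded_ops_linear[OF B(1)]] bounded_opsD(3)[OF B(1)]
            scaleC_simps mult.commute)
      also have "norm \<dots> \<le> norm (B (B' x - c' *\<^sub>C x)) + cmod c' * norm (B x - c *\<^sub>C x)"
        using norm_triangle_ineq[of "B (B' x - c' *\<^sub>C x)" "c' *\<^sub>C (B x - c *\<^sub>C x)"] by simp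
      also have "norm (B (B' x - c' *\<^sub>C x)) \<le> K * norm (B' x - c' *\<^sub>C x)"
        using x bounded_opsD(1)[OF B(2) x] closed_csubspaceD(4,6)[OF M] by (intro K(2)) auto
      finally show ?case by simp
    qed
  qed
qed

text \<open>A normal operator and its adjoint have equal norm at every vector, and the cross terms
  with \<open>z\<close> have equal real part; so the equality persists for the translate by
  \<open>z\<close>.\<close>

lemma normal_norm_eq:
  assumes A: "A \<in> bounded_ops M"
    and normal: "\<And>x. x \<in> M \<Longrightarrow> A (op_adj M A x) = op_adj M A (A x)" and x: "x \<in> M"
  shows "norm (A x - z *\<^sub>C x) = norm (op_adj M A x - cnj z *\<^sub>C x)"
proof -
  have Ax: "A x \<in> M" "op_adj M A x \<in> M"
    using x A bounded_opsD(1) op_adj_bounded[OF M A] by blast+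
  have "cinner (A x) (A x) = cinner x (op_adj M A (A x))" by (rule cinner_op_adj[OF M A x Ax(1)])
  also have "\<dots> = cinner x (A (op_adj M A x))" using normal[OF x] by simp
  also have "\<dots> = cinner (op_adj M A x) (op_adj M A x)"
    by (rule cinner_op_adj_left[OF M A x Ax(2), symmetric])
  finally have "cinner (A x) (A x) = cinner (op_adj M A x) (op_adj M A x)" .
  then have 1: "(norm (A x))\<^sup>2 = (norm (op_adj M A x))\<^sup>2"
    by (simp only: cinner_self of_real_eq_iff)
  have "Re (cinner (A x) (z *\<^sub>C x)) = Re (cinner (op_adj M A x) (cnj z *\<^sub>C x))"
    using cinner_op_adj_left[OF M A x x] cinner_commute[of x "A x"] by (simp add: cinner_simps)
  then have "(norm (A x - z *\<^sub>C x))\<^sup>2 = (norm (op_adj M A x - cnj z *\<^sub>C x))\<^sup>2"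
    unfolding norm_diff_square by (simp add: 1)
  then show ?thesis by (simp add: power2_eq_iff_nonneg)
qed

lemma approx_eigenvalue_self:
  assumes A: "A \<in> bounded_ops M"
    and normal: "\<And>x. x \<in> M \<Longrightarrow> A (op_adj M A x) = op_adj M A (A x)"
  shows "approx_eigenvalue M (approx_eigenfilter M A z) A z"
proof -
  have lim: "((\<lambda>x. norm (A x - z *\<^sub>C x)) \<longlongrightarrow> 0) (approx_eigenfilter M A z)"
    unfolding approx_eigenfilter_def
    by (rule tendsto_mono[OF inf_le1]) (rule filterlim_filtercomap)
  have "\<forall>\<^sub>F x in approx_eigenfilter M A z. norm (op_adj M A x - cnj z *\<^sub>C x) \<le> norm (A x - z *\<^sub>C x)"
    using eventually_unit_approx_eigenfilter
    by eventually_elim (simp add: normal_norm_eq[OF A normal])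
  then show ?thesis
    unfolding approx_eigenvalue_def using lim by (auto intro: tendsto_0_normI tendsto_norm_zero_cancel)
qed

text \<open>The operators possessing a continuous symbol form a \<open>C\<^sup>*\<close>-algebra, so all elements of
  \<open>cstar_generated M A\<close> have one: this is the Gelfand transform.\<close>

lemma gelfand_symbol:
  assumes A: "A \<in> bounded_ops M"
    and normal: "\<And>x. x \<in> M \<Longrightarrow> A (op_adj M A x) = op_adj M A (A x)"
    and B: "B \<in> cstar_generated M A"
  shows "\<exists>f. continuous_on (approx_spectrum M A) f \<and>
    (\<forall>z\<in>approx_spectrum M A. approx_eigenvalue M (approx_eigenfilter M A z) B (f z))"
proof -
  let ?F = "approx_eigenfilter M A" and ?sp = "approx_spectrum M A"
  define S where "S = {B \<in> bounded_ops M. \<exists>f. continuous_on ?sp f \<and>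
    (\<forall>z\<in>?sp. approx_eigenvalue M (?F z) B (f z))}"
  note unit = eventually_unit_approx_eigenfilter[of M A]
  have SI: "B \<in> S" if "B \<in> bounded_ops M" "continuous_on ?sp f"
    "\<And>z. z \<in> ?sp \<Longrightarrow> ((\<lambda>x. B x - f z *\<^sub>C x) \<longlongrightarrow> 0) (?F z)"
    "\<And>z. z \<in> ?sp \<Longrightarrow> ((\<lambda>x. op_adj M B x - cnj (f z) *\<^sub>C x) \<longlongrightarrow> 0) (?F z)" for B f
    using that unfolding S_def approx_eigenvalue_def by blast
  have SE: "B \<in> bounded_ops M" "\<exists>f. continuous_on ?sp f \<and>
      (\<forall>z\<in>?sp. ((\<lambda>x. B x - f z *\<^sub>C x) \<longlongrightarrow> 0) (?F z)) \<and>
      (\<forall>z\<in>?sp. ((\<lambda>x. op_adj M B x - cnj (f z) *\<^sub>C x) \<longlongrightarrow> 0) (?F z))" if "B \<in> S" for B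
    using that unfolding S_def approx_eigenvalue_def by blast+
  \<comment> \<open>Norm closure is the analytic core: symbols of close operators are uniformly
    close on the spectrum, so those of approximants converge uniformly to a continuous
    function.\<close>
  have S_lim: "B \<in> S" if Bb: "B \<in> bounded_ops M"
    and app: "\<And>e. e > 0 \<Longrightarrow> \<exists>B'\<in>S. \<forall>x\<in>M. norm (B x - B' x) \<le> e * norm x" for B
  proof -
    define good where "good n B' f \<longleftrightarrow>
      B' \<in> bounded_ops M \<and> (\<forall>x\<in>M. norm (B x - B' x) \<le> 1 / real (Suc n) * norm x) \<and>
      continuous_on ?sp f \<and> (\<forall>z\<in>?sp. ((\<lambda>x. B' x - f z *\<^sub>C x) \<longlongrightarrow> 0) (?F z)) \<and>
      (\<forall>z\<in>?sp. ((\<lambda>x. op_adj M B' x - cnj (f z) *\<^sub>C x) \<longlongrightarrow> 0) (?F z))" for n B' f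
    have "\<exists>B' f. good n B' f" for n
    proof -
      have "1 / real (Suc n) > 0" by simp
      from app[OF this] obtain B' where "B' \<in> S" "\<forall>x\<in>M. norm (B x - B' x) \<le> 1 / real (Suc n) * norm x"
        by blast
      then show ?thesis using SE[of B'] unfolding good_def by blast
    qed
    then obtain Bn fn where good: "\<And>n. good n (Bn n) (fn n)" by metis
    have Bn: "\<And>n. Bn n \<in> bounded_ops M"
      "\<And>n x. x \<in> M \<Longrightarrow> norm (B x - Bn n x) \<le> 1 / real (Suc n) * norm x"
      and fn: "\<And>n. continuous_on ?sp (fn n)"
      "\<And>n z. z \<in> ?sp \<Longrightarrow> ((\<lambda>x. Bn n x - fn n z *\<^sub>C x) \<longlongrightarrow> 0) (?F z)"
      "\<And>n z. z \<in> ?sp \<Longrightarrow> ((\<lambda>x. op_adj M (Bn n) x - cnj (fn n z) *\<^sub>C x) \<longlongrightarrow> 0) (?F z)"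
      using good unfolding good_def by blast+
    have close: "cmod (fn m z - fn n z) \<le> 1 / real (Suc m) + 1 / real (Suc n)" if z: "z \<in> ?sp" for m n z
    proof (rule approx_eigenvalue_dist_le[OF _ unit fn(2)[OF z] fn(2)[OF z]])
      show "?F z \<noteq> bot" using z by (simp add: approx_spectrum_def)
      fix x assume x: "x \<in> M"
      have "norm (Bn m x - Bn n x) \<le> norm (B x - Bn m x) + norm (B x - Bn n x)"
        using norm_triangle_ineq4[of "B x - Bn n x" "B x - Bn m x"] by simp
      then show "norm (Bn m x - Bn n x) \<le> (1 / real (Suc m) + 1 / real (Suc n)) * norm x"
        using Bn(2)[OF x, of m] Bn(2)[OF x, of n] by (simp add: distrib_right)
    qed
    have inv_lim: "(\<lambda>n. 1 / real (Suc n)) \<longlonglongrightarrow> 0" by (intro LIMSEQ_Suc[OF lim_const_over_n])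
    have "uniformly_Cauchy_on ?sp fn"
    proof (rule uniformly_Cauchy_onI)
      fix e :: real assume "e > 0"
      then have "\<forall>\<^sub>F n in sequentially. 1 / real (Suc n) < e / 2"
        by (intro order_tendstoD(2)[OF inv_lim]) simp
      then obtain N where N: "\<And>n. n \<ge> N \<Longrightarrow> 1 / real (Suc n) < e / 2"
        unfolding eventually_sequentially by blast
      have "dist (fn m z) (fn n z) < e" if "z \<in> ?sp" "m \<ge> N" "n \<ge> N" for z m n
        using close[OF that(1), of m n] N[OF that(2)] N[OF that(3)] unfolding dist_norm by linarith
      then show "\<exists>N. \<forall>z\<in>?sp. \<forall>m\<ge>N. \<forall>n\<ge>N. dist (fn m z) (fn n z) < e" by blast
    qed
    then obtain f where f: "uniform_limit ?sp fn f sequentially"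
      using Cauchy_uniformly_convergent unfolding uniformly_convergent_on_def by blast
    have f_cont: "continuous_on ?sp f"
      by (rule uniform_limit_theorem[OF _ f]) (simp_all add: fn(1))
    have close_f: "cmod (fn n z - f z) \<le> 1 / real (Suc n)" if z: "z \<in> ?sp" for n z
    proof (rule tendsto_le[OF sequentially_bot])
      show "(\<lambda>m. cmod (fn n z - fn m z)) \<longlonglongrightarrow> cmod (fn n z - f z)"
        by (intro tendsto_intros tendsto_uniform_limitI[OF f z])
      show "(\<lambda>m. 1 / real (Suc n) + 1 / real (Suc m)) \<longlonglongrightarrow> 1 / real (Suc n)"
        using tendsto_add[OF tendsto_const inv_lim] by simp
    qed (use close[OF z] in simp)
    \<comment> \<open>A three-epsilon argument in generic form, to be applied to \<open>B\<close>
      and again to its adjoint.\<close>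
    have limit: "((\<lambda>x. Y x - y *\<^sub>C x) \<longlongrightarrow> 0) (?F z)"
      if Yn: "\<And>n. ((\<lambda>x. Yn n x - yn n *\<^sub>C x) \<longlongrightarrow> 0) (?F z)"
        and Y: "\<And>n x. x \<in> M \<Longrightarrow> norm (Y x - Yn n x) \<le> 1 / real (Suc n) * norm x"
        and y: "\<And>n. cmod (yn n - y) \<le> 1 / real (Suc n)" for Y Yn y yn z
      unfolding tendsto_iff
    proof (intro allI impI)
      fix e :: real assume "e > 0"
      then have "\<forall>\<^sub>F n in sequentially. 1 / real (Suc n) < e / 3"
        by (intro order_tendstoD(2)[OF inv_lim]) simp
      then obtain n where n: "1 / real (Suc n) < e / 3"
        unfolding eventually_sequentially by blast
      have "\<forall>\<^sub>F x in ?F z. dist (Yn n x - yn n *\<^sub>C x) 0 < e / 3"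
        using Yn[of n] \<open>e > 0\<close> unfolding tendsto_iff by (metis divide_pos_pos zero_less_numeral)
      then show "\<forall>\<^sub>F x in ?F z. dist (Y x - y *\<^sub>C x) 0 < e"
        using unit[of z]
      proof eventually_elim
        case (elim x)
        have "Y x - y *\<^sub>C x = (Yn n x - yn n *\<^sub>C x) + (Y x - Yn n x) + (yn n - y) *\<^sub>C x"
          by (simp add: scaleC_simps)
        also have "norm \<dots> \<le> norm (Yn n x - yn n *\<^sub>C x) + norm (Y x - Yn n x) + norm ((yn n - y) *\<^sub>C x)"
          by (intro norm_triangle_le add_mono) auto
        also have "\<dots> < e / 3 + e / 3 + e / 3"
          using elim Y[of x n] y[of n] n by (intro add_strict_mono) auto
        finally show ?case by simp
      qed
    qed
    show "B \<in> S"
    proof (rule SI[OF Bb f_cont])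
      fix z assume z: "z \<in> ?sp"
      show "((\<lambda>x. B x - f z *\<^sub>C x) \<longlongrightarrow> 0) (?F z)"
        by (rule limit[OF fn(2)[OF z] Bn(2) close_f[OF z]])
      show "((\<lambda>x. op_adj M B x - cnj (f z) *\<^sub>C x) \<longlongrightarrow> 0) (?F z)"
      proof (rule limit[OF fn(3)[OF z]])
        show "norm (op_adj M B x - op_adj M (Bn n) x) \<le> 1 / real (Suc n) * norm x" if "x \<in> M" for n x
          using that by (intro op_adj_diff_le[OF M Bb Bn(1) Bn(2)]) auto
        show "cmod (cnj (fn n z) - cnj (f z)) \<le> 1 / real (Suc n)" for n
          using close_f[OF z, of n] by (metis complex_cnj_diff complex_mod_cnj)
      qed
    qed
  qed
  have "unital_cstar_subalgebra M S"
  proof (rule unital_cstar_subalgebraI[OF M])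
    show "S \<subseteq> bounded_ops M" unfolding S_def by blast
    show "op_id M \<in> S"
    proof (rule SI[OF bounded_ops_id[OF M], of "\<lambda>_. 1"])
      fix z
      have ev: "\<forall>\<^sub>F x in ?F z. norm (op_id M x - 1 *\<^sub>C x) \<le> 0"
        "\<forall>\<^sub>F x in ?F z. norm (op_adj M (op_id M) x - cnj 1 *\<^sub>C x) \<le> 0"
        using unit[of z] by (eventually_elim, simp add: op_id_def op_restrict_def scaleC_one)
          (use unit[of z] in \<open>eventually_elim, simp add: op_adj_id[OF M] scaleC_one\<close>)
      show "((\<lambda>x. op_id M x - 1 *\<^sub>C x) \<longlongrightarrow> 0) (?F z)"
        by (rule tendsto_0_normI[OF tendsto_const ev(1)])
      show "((\<lambda>x. op_adj M (op_id M) x - cnj 1 *\<^sub>C x) \<longlongrightarrow> 0) (?F z)"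
        by (rule tendsto_0_normI[OF tendsto_const ev(2)])
    qed simp
  next
    fix B B' assume "B \<in> S" "B' \<in> S"
    note Bb = SE(1)[OF \<open>B \<in> S\<close>] SE(1)[OF \<open>B' \<in> S\<close>]
    obtain f where f: "continuous_on ?sp f"
      "\<And>z. z \<in> ?sp \<Longrightarrow> ((\<lambda>x. B x - f z *\<^sub>C x) \<longlongrightarrow> 0) (?F z)"
      "\<And>z. z \<in> ?sp \<Longrightarrow> ((\<lambda>x. op_adj M B x - cnj (f z) *\<^sub>C x) \<longlongrightarrow> 0) (?F z)"
      using SE(2)[OF \<open>B \<in> S\<close>] by blast
    obtain g where g: "continuous_on ?sp g"
      "\<And>z. z \<in> ?sp \<Longrightarrow> ((\<lambda>x. B' x - g z *\<^sub>C x) \<longlongrightarrow> 0) (?F z)"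
      "\<And>z. z \<in> ?sp \<Longrightarrow> ((\<lambda>x. op_adj M B' x - cnj (g z) *\<^sub>C x) \<longlongrightarrow> 0) (?F z)"
      using SE(2)[OF \<open>B' \<in> S\<close>] by blast
    show "op_add B B' \<in> S"
    proof (rule SI[OF bounded_ops_add[OF M Bb], of "\<lambda>z. f z + g z"])
      fix z assume z: "z \<in> ?sp"
      show "((\<lambda>x. op_add B B' x - (f z + g z) *\<^sub>C x) \<longlongrightarrow> 0) (?F z)"
        using tendsto_add[OF f(2)[OF z] g(2)[OF z]]
        by (simp add: op_add_def scaleC_simps algebra_simps)
      show "((\<lambda>x. op_adj M (op_add B B') x - cnj (f z + g z) *\<^sub>C x) \<longlongrightarrow> 0) (?F z)"
      proof (rule Lim_transform_eventually)
        show "((\<lambda>x. (op_adj M B x - cnj (f z) *\<^sub>C x) + (op_adj M B' x - cnj (g z) *\<^sub>C x)) \<longlongrightarrow> 0) (?F z)"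
          using tendsto_add[OF f(3)[OF z] g(3)[OF z]] by simp
        show "\<forall>\<^sub>F x in ?F z. (op_adj M B x - cnj (f z) *\<^sub>C x) + (op_adj M B' x - cnj (g z) *\<^sub>C x)
            = op_adj M (op_add B B') x - cnj (f z + g z) *\<^sub>C x"
          using unit[of z] by eventually_elim (simp add: op_adj_add[OF M Bb] scaleC_simps)
      qed
    qed (intro continuous_intros f g)
    show "B \<circ> B' \<in> S"
    proof (rule SI[OF bounded_ops_comp[OF M Bb], of "\<lambda>z. f z * g z"])
      fix z assume z: "z \<in> ?sp"
      show "((\<lambda>x. (B \<circ> B') x - (f z * g z) *\<^sub>C x) \<longlongrightarrow> 0) (?F z)"
        using approx_eigenvalue_comp[OF unit Bb f(2)[OF z] g(2)[OF z]] by simp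
      show "((\<lambda>x. op_adj M (B \<circ> B') x - cnj (f z * g z) *\<^sub>C x) \<longlongrightarrow> 0) (?F z)"
      proof (rule Lim_transform_eventually)
        show "((\<lambda>x. op_adj M B' (op_adj M B x) - (cnj (g z) * cnj (f z)) *\<^sub>C x) \<longlongrightarrow> 0) (?F z)"
          using approx_eigenvalue_comp[OF unit op_adj_bounded[OF M Bb(2)] op_adj_bounded[OF M Bb(1)]
              g(3)[OF z] f(3)[OF z]] .
        show "\<forall>\<^sub>F x in ?F z. op_adj M B' (op_adj M B x) - (cnj (g z) * cnj (f z)) *\<^sub>C x
            = op_adj M (B \<circ> B') x - cnj (f z * g z) *\<^sub>C x"
          using unit[of z] by eventually_elim (simp add: op_adj_comp[OF M Bb] mult.commute)
      qed
    qed (intro continuous_intros f g)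
  next
    fix c B assume "B \<in> S"
    note Bb = SE(1)[OF \<open>B \<in> S\<close>]
    obtain f where f: "continuous_on ?sp f"
      "\<And>z. z \<in> ?sp \<Longrightarrow> ((\<lambda>x. B x - f z *\<^sub>C x) \<longlongrightarrow> 0) (?F z)"
      "\<And>z. z \<in> ?sp \<Longrightarrow> ((\<lambda>x. op_adj M B x - cnj (f z) *\<^sub>C x) \<longlongrightarrow> 0) (?F z)"
      using SE(2)[OF \<open>B \<in> S\<close>] by blast
    have scale_lim: "((\<lambda>x. d *\<^sub>C g x) \<longlongrightarrow> 0) (?F z)" if "(g \<longlongrightarrow> 0) (?F z)" for d g z
      by (rule tendsto_0_normI[of "\<lambda>x. cmod d * norm (g x)"])
        (use tendsto_mult_left[OF tendsto_norm[OF that], of "cmod d"] in auto)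
    show "op_scale c B \<in> S"
    proof (rule SI[OF bounded_ops_scale[OF M Bb], of "\<lambda>z. c * f z"])
      fix z assume z: "z \<in> ?sp"
      show "((\<lambda>x. op_scale c B x - (c * f z) *\<^sub>C x) \<longlongrightarrow> 0) (?F z)"
        using scale_lim[OF f(2)[OF z], of c] by (simp add: op_scale_def scaleC_simps)
      show "((\<lambda>x. op_adj M (op_scale c B) x - cnj (c * f z) *\<^sub>C x) \<longlongrightarrow> 0) (?F z)"
      proof (rule Lim_transform_eventually)
        show "((\<lambda>x. cnj c *\<^sub>C (op_adj M B x - cnj (f z) *\<^sub>C x)) \<longlongrightarrow> 0) (?F z)"
          by (rule scale_lim[OF f(3)[OF z]])
        show "\<forall>\<^sub>F x in ?F z. cnj c *\<^sub>C (op_adj M B x - cnj (f z) *\<^sub>C x)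
            = op_adj M (op_scale c B) x - cnj (c * f z) *\<^sub>C x"
          using unit[of z] by eventually_elim (simp add: op_adj_scale[OF M Bb] scaleC_simps)
      qed
    qed (intro continuous_intros f)
  next
    fix B assume "B \<in> S"
    note Bb = SE(1)[OF \<open>B \<in> S\<close>]
    obtain f where f: "continuous_on ?sp f"
      "\<And>z. z \<in> ?sp \<Longrightarrow> ((\<lambda>x. B x - f z *\<^sub>C x) \<longlongrightarrow> 0) (?F z)"
      "\<And>z. z \<in> ?sp \<Longrightarrow> ((\<lambda>x. op_adj M B x - cnj (f z) *\<^sub>C x) \<longlongrightarrow> 0) (?F z)"
      using SE(2)[OF \<open>B \<in> S\<close>] by blast
    show "op_adj M B \<in> S"
    proof (rule SI[OF op_adj_bounded[OF M Bb], of "\<lambda>z. cnj (f z)"])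
      fix z assume z: "z \<in> ?sp"
      show "((\<lambda>x. op_adj M B x - cnj (f z) *\<^sub>C x) \<longlongrightarrow> 0) (?F z)" by (rule f(3)[OF z])
      show "((\<lambda>x. op_adj M (op_adj M B) x - cnj (cnj (f z)) *\<^sub>C x) \<longlongrightarrow> 0) (?F z)"
      proof (rule Lim_transform_eventually[OF f(2)[OF z]])
        show "\<forall>\<^sub>F x in ?F z. B x - f z *\<^sub>C x = op_adj M (op_adj M B) x - cnj (cnj (f z)) *\<^sub>C x"
          using unit[of z] by eventually_elim (simp add: op_adj_op_adj[OF M Bb])
      qed
    qed (intro continuous_intros f)
  next
    fix B assume "B \<in> bounded_ops M"
      and "\<And>e::real. e > 0 \<Longrightarrow> \<exists>B'\<in>S. \<forall>x\<in>M. norm (B x - B' x) \<le> e * norm x"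
    then show "B \<in> S" by (rule S_lim)
  qed
  moreover have "A \<in> S"
    unfolding S_def using A approx_eigenvalue_self[OF A normal]
    by (intro CollectI conjI exI[of _ "\<lambda>z. z"]) auto
  ultimately have "B \<in> S" using B unfolding cstar_generated_def by blast
  then show ?thesis unfolding S_def by blast
qed

text \<open>Normality excludes residual spectrum: a lower bound for \<open>A - z\<close> is also one
  for its adjoint, so with \<open>U = z - A\<close> both \<open>U' U\<close> and \<open>U U'\<close>
  are coercive and invertible, which gives \<open>U\<close> an inverse on either side.\<close>

lemma spectrum_eq_approx_spectrum:
  assumes A: "A \<in> bounded_ops M"
    and normal: "\<And>x. x \<in> M \<Longrightarrow> A (op_adj M A x) = op_adj M A (A x)"
  shows "spectrum_in M (bounded_ops M) A = approx_spectrum M A"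
proof (rule set_eqI)
  fix z
  define U where "U = op_diff (op_scale z (op_id M)) A"
  note BD = unital_cstar_subalgebraD[OF M unital_cstar_subalgebra_bounded_ops[OF M]]
  have U: "U \<in> bounded_ops M" unfolding U_def using A BD(2,5,7) by blast
  have U_apply: "U x = z *\<^sub>C x - A x" if "x \<in> M" for x
    using that by (simp add: U_def op_diff_def op_scale_def op_id_def op_restrict_def)
  have U_norm: "norm (U x) = norm (A x - z *\<^sub>C x)" if "x \<in> M" for x
    using U_apply[OF that] by (simp add: norm_minus_commute)
  have "(\<exists>B\<in>bounded_ops M. B \<circ> U = op_id M \<and> U \<circ> B = op_id M) \<longleftrightarrow> z \<notin> approx_spectrum M A"
  proof
    assume "\<exists>B\<in>bounded_ops M. B \<circ> U = op_id M \<and> U \<circ> B = op_id M"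
    then obtain B where B: "B \<in> bounded_ops M" "B \<circ> U = op_id M" by blast
    obtain K where K: "K > 0" "\<And>x. x \<in> M \<Longrightarrow> norm (B x) \<le> K * norm x"
      using bounded_opsE[OF B(1)] by metis
    have "(1 / K) * norm x \<le> norm (A x - z *\<^sub>C x)" if x: "x \<in> M" for x
    proof -
      have "B (U x) = x" using fun_cong[OF B(2), of x] x by (simp add: op_id_def op_restrict_def)
      then have "norm x \<le> K * norm (U x)" using K(2)[OF bounded_opsD(1)[OF U x]] by simp
      then show ?thesis using K(1) U_norm[OF x] by (simp add: field_simps)
    qed
    then show "z \<notin> approx_spectrum M A"
      unfolding notin_approx_spectrum_iff[OF bounded_ops_linear[OF A]]
      using K(1) by (intro exI[of _ "1 / K"]) auto
  next
    assume "z \<notin> approx_spectrum M A"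
    then obtain d where d: "d > 0" "\<And>x. x \<in> M \<Longrightarrow> d * norm x \<le> norm (U x)"
      unfolding notin_approx_spectrum_iff[OF bounded_ops_linear[OF A]] using U_norm by auto
    define U' where "U' = op_adj M U"
    have U': "U' \<in> bounded_ops M" unfolding U'_def by (rule op_adj_bounded[OF M U])
    have adj: "U' x = cnj z *\<^sub>C x - op_adj M A x" if x: "x \<in> M" for x
      unfolding U'_def using x bounded_opsD(1)[OF op_adj_bounded[OF M A]] closed_csubspaceD(4,6)[OF M]
      by (intro op_adj_eqI[OF M U]) (auto simp: U_apply cinner_simps cinner_op_adj[OF M A])
    have d': "d * norm x \<le> norm (U' x)" if x: "x \<in> M" for x
      using d(2)[OF x] U_norm[OF x] normal_norm_eq[OF A normal x, of z] adj[OF x]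
      by (simp add: norm_minus_commute)
    have sq: "d\<^sup>2 * (norm x)\<^sup>2 \<le> (norm y)\<^sup>2" if "d * norm x \<le> norm y" for x y :: 'h
      using power_mono[OF that, of 2] d(1) by (simp add: power_mult_distrib)
    have "d\<^sup>2 * (norm x)\<^sup>2 \<le> Re (cinner ((U' \<circ> U) x) x)" if x: "x \<in> M" for x
      using sq[OF d(2)[OF x]] cinner_op_adj_left[OF M U bounded_opsD(1)[OF U x] x]
      by (simp add: U'_def cinner_self)
    then obtain V where V: "V \<in> bounded_ops M" "V \<circ> (U' \<circ> U) = op_id M"
      using cstar_inverse_coercive[OF M unital_cstar_subalgebra_bounded_ops[OF M] BD(4)[OF U' U], of "d\<^sup>2"] d(1)
      by auto
    have "d\<^sup>2 * (norm x)\<^sup>2 \<le> Re (cinner ((U \<circ> U') x) x)" if x: "x \<in> M" for x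
      using sq[OF d'[OF x]] cinner_op_adj[OF M U bounded_opsD(1)[OF U' x] x]
      by (simp add: U'_def cinner_self)
    then obtain W where W: "W \<in> bounded_ops M" "(U \<circ> U') \<circ> W = op_id M"
      using cstar_inverse_coercive[OF M unital_cstar_subalgebra_bounded_ops[OF M] BD(4)[OF U U'], of "d\<^sup>2"] d(1)
      by auto
    have id_comp: "op_id M \<circ> Y = Y" "Y \<circ> op_id M = Y" if "Y \<in> bounded_ops M" for Y
      using that bounded_opsD(1,4)[OF that] linear_ops_zero[OF M bounded_ops_linear[OF that]]
      by (auto simp: op_id_def op_restrict_def fun_eq_iff)
    \<comment> \<open>The left inverse \<open>V U'\<close> is identified with the right inverse
      \<open>U' W\<close>.\<close>
    have "V \<circ> U' = (V \<circ> U') \<circ> ((U \<circ> U') \<circ> W)" using W id_comp BD(4)[OF V(1) U'] by simp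
    also have "\<dots> = (V \<circ> (U' \<circ> U)) \<circ> (U' \<circ> W)" by (simp add: comp_assoc)
    also have "\<dots> = U' \<circ> W" using V id_comp BD(4)[OF U' W(1)] by simp
    finally have "U \<circ> (V \<circ> U') = op_id M" using W(2) by (simp add: comp_assoc)
    then show "\<exists>B\<in>bounded_ops M. B \<circ> U = op_id M \<and> U \<circ> B = op_id M"
      using V(2) BD(4)[OF V(1) U'] by (intro bexI[of _ "V \<circ> U'"]) (simp_all add: comp_assoc)
  qed
  then show "z \<in> spectrum_in M (bounded_ops M) A \<longleftrightarrow> z \<in> approx_spectrum M A"
    unfolding spectrum_in_def U_def by blast
qed

end

section \<open>Local operators\<close>

lemma op_restrict_apply: "op_restrict M A x = (if x \<in> M then A x else 0)"
  by (simp add: op_restrict_def)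

lemma op_restrict_add:
  "op_restrict M (op_add A B) = op_add (op_restrict M A) (op_restrict M B)"
  by (auto simp: op_restrict_apply op_add_def fun_eq_iff)

lemma op_restrict_diff:
  "op_restrict M (op_diff A B) = op_diff (op_restrict M A) (op_restrict M B)"
  by (auto simp: op_restrict_apply op_diff_def fun_eq_iff)

lemma op_restrict_scale:
  "op_restrict M (op_scale c (A :: 'h::complex_hilbert_space \<Rightarrow> 'h)) = op_scale c (op_restrict M A)"
  by (auto simp: op_restrict_apply op_scale_def fun_eq_iff)

lemma op_id_apply: "op_id M x = (if x \<in> M then x else 0)"
  by (simp add: op_id_def op_restrict_def)

section \<open>Linearity, symmetry and contractivity of orthogonal projections\<close>

context
  fixes M :: "'h::complex_hilbert_space set"
  assumes M: "closed_csubspace M"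
begin

lemma orth_proj_eqI:
  assumes y: "y \<in> M" and eq: "\<And>z. z \<in> M \<Longrightarrow> cinner y z = cinner x z"
  shows "orth_proj M x = y"
proof -
  have "orth_proj M x - y \<in> M" using orth_proj(1)[OF M] y closed_csubspaceD(6)[OF M] by blast
  then have "cinner (orth_proj M x - y) (orth_proj M x - y) = 0"
    using orth_proj(2)[OF M] eq by (simp add: cinner_diff_left)
  then show ?thesis using cinner_self_eq_0D by fastforce
qed

lemma orth_proj_add: "orth_proj M (x + y) = orth_proj M x + orth_proj M y"
  by (rule orth_proj_eqI) (simp_all add: orth_proj[OF M] closed_csubspaceD[OF M] cinner_simps)

lemma orth_proj_scale: "orth_proj M (c *\<^sub>C x) = c *\<^sub>C orth_proj M x"
  by (rule orth_proj_eqI) (simp_all add: orth_proj[OF M] closed_csubspaceD[OF M] cinner_simps)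

lemma orth_proj_diff: "orth_proj M (x - y) = orth_proj M x - orth_proj M y"
  by (rule orth_proj_eqI) (simp_all add: orth_proj[OF M] closed_csubspaceD[OF M] cinner_simps)

lemma cinner_orth_proj_swap: "cinner (orth_proj M x) y = cinner x (orth_proj M y)"
  using orth_proj(2)[OF M orth_proj(1)[OF M], of x y] orth_proj(3)[OF M orth_proj(1)[OF M], of x y]
  by simp

lemma norm_orth_proj_le: "norm (orth_proj M x) \<le> norm x"
proof -
  have "(norm (orth_proj M x))\<^sup>2 = Re (cinner x (orth_proj M x))"
    using orth_proj(2)[OF M orth_proj(1)[OF M], of x x] by (metis cinner_self Re_complex_of_real)
  also have "\<dots> \<le> norm x * norm (orth_proj M x)" using Re_cinner_le[of x "orth_proj M x"] by simp
  finally have "norm (orth_proj M x) * norm (orth_proj M x) \<le> norm (orth_proj M x) * norm x"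
    by (simp add: power2_eq_square mult.commute)
  then show ?thesis by (cases "norm (orth_proj M x) = 0") (auto simp: mult_le_cancel_left)
qed

end

locale directed_subspaces =
  fixes H :: "'l::order \<Rightarrow> 'h::complex_hilbert_space set"
  assumes dir: "directed_family H"
begin

lemma closed_csubspace_H: "closed_csubspace (H \<alpha>)"
  using dir by (simp add: directed_family_def)

lemma H_mono: "\<alpha> \<le> \<beta> \<Longrightarrow> x \<in> H \<alpha> \<Longrightarrow> x \<in> H \<beta>"
  using dir unfolding directed_family_def by blast

lemma upper_boundE: obtains \<gamma> :: 'l where "\<alpha> \<le> \<gamma>" "\<beta> \<le> \<gamma>"
  using dir unfolding directed_family_def by blast

lemma dom_unionI: "x \<in> H \<alpha> \<Longrightarrow> x \<in> dom_union H"
  by (auto simp: dom_union_def)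

lemma dom_unionE:
  assumes "x \<in> dom_union H" obtains \<alpha> where "x \<in> H \<alpha>"
  using assms by (auto simp: dom_union_def)

lemma dom_union2E:
  assumes "x \<in> dom_union H" "y \<in> dom_union H" obtains \<alpha> where "x \<in> H \<alpha>" "y \<in> H \<alpha>"
  using assms H_mono upper_boundE by (metis dom_unionE)

lemma orth_proj_H_dom_union: "orth_proj (H \<alpha>) x \<in> dom_union H"
  using orth_proj(1)[OF closed_csubspace_H] by (rule dom_unionI)

text \<open>Directedness puts any two vectors of the union into one layer, so linearity is inherited
  from the restrictions.\<close>

lemma local_opsI:
  assumes off: "\<And>x. x \<notin> dom_union H \<Longrightarrow> A x = 0"
    and restrict: "\<And>\<alpha>. op_restrict (H \<alpha>) A \<in> bounded_ops (H \<alpha>)"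
    and proj: "\<And>\<alpha> x. x \<in> dom_union H \<Longrightarrow> orth_proj (H \<alpha>) (A x) = A (orth_proj (H \<alpha>) x)"
  shows "A \<in> local_ops H"
proof -
  have "A x \<in> dom_union H" if x: "x \<in> dom_union H" for x
  proof -
    obtain \<alpha> where "x \<in> H \<alpha>" using x by (rule dom_unionE)
    then show ?thesis using bounded_opsD(1)[OF restrict, of x \<alpha>]
      by (auto simp: op_restrict_apply intro: dom_unionI)
  qed
  moreover have "A (x + y) = A x + A y" if xy: "x \<in> dom_union H" "y \<in> dom_union H" for x y
  proof -
    obtain \<alpha> where "x \<in> H \<alpha>" "y \<in> H \<alpha>" using xy by (rule dom_union2E)
    then show ?thesis using bounded_opsD(2)[OF restrict, of x \<alpha> y] closed_csubspaceD(3)[OF closed_csubspace_H]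
      by (auto simp: op_restrict_apply)
  qed
  moreover have "A (c *\<^sub>C x) = c *\<^sub>C A x" if x: "x \<in> dom_union H" for c x
  proof -
    obtain \<alpha> where "x \<in> H \<alpha>" using x by (rule dom_unionE)
    then show ?thesis using bounded_opsD(3)[OF restrict, of x \<alpha> c] closed_csubspaceD(4)[OF closed_csubspace_H]
      by (auto simp: op_restrict_apply)
  qed
  ultimately show ?thesis using off restrict proj by (simp add: local_ops_def linear_ops_def)
qed

lemma local_opsD:
  assumes A: "A \<in> local_ops H"
  shows "\<And>x. x \<notin> dom_union H \<Longrightarrow> A x = 0"
    and "\<And>\<alpha>. op_restrict (H \<alpha>) A \<in> bounded_ops (H \<alpha>)"
    and "\<And>\<alpha> x. x \<in> dom_union H \<Longrightarrow> orth_proj (H \<alpha>) (A x) = A (orth_proj (H \<alpha>) x)"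
    and "\<And>\<alpha> x. x \<in> H \<alpha> \<Longrightarrow> A x \<in> H \<alpha>"
    and "\<And>x. x \<in> dom_union H \<Longrightarrow> A x \<in> dom_union H"
    and "\<And>x y. x \<in> dom_union H \<Longrightarrow> y \<in> dom_union H \<Longrightarrow> A (x + y) = A x + A y"
    and "\<And>c x. x \<in> dom_union H \<Longrightarrow> A (c *\<^sub>C x) = c *\<^sub>C A x"
    and "\<And>x y. x \<in> dom_union H \<Longrightarrow> y \<in> dom_union H \<Longrightarrow> A (x - y) = A x - A y"
    and "A 0 = 0"
proof -
  show restrict: "op_restrict (H \<alpha>) A \<in> bounded_ops (H \<alpha>)" for \<alpha>
    using A by (simp add: local_ops_def)
  show "A x \<in> H \<alpha>" if "x \<in> H \<alpha>" for x \<alpha>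
    using bounded_opsD(1)[OF restrict that] that by (simp add: op_restrict_apply)
  show diff: "A (x - y) = A x - A y" if xy: "x \<in> dom_union H" "y \<in> dom_union H" for x y
  proof -
    obtain \<alpha> where "x \<in> H \<alpha>" "y \<in> H \<alpha>" using xy by (rule dom_union2E)
    then show ?thesis
      using linear_ops_diff[OF closed_csubspace_H bounded_ops_linear[OF restrict], of x \<alpha> y]
        closed_csubspaceD(6)[OF closed_csubspace_H]
      by (auto simp: op_restrict_apply)
  qed
  have "0 \<in> dom_union H" using closed_csubspaceD(2)[OF closed_csubspace_H] by (rule dom_unionI)
  then show "A 0 = 0" using diff[of 0 0] by simp
qed (use A in \<open>auto simp: local_ops_def linear_ops_def\<close>)

lemma local_ops_eqI:
  assumes "A \<in> local_ops H" "B \<in> local_ops H"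
    and "\<And>\<alpha>. op_restrict (H \<alpha>) A = op_restrict (H \<alpha>) B"
  shows "A = B"
proof (rule op_eqI[of "dom_union H"])
  fix x assume "x \<in> dom_union H"
  then obtain \<alpha> where "x \<in> H \<alpha>" by (rule dom_unionE)
  then show "A x = B x" using fun_cong[OF assms(3), of \<alpha> x] by (simp add: op_restrict_apply)
qed (use assms local_opsD(1) in auto)

lemma op_restrict_id: "op_restrict (H \<alpha>) (op_id (dom_union H)) = op_id (H \<alpha>)"
  by (auto simp: op_restrict_apply op_id_apply fun_eq_iff intro: dom_unionI)

lemma op_restrict_comp:
  assumes "A \<in> local_ops H" "B \<in> local_ops H"
  shows "op_restrict (H \<alpha>) (A \<circ> B) = op_restrict (H \<alpha>) A \<circ> op_restrict (H \<alpha>) B"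
  using local_opsD(4)[OF assms(2)] local_opsD(9)[OF assms(1)]
  by (auto simp: op_restrict_apply fun_eq_iff)

lemma local_ops_id: "op_id (dom_union H) \<in> local_ops H"
  by (rule local_opsI)
    (simp_all add: op_restrict_id bounded_ops_id closed_csubspace_H op_id_apply orth_proj_H_dom_union)

lemma local_ops_add: "A \<in> local_ops H \<Longrightarrow> B \<in> local_ops H \<Longrightarrow> op_add A B \<in> local_ops H"
  by (rule local_opsI)
    (simp_all add: op_restrict_add bounded_ops_add closed_csubspace_H local_opsD(2),
      simp_all add: op_add_def local_opsD(1,3) orth_proj_add[OF closed_csubspace_H])

lemma local_ops_scale: "A \<in> local_ops H \<Longrightarrow> op_scale c A \<in> local_ops H"
  by (rule local_opsI)
    (simp_all add: op_restrict_scale bounded_ops_scale closed_csubspace_H local_opsD(2),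
      simp_all add: op_scale_def local_opsD(1,3) orth_proj_scale[OF closed_csubspace_H])

lemma local_ops_diff: "A \<in> local_ops H \<Longrightarrow> B \<in> local_ops H \<Longrightarrow> op_diff A B \<in> local_ops H"
  unfolding op_diff_eq_add by (intro local_ops_add local_ops_scale)

lemma local_ops_comp: "A \<in> local_ops H \<Longrightarrow> B \<in> local_ops H \<Longrightarrow> A \<circ> B \<in> local_ops H"
  by (rule local_opsI)
    (simp_all add: op_restrict_comp bounded_ops_comp closed_csubspace_H local_opsD orth_proj_H_dom_union)

section \<open>Gluing layerwise operators: adjoints, inverses and the local spectrum\<close>

text \<open>Any two layers lie below a third, so \<open>mono\<close> makes the value at
  \<open>x\<close> independent of the layer that the choice operator picks; \<open>proj\<close>
  becomes commutation with every projection.\<close>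

lemma local_ops_glue:
  assumes A: "\<And>\<alpha>. A \<alpha> \<in> bounded_ops (H \<alpha>)"
    and mono: "\<And>\<alpha> \<beta> x. \<alpha> \<le> \<beta> \<Longrightarrow> x \<in> H \<alpha> \<Longrightarrow> A \<beta> x = A \<alpha> x"
    and proj: "\<And>\<alpha> \<beta> x. \<alpha> \<le> \<beta> \<Longrightarrow> x \<in> H \<beta> \<Longrightarrow> orth_proj (H \<alpha>) (A \<beta> x) = A \<beta> (orth_proj (H \<alpha>) x)"
  shows "\<exists>R\<in>local_ops H. \<forall>\<alpha>. op_restrict (H \<alpha>) R = A \<alpha>"
proof -
  define R where "R = op_restrict (dom_union H) (\<lambda>x. A (SOME \<alpha>. x \<in> H \<alpha>) x)"
  have R: "R x = A \<alpha> x" if x: "x \<in> H \<alpha>" for x \<alpha>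
  proof -
    define \<beta> where "\<beta> = (SOME \<beta>. x \<in> H \<beta>)"
    have "x \<in> H \<beta>" unfolding \<beta>_def using x by (rule someI)
    obtain \<gamma> where "\<alpha> \<le> \<gamma>" "\<beta> \<le> \<gamma>" by (rule upper_boundE)
    then have "A \<beta> x = A \<alpha> x" using mono x \<open>x \<in> H \<beta>\<close> by metis
    then show ?thesis using dom_unionI[OF x] by (simp add: R_def op_restrict_apply \<beta>_def)
  qed
  have restrict: "op_restrict (H \<alpha>) R = A \<alpha>" for \<alpha>
    using R bounded_opsD(4)[OF A] by (auto simp: op_restrict_apply fun_eq_iff)
  have "R \<in> local_ops H"
  proof (rule local_opsI)
    fix \<alpha> x assume "x \<in> dom_union H"
    then obtain \<beta> where x: "x \<in> H \<beta>" by (rule dom_unionE)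
    \<comment> \<open>Both \<open>x\<close> and its projection to \<open>H \<alpha>\<close> lie in
      this common layer, where \<open>proj\<close> applies.\<close>
    obtain \<gamma> where \<gamma>: "\<alpha> \<le> \<gamma>" "\<beta> \<le> \<gamma>" by (rule upper_boundE)
    have "orth_proj (H \<alpha>) x \<in> H \<gamma>" using H_mono[OF \<gamma>(1)] orth_proj(1)[OF closed_csubspace_H] by blast
    then show "orth_proj (H \<alpha>) (R x) = R (orth_proj (H \<alpha>) x)"
      using proj[OF \<gamma>(1) H_mono[OF \<gamma>(2) x]] R[OF H_mono[OF \<gamma>(2) x]] R[of "orth_proj (H \<alpha>) x" \<gamma>] by simp
  next
    show "op_restrict (H \<alpha>) R \<in> bounded_ops (H \<alpha>)" for \<alpha> unfolding restrict by (rule A)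
  qed (simp add: R_def op_restrict_apply)
  then show ?thesis using restrict by blast
qed

text \<open>Each layer reduces \<open>T\<close>, because \<open>T\<close> commutes with the
  projections; hence the adjoints taken in different layers are compatible, also commute with the
  projections, and glue.\<close>

lemma local_adj:
  assumes T: "T \<in> local_ops H"
  shows local_adj_in: "local_adj H T \<in> local_ops H"
    and op_restrict_local_adj: "\<And>\<alpha>. op_restrict (H \<alpha>) (local_adj H T) = op_adj (H \<alpha>) (op_restrict (H \<alpha>) T)"
proof -
  let ?A = "\<lambda>\<alpha>. op_adj (H \<alpha>) (op_restrict (H \<alpha>) T)"
  note Tb = local_opsD(2)[OF T]
  note adj_in = bounded_opsD(1)[OF op_adj_bounded[OF closed_csubspace_H Tb]]
  have P_in: "orth_proj (H \<alpha>) x \<in> H \<beta>" if "\<alpha> \<le> \<beta>" for \<alpha> \<beta> x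
    using H_mono[OF that] orth_proj(1)[OF closed_csubspace_H] by blast
  have adj: "cinner (T z) x = cinner z (?A \<alpha> x)" if "z \<in> H \<alpha>" "x \<in> H \<alpha>" for \<alpha> z x
    using cinner_op_adj[OF closed_csubspace_H Tb that] that by (simp add: op_restrict_apply)
  have "\<exists>R\<in>local_ops H. \<forall>\<alpha>. op_restrict (H \<alpha>) R = ?A \<alpha>"
  proof (rule local_ops_glue)
    fix \<alpha> show "?A \<alpha> \<in> bounded_ops (H \<alpha>)" by (rule op_adj_bounded[OF closed_csubspace_H Tb])
  next
    fix \<alpha> \<beta> :: 'l and x assume le: "\<alpha> \<le> \<beta>" and x: "x \<in> H \<alpha>"
    show "?A \<beta> x = ?A \<alpha> x"
    proof (rule op_adj_eqI[OF closed_csubspace_H Tb])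
      fix z assume z: "z \<in> H \<beta>"
      have "cinner (T z) x = cinner (T z) (orth_proj (H \<alpha>) x)"
        using orth_proj_ident[OF closed_csubspace_H x] by simp
      also have "\<dots> = cinner (T (orth_proj (H \<alpha>) z)) x"
        by (simp add: cinner_orth_proj_swap[OF closed_csubspace_H, symmetric] local_opsD(3)[OF T dom_unionI[OF z]])
      also have "\<dots> = cinner (orth_proj (H \<alpha>) z) (?A \<alpha> x)"
        by (rule adj[OF orth_proj(1)[OF closed_csubspace_H] x])
      also have "\<dots> = cinner z (?A \<alpha> x)" by (rule orth_proj(2)[OF closed_csubspace_H adj_in[OF x]])
      finally show "cinner (op_restrict (H \<beta>) T z) x = cinner z (?A \<alpha> x)"
        using z by (simp add: op_restrict_apply)
    qed (use H_mono[OF le] x adj_in in auto)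
  next
    fix \<alpha> \<beta> :: 'l and x assume le: "\<alpha> \<le> \<beta>" and x: "x \<in> H \<beta>"
    have "?A \<beta> (orth_proj (H \<alpha>) x) = orth_proj (H \<alpha>) (?A \<beta> x)"
    proof (rule op_adj_eqI[OF closed_csubspace_H Tb P_in[OF le] P_in[OF le]])
      fix z assume z: "z \<in> H \<beta>"
      have "cinner (T z) (orth_proj (H \<alpha>) x) = cinner (T (orth_proj (H \<alpha>) z)) x"
        by (simp add: cinner_orth_proj_swap[OF closed_csubspace_H, symmetric] local_opsD(3)[OF T dom_unionI[OF z]])
      also have "\<dots> = cinner (orth_proj (H \<alpha>) z) (?A \<beta> x)" by (rule adj[OF P_in[OF le] x])
      also have "\<dots> = cinner z (orth_proj (H \<alpha>) (?A \<beta> x))"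
        by (rule cinner_orth_proj_swap[OF closed_csubspace_H])
      finally show "cinner (op_restrict (H \<beta>) T z) (orth_proj (H \<alpha>) x) = cinner z (orth_proj (H \<alpha>) (?A \<beta> x))"
        using z by (simp add: op_restrict_apply)
    qed
    then show "orth_proj (H \<alpha>) (?A \<beta> x) = ?A \<beta> (orth_proj (H \<alpha>) x)" by simp
  qed
  then obtain R where R: "R \<in> local_ops H" "\<And>\<alpha>. op_restrict (H \<alpha>) R = ?A \<alpha>" by blast
  have "\<exists>!S. S \<in> local_ops H \<and> (\<forall>\<alpha>. op_restrict (H \<alpha>) S = ?A \<alpha>)"
    by (rule ex1I[of _ R]) (use R local_ops_eqI in auto)
  from theI'[OF this] show "local_adj H T \<in> local_ops H"
    "\<And>\<alpha>. op_restrict (H \<alpha>) (local_adj H T) = ?A \<alpha>" unfolding local_adj_def by blast+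
qed

lemma cinner_local_adj:
  assumes T: "T \<in> local_ops H" and xy: "x \<in> dom_union H" "y \<in> dom_union H"
  shows "cinner (T x) y = cinner x (local_adj H T y)"
proof -
  obtain \<alpha> where x: "x \<in> H \<alpha>" "y \<in> H \<alpha>" using xy by (rule dom_union2E)
  then show ?thesis
    using cinner_op_adj[OF closed_csubspace_H local_opsD(2)[OF T] x]
    unfolding op_restrict_local_adj[OF T, symmetric] by (simp add: op_restrict_apply)
qed

text \<open>Inverses are unique, so those in the layers agree on smaller layers, and they commute
  with the projections because \<open>U\<close> does.\<close>

lemma local_inverse_glue:
  assumes U: "U \<in> local_ops H"
    and V: "\<And>\<alpha>. V \<alpha> \<in> bounded_ops (H \<alpha>)"
    and VU: "\<And>\<alpha>. V \<alpha> \<circ> op_restrict (H \<alpha>) U = op_id (H \<alpha>)"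
    and UV: "\<And>\<alpha>. op_restrict (H \<alpha>) U \<circ> V \<alpha> = op_id (H \<alpha>)"
  shows "\<exists>R\<in>local_ops H. (\<forall>\<alpha>. op_restrict (H \<alpha>) R = V \<alpha>) \<and>
    R \<circ> U = op_id (dom_union H) \<and> U \<circ> R = op_id (dom_union H)"
proof -
  note V_in = bounded_opsD(1)[OF V]
  have VU': "V \<alpha> (U x) = x" if "x \<in> H \<alpha>" for \<alpha> x
    using fun_cong[OF VU, of \<alpha> x] that by (simp add: op_restrict_apply op_id_apply)
  have UV': "U (V \<alpha> x) = x" if "x \<in> H \<alpha>" for \<alpha> x
    using fun_cong[OF UV, of \<alpha> x] that V_in[OF that] by (simp add: op_restrict_apply op_id_apply)
  have "\<exists>R\<in>local_ops H. \<forall>\<alpha>. op_restrict (H \<alpha>) R = V \<alpha>"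
  proof (rule local_ops_glue)
    fix \<alpha> \<beta> :: 'l and x assume le: "\<alpha> \<le> \<beta>" and x: "x \<in> H \<alpha>"
    show "V \<beta> x = V \<alpha> x" using VU'[of "V \<alpha> x" \<beta>] UV'[OF x] H_mono[OF le V_in[OF x]] by simp
  next
    fix \<alpha> \<beta> :: 'l and x assume le: "\<alpha> \<le> \<beta>" and x: "x \<in> H \<beta>"
    have "V \<beta> (orth_proj (H \<alpha>) x) = V \<beta> (U (orth_proj (H \<alpha>) (V \<beta> x)))"
      using local_opsD(3)[OF U dom_unionI[OF V_in[OF x]], of \<alpha>] UV'[OF x] by simp
    also have "\<dots> = orth_proj (H \<alpha>) (V \<beta> x)"
      by (intro VU' H_mono[OF le] orth_proj(1)[OF closed_csubspace_H])
    finally show "orth_proj (H \<alpha>) (V \<beta> x) = V \<beta> (orth_proj (H \<alpha>) x)" by simp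
  qed (rule V)
  then obtain R where R: "R \<in> local_ops H" "\<And>\<alpha>. op_restrict (H \<alpha>) R = V \<alpha>" by blast
  moreover have "R \<circ> U = op_id (dom_union H)"
    by (rule local_ops_eqI) (simp_all add: local_ops_comp local_ops_id R U op_restrict_comp op_restrict_id VU)
  moreover have "U \<circ> R = op_id (dom_union H)"
    by (rule local_ops_eqI) (simp_all add: local_ops_comp local_ops_id R U op_restrict_comp op_restrict_id UV)
  ultimately show ?thesis by blast
qed

text \<open>An inverse restricts to every layer. Conversely, elements of \<open>local_ops H\<close>
  are bounded layer by layer, so inverses in the layers glue even when their norms have no common
  bound.\<close>

lemma local_spectrum_eq:
  assumes T: "T \<in> local_ops H"
  shows "local_spectrum H T = (\<Union>\<alpha>. spectrum_at H T \<alpha>)"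
proof -
  let ?U = "\<lambda>z. op_diff (op_scale z (op_id (dom_union H))) T"
  have U: "?U z \<in> local_ops H" for z
    by (intro local_ops_diff local_ops_scale local_ops_id T)
  have restrict: "op_restrict (H \<alpha>) (?U z) = op_diff (op_scale z (op_id (H \<alpha>))) (op_restrict (H \<alpha>) T)" for z \<alpha>
    by (simp add: op_restrict_diff op_restrict_scale op_restrict_id)
  have "z \<notin> local_spectrum H T \<longleftrightarrow> (\<forall>\<alpha>. z \<notin> spectrum_at H T \<alpha>)" for z
  proof
    assume "z \<notin> local_spectrum H T"
    then obtain B where B: "B \<in> local_ops H" "B \<circ> ?U z = op_id (dom_union H)" "?U z \<circ> B = op_id (dom_union H)"
      unfolding local_spectrum_def spectrum_in_def by blast
    have "op_restrict (H \<alpha>) B \<circ> op_restrict (H \<alpha>) (?U z) = op_id (H \<alpha>)"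
      "op_restrict (H \<alpha>) (?U z) \<circ> op_restrict (H \<alpha>) B = op_id (H \<alpha>)" for \<alpha>
      using op_restrict_comp[OF B(1) U, of \<alpha> z] op_restrict_comp[OF U B(1), of \<alpha> z] B(2,3)
      by (simp_all add: op_restrict_id)
    then show "\<forall>\<alpha>. z \<notin> spectrum_at H T \<alpha>"
      using local_opsD(2)[OF B(1)] unfolding spectrum_at_def spectrum_in_def restrict by blast
  next
    assume "\<forall>\<alpha>. z \<notin> spectrum_at H T \<alpha>"
    then have "\<forall>\<alpha>. \<exists>V. V \<in> bounded_ops (H \<alpha>) \<and> V \<circ> op_restrict (H \<alpha>) (?U z) = op_id (H \<alpha>) \<and>
        op_restrict (H \<alpha>) (?U z) \<circ> V = op_id (H \<alpha>)"
      unfolding spectrum_at_def spectrum_in_def restrict by blast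
    then obtain V where "\<forall>\<alpha>. V \<alpha> \<in> bounded_ops (H \<alpha>) \<and> V \<alpha> \<circ> op_restrict (H \<alpha>) (?U z) = op_id (H \<alpha>) \<and>
        op_restrict (H \<alpha>) (?U z) \<circ> V \<alpha> = op_id (H \<alpha>)"
      by (rule choice[THEN exE])
    then obtain R where "R \<in> local_ops H" "R \<circ> ?U z = op_id (dom_union H)" "?U z \<circ> R = op_id (dom_union H)"
      using local_inverse_glue[OF U, of V z] by blast
    then show "z \<notin> local_spectrum H T" unfolding local_spectrum_def spectrum_in_def by blast
  qed
  then show ?thesis by blast
qed

end

section \<open>The algebra generated by a local operator\<close>

locale local_operator = directed_subspaces H
  for H :: "'l::order \<Rightarrow> 'h::complex_hilbert_space set" +
  fixes T :: "'h \<Rightarrow> 'h"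
  assumes T: "T \<in> local_ops H"
begin

lemma unital_cstar_subalgebra_layer:
  "unital_cstar_subalgebra (H \<alpha>) (cstar_generated (H \<alpha>) (op_restrict (H \<alpha>) T))"
  by (rule unital_cstar_subalgebra_cstar_generated[OF closed_csubspace_H local_opsD(2)[OF T]])

lemmas layerD = unital_cstar_subalgebraD[OF closed_csubspace_H unital_cstar_subalgebra_layer]

lemma gen_algD:
  assumes "R \<in> gen_alg H T"
  shows "R \<in> local_ops H" "\<And>\<alpha>. op_restrict (H \<alpha>) R \<in> cstar_generated (H \<alpha>) (op_restrict (H \<alpha>) T)"
  using assms by (simp_all add: gen_alg_def)

lemma gen_alg_id: "op_id (dom_union H) \<in> gen_alg H T"
  by (simp add: gen_alg_def local_ops_id op_restrict_id layerD(2))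

lemma gen_alg_add: "R \<in> gen_alg H T \<Longrightarrow> S \<in> gen_alg H T \<Longrightarrow> op_add R S \<in> gen_alg H T"
  by (simp add: gen_alg_def local_ops_add op_restrict_add layerD(3))

lemma gen_alg_scale: "R \<in> gen_alg H T \<Longrightarrow> op_scale c R \<in> gen_alg H T"
  by (simp add: gen_alg_def local_ops_scale op_restrict_scale layerD(5))

lemma gen_alg_diff: "R \<in> gen_alg H T \<Longrightarrow> S \<in> gen_alg H T \<Longrightarrow> op_diff R S \<in> gen_alg H T"
  by (simp add: op_diff_eq_add gen_alg_add gen_alg_scale)

lemma gen_alg_comp: "R \<in> gen_alg H T \<Longrightarrow> S \<in> gen_alg H T \<Longrightarrow> R \<circ> S \<in> gen_alg H T"
  by (simp add: gen_alg_def local_ops_comp op_restrict_comp layerD(4))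

lemma gen_alg_adj: "R \<in> gen_alg H T \<Longrightarrow> local_adj H R \<in> gen_alg H T"
  by (simp add: gen_alg_def local_adj_in op_restrict_local_adj layerD(6))

lemma gen_alg_self: "T \<in> gen_alg H T"
  using T by (auto simp: gen_alg_def cstar_generated_def)

text \<open>An error relative to \<open>norm x\<close> on the whole domain controls all layers at
  once, and each layer algebra is norm closed. Commutation with the projections survives because
  they are contractions.\<close>

lemma gen_alg_limit:
  assumes app: "\<And>e::real. e > 0 \<Longrightarrow> \<exists>B\<in>gen_alg H T. \<forall>x\<in>dom_union H. norm (Y x - B x) \<le> e * norm x"
    and off: "\<And>x. x \<notin> dom_union H \<Longrightarrow> Y x = 0"
  shows "Y \<in> gen_alg H T"
proof -
  have layer: "op_restrict (H \<alpha>) Y \<in> cstar_generated (H \<alpha>) (op_restrict (H \<alpha>) T)" for \<alpha>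
  proof (rule unital_cstar_subalgebra_limit[OF closed_csubspace_H unital_cstar_subalgebra_layer])
    fix e :: real assume "e > 0"
    then obtain B where "B \<in> gen_alg H T" "\<forall>x\<in>dom_union H. norm (Y x - B x) \<le> e * norm x"
      using app by blast
    then show "\<exists>B\<in>cstar_generated (H \<alpha>) (op_restrict (H \<alpha>) T).
        \<forall>x\<in>H \<alpha>. norm (op_restrict (H \<alpha>) Y x - B x) \<le> e * norm x"
      using gen_algD(2)[of B \<alpha>] by (intro bexI[of _ "op_restrict (H \<alpha>) B"])
        (auto simp: op_restrict_apply intro: dom_unionI)
  qed (simp add: op_restrict_apply)
  have "Y \<in> local_ops H"
  proof (rule local_opsI[OF off])
    show "op_restrict (H \<alpha>) Y \<in> bounded_ops (H \<alpha>)" for \<alpha> using layer layerD(1) by blast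
    fix \<alpha> x assume x: "x \<in> dom_union H"
    show "orth_proj (H \<alpha>) (Y x) = Y (orth_proj (H \<alpha>) x)"
    proof (rule eq_if_norm_le_all)
      fix e :: real assume "e > 0"
      then obtain B where B: "B \<in> gen_alg H T" "\<And>x. x \<in> dom_union H \<Longrightarrow> norm (Y x - B x) \<le> e * norm x"
        using app by blast
      have "orth_proj (H \<alpha>) (Y x) - Y (orth_proj (H \<alpha>) x)
          = orth_proj (H \<alpha>) (Y x - B x) - (Y (orth_proj (H \<alpha>) x) - B (orth_proj (H \<alpha>) x))"
        using local_opsD(3)[OF gen_algD(1)[OF B(1)] x] by (simp add: orth_proj_diff[OF closed_csubspace_H])
      also have "norm \<dots> \<le> norm (Y x - B x) + norm (Y (orth_proj (H \<alpha>) x) - B (orth_proj (H \<alpha>) x))"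
        using norm_triangle_ineq4 norm_orth_proj_le[OF closed_csubspace_H] by (smt (verit))
      also have "\<dots> \<le> e * norm x + e * norm (orth_proj (H \<alpha>) x)"
        by (intro add_mono B(2) x orth_proj_H_dom_union)
      also have "\<dots> = e * (norm x + norm (orth_proj (H \<alpha>) x))" by (simp add: distrib_left)
      finally show "norm (orth_proj (H \<alpha>) (Y x) - Y (orth_proj (H \<alpha>) x))
          \<le> e * (norm x + norm (orth_proj (H \<alpha>) x))" .
    qed
  qed
  then show ?thesis using layer by (simp add: gen_alg_def)
qed

text \<open>In every layer the inverse already lies in the generated C*-algebra, so the glued
  inverse belongs to \<open>gen_alg H T\<close> and is available to characters. This rests on
  coercivity in all layers, not in a single one.\<close>

lemma gen_alg_inverse:
  assumes U: "U \<in> gen_alg H T" and c: "c > 0"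
    and coercive: "\<And>x. x \<in> dom_union H \<Longrightarrow> c * (norm x)\<^sup>2 \<le> Re (cinner (U x) x)"
  obtains V where "V \<in> gen_alg H T" "V \<circ> U = op_id (dom_union H)" "U \<circ> V = op_id (dom_union H)"
proof -
  have "\<exists>V. V \<in> cstar_generated (H \<alpha>) (op_restrict (H \<alpha>) T) \<and>
      V \<circ> op_restrict (H \<alpha>) U = op_id (H \<alpha>) \<and> op_restrict (H \<alpha>) U \<circ> V = op_id (H \<alpha>)" for \<alpha>
  proof -
    have "c * (norm x)\<^sup>2 \<le> Re (cinner (op_restrict (H \<alpha>) U x) x)" if "x \<in> H \<alpha>" for x
      using coercive[OF dom_unionI[OF that]] that by (simp add: op_restrict_apply)
    then show ?thesis
      using cstar_inverse_coercive[OF closed_csubspace_H unital_cstar_subalgebra_layer gen_algD(2)[OF U] c]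
      by blast
  qed
  then have "\<forall>\<alpha>. \<exists>V. V \<in> cstar_generated (H \<alpha>) (op_restrict (H \<alpha>) T) \<and>
      V \<circ> op_restrict (H \<alpha>) U = op_id (H \<alpha>) \<and> op_restrict (H \<alpha>) U \<circ> V = op_id (H \<alpha>)" by blast
  then obtain V where V: "\<forall>\<alpha>. V \<alpha> \<in> cstar_generated (H \<alpha>) (op_restrict (H \<alpha>) T) \<and>
      V \<alpha> \<circ> op_restrict (H \<alpha>) U = op_id (H \<alpha>) \<and> op_restrict (H \<alpha>) U \<circ> V \<alpha> = op_id (H \<alpha>)"
    by (rule choice[THEN exE])
  obtain R where R: "R \<in> local_ops H" "\<And>\<alpha>. op_restrict (H \<alpha>) R = V \<alpha>"
      "R \<circ> U = op_id (dom_union H)" "U \<circ> R = op_id (dom_union H)"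
    using local_inverse_glue[OF gen_algD(1)[OF U], of V] V layerD(1) by blast
  have "R \<in> gen_alg H T" using R(1,2) V by (simp add: gen_alg_def)
  then show ?thesis using R(3,4) by (rule that)
qed

end

section \<open>Characters\<close>

text \<open>For the quotient operations, which are unions over representatives.\<close>

lemma UN_eq_const: "X \<noteq> {} \<Longrightarrow> (\<And>x. x \<in> X \<Longrightarrow> f x = c) \<Longrightarrow> (\<Union>x\<in>X. f x) = c"
  by auto

lemma coercive_of_unit:
  assumes M: "closed_csubspace (M :: 'h::complex_hilbert_space set)"
    and scale: "\<And>r x. x \<in> M \<Longrightarrow> q (complex_of_real r *\<^sub>C x) = r\<^sup>2 * q x"
    and unit: "\<And>x. x \<in> M \<Longrightarrow> norm x = 1 \<Longrightarrow> c \<le> q x" and x: "x \<in> M"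
  shows "c * (norm x)\<^sup>2 \<le> q x"
proof (cases "x = 0")
  case True
  then show ?thesis using scale[OF x, of 0] by simp
next
  case False
  have "c \<le> q (complex_of_real (1 / norm x) *\<^sub>C x)"
    using False closed_csubspaceD(4)[OF M x] by (intro unit) (auto simp: norm_divide)
  also have "\<dots> = (1 / norm x)\<^sup>2 * q x" by (rule scale[OF x])
  finally show ?thesis using False by (simp add: field_simps)
qed

context local_operator
begin

abbreviation "D \<equiv> dom_union H"

text \<open>Characters of the quotient by \<open>null_ideal H T \<alpha>\<close>, seen as functionals on the algebra itself.\<close>

definition layer_character :: "'l \<Rightarrow> (('h \<Rightarrow> 'h) \<Rightarrow> complex) \<Rightarrow> bool" where
  "layer_character \<alpha> \<psi> \<longleftrightarrow>
     (\<forall>R\<in>gen_alg H T. \<forall>S\<in>gen_alg H T. \<psi> (op_add R S) = \<psi> R + \<psi> S \<and> \<psi> (R \<circ> S) = \<psi> R * \<psi> S) \<and>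
     (\<forall>c. \<forall>R\<in>gen_alg H T. \<psi> (op_scale c R) = c * \<psi> R) \<and>
     (\<exists>R\<in>gen_alg H T. \<psi> R \<noteq> 0) \<and>
     (\<forall>R\<in>gen_alg H T. (\<forall>x\<in>H \<alpha>. R x = 0) \<longrightarrow> \<psi> R = 0)"

lemma gen_alg_in:
  assumes "R \<in> gen_alg H T"
  shows "x \<in> D \<Longrightarrow> R x \<in> D" "x \<in> H \<alpha> \<Longrightarrow> R x \<in> H \<alpha>"
  using local_opsD(4,5)[OF gen_algD(1)[OF assms]] by blast+

text \<open>The scalar sequence \<open>a\<close> acts as majorant: its convergence makes
  \<open>Y\<close> Cauchy uniformly relative to \<open>norm x\<close> in all layers, although the
  operators themselves may be unbounded on \<open>D\<close>.\<close>

lemma gen_alg_uniform_limit: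
  assumes Y: "\<And>n. Y n \<in> gen_alg H T"
    and cauchy: "\<And>m n x. n \<le> m \<Longrightarrow> x \<in> D \<Longrightarrow> norm (Y m x - Y n x) \<le> (a m - a n) * norm x"
    and a: "a \<longlonglongrightarrow> (l::real)"
  obtains L where "L \<in> gen_alg H T" "\<And>x. x \<in> D \<Longrightarrow> (\<lambda>n. Y n x) \<longlonglongrightarrow> L x"
proof -
  have "convergent (\<lambda>n. Y n x)" if x: "x \<in> D" for x
  proof -
    have "Cauchy (\<lambda>n. Y n x)"
    proof (rule metric_CauchyI)
      fix e :: real assume "e > 0"
      then have "e / (norm x + 1) > 0" by (simp add: add_nonneg_pos)
      then obtain N where N: "\<And>m n. m \<ge> N \<Longrightarrow> n \<ge> N \<Longrightarrow> dist (a m) (a n) < e / (norm x + 1)"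
        using LIMSEQ_imp_Cauchy[OF a] unfolding Cauchy_def by meson
      have *: "dist (Y m x) (Y n x) < e" if "n \<ge> N" "n \<le> m" for m n
      proof -
        have "dist (Y m x) (Y n x) \<le> (a m - a n) * norm x"
          using cauchy[OF that(2) x] by (simp add: dist_norm)
        also have "\<dots> \<le> e / (norm x + 1) * norm x"
          using N[of m n] that by (intro mult_right_mono) (auto simp: dist_real_def)
        also have "\<dots> < e / (norm x + 1) * (norm x + 1)"
          using \<open>e / (norm x + 1) > 0\<close> by (intro mult_strict_left_mono) auto
        also have "\<dots> = e" by (simp add: add_nonneg_eq_0_iff)
        finally show ?thesis .
      qed
      have "dist (Y m x) (Y n x) < e" if "m \<ge> N" "n \<ge> N" for m n
        using *[of n m] *[of m n] that by (cases "n \<le> m") (auto simp: dist_commute)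
      then show "\<exists>N. \<forall>m\<ge>N. \<forall>n\<ge>N. dist (Y m x) (Y n x) < e" by blast
    qed
    then show ?thesis by (rule Cauchy_convergent)
  qed
  define L where "L = op_restrict D (\<lambda>x. lim (\<lambda>n. Y n x))"
  have L: "(\<lambda>n. Y n x) \<longlonglongrightarrow> L x" if "x \<in> D" for x
    using \<open>x \<in> D \<Longrightarrow> convergent (\<lambda>n. Y n x)\<close> that
    by (simp add: L_def op_restrict_apply convergent_LIMSEQ_iff)
  have "L \<in> gen_alg H T"
  proof (rule gen_alg_limit)
    fix e :: real assume "e > 0"
    then have "\<forall>\<^sub>F n in sequentially. l - e < a n" by (intro order_tendstoD(1)[OF a]) simp
    then obtain n where n: "l - e < a n" by (auto simp: eventually_sequentially)
    have "norm (L x - Y n x) \<le> e * norm x" if x: "x \<in> D" for x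
    proof -
      have "norm (L x - Y n x) \<le> (l - a n) * norm x"
      proof (rule LIMSEQ_le)
        show "(\<lambda>m. norm (Y m x - Y n x)) \<longlonglongrightarrow> norm (L x - Y n x)" by (intro tendsto_intros L x)
        show "(\<lambda>m. (a m - a n) * norm x) \<longlonglongrightarrow> (l - a n) * norm x" by (intro tendsto_intros a)
      qed (use cauchy[OF _ x] in blast)
      also have "\<dots> \<le> e * norm x" using n by (intro mult_right_mono) auto
      finally show ?thesis .
    qed
    then show "\<exists>B\<in>gen_alg H T. \<forall>x\<in>D. norm (L x - B x) \<le> e * norm x" using Y by blast
  qed (simp add: L_def op_restrict_apply)
  then show ?thesis using L by (rule that)
qed

context
  fixes \<alpha> \<psi>
  assumes \<psi>: "layer_character \<alpha> \<psi>"
begin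

lemma char_add: "R \<in> gen_alg H T \<Longrightarrow> S \<in> gen_alg H T \<Longrightarrow> \<psi> (op_add R S) = \<psi> R + \<psi> S"
  and char_comp: "R \<in> gen_alg H T \<Longrightarrow> S \<in> gen_alg H T \<Longrightarrow> \<psi> (R \<circ> S) = \<psi> R * \<psi> S"
  and char_scale: "R \<in> gen_alg H T \<Longrightarrow> \<psi> (op_scale c R) = c * \<psi> R"
  and char_null: "R \<in> gen_alg H T \<Longrightarrow> (\<And>x. x \<in> H \<alpha> \<Longrightarrow> R x = 0) \<Longrightarrow> \<psi> R = 0"
  using \<psi> unfolding layer_character_def by blast+

lemma char_diff: "R \<in> gen_alg H T \<Longrightarrow> S \<in> gen_alg H T \<Longrightarrow> \<psi> (op_diff R S) = \<psi> R - \<psi> S"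
  by (simp add: op_diff_eq_add char_add char_scale gen_alg_scale)

lemma char_id: "\<psi> (op_id D) = 1"
proof -
  obtain R where R: "R \<in> gen_alg H T" "\<psi> R \<noteq> 0" using \<psi> unfolding layer_character_def by blast
  have "op_id D \<circ> R = R"
    using local_opsD(1,5)[OF gen_algD(1)[OF R(1)]] by (auto simp: op_id_apply fun_eq_iff)
  then show ?thesis using char_comp[OF gen_alg_id R(1)] R(2) by simp
qed

lemma char_eq:
  assumes "R \<in> gen_alg H T" "S \<in> gen_alg H T" "\<And>x. x \<in> H \<alpha> \<Longrightarrow> R x = S x"
  shows "\<psi> R = \<psi> S"
  using char_null[OF gen_alg_diff[OF assms(1,2)]] char_diff[OF assms(1,2)] assms(3)
  by (simp add: op_diff_def)

section \<open>Elements on which a character cannot vanish\<close>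

text \<open>\<open>U\<close> has an inverse in the algebra, and a multiplicative functional with
  value 1 at the unit cannot kill an invertible element. This takes the place of a norm estimate for
  \<open>\<psi>\<close>.\<close>

lemma char_coercive_nonzero:
  assumes U: "U \<in> gen_alg H T" and "c > 0"
    and "\<And>x. x \<in> D \<Longrightarrow> c * (norm x)\<^sup>2 \<le> Re (cinner (U x) x)"
  shows "\<psi> U \<noteq> 0"
proof -
  obtain V where V: "V \<in> gen_alg H T" "V \<circ> U = op_id D"
    using gen_alg_inverse[OF assms] by blast
  show ?thesis using char_comp[OF V(1) U] V(2) char_id by auto
qed

text \<open>With \<open>G = t (W - e)\<close>, the iterates \<open>Y (n + 1) = (1 - G\<^sup>2 + (Y n)\<^sup>2) / 2\<close> converge to
  \<open>1 - \<bar>G\<bar>\<close>, a contraction equal to \<open>1 - G\<close> on \<open>H \<alpha>\<close>, where \<open>G\<close> is positive. So \<open>\<psi>\<close> maps the limit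
  to \<open>1 - \<psi> G\<close>, which exceeds 1 if \<open>\<psi> W = 0\<close>.\<close>

lemma char_bounded_nonzero:
  assumes W: "W \<in> gen_alg H T"
    and sym: "\<And>x y. x \<in> D \<Longrightarrow> y \<in> D \<Longrightarrow> cinner (W x) y = cinner x (W y)"
    and le: "\<And>x. x \<in> D \<Longrightarrow> norm (W x) \<le> norm x" and c: "c > 0"
    and coercive: "\<And>x. x \<in> H \<alpha> \<Longrightarrow> c * (norm x)\<^sup>2 \<le> Re (cinner (W x) x)"
  shows "\<psi> W \<noteq> 0"
proof
  assume "\<psi> W = 0"
  \<comment> \<open>Since \<open>2 * e \<le> c\<close>, the shift \<open>N = W - e\<close> is still
    coercive with constant \<open>e\<close> on \<open>H \<alpha>\<close>, and
    \<open>e \<le> 1\<close> bounds \<open>N\<close> by 2. Then \<open>t = e / 4\<close> minimises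
    \<open>1 - 2 t e + 4 t^2\<close>, the bound for the squared norm of \<open>1 - t N\<close> on
    \<open>H \<alpha>\<close>; the minimum is \<open>r^2\<close> below.\<close>
  define e where "e = min c 1 / 2"
  define t where "t = e / 4"
  have e: "0 < e" "e \<le> 1 / 2" "2 * e \<le> c" using c by (auto simp: e_def)
  have t: "0 < t" "t \<le> 1 / 8" using e by (auto simp: t_def)
  define N where "N = op_diff W (op_scale (complex_of_real e) (op_id D))"
  define G where "G = op_scale (complex_of_real t) N"
  have N: "N \<in> gen_alg H T" unfolding N_def by (intro gen_alg_diff gen_alg_scale gen_alg_id W)
  have G: "G \<in> gen_alg H T" unfolding G_def by (intro gen_alg_scale N)
  note G_in = gen_alg_in[OF G]
  have N_apply: "N x = W x - e *\<^sub>R x" if "x \<in> D" for x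
    using that by (simp add: N_def op_diff_def op_scale_def op_id_apply scaleR_scaleC)
  have G_apply: "G x = t *\<^sub>R N x" if "x \<in> D" for x
    using that by (simp add: G_def op_scale_def scaleR_scaleC)
  have N_le: "norm (N x) \<le> 2 * norm x" if x: "x \<in> D" for x
  proof -
    have "norm (N x) \<le> norm (W x) + norm (e *\<^sub>R x)"
      unfolding N_apply[OF x] by (rule norm_triangle_ineq4)
    also have "\<dots> \<le> norm x + 1 * norm x"
      using le[OF x] e mult_right_mono[of e 1 "norm x"] by (intro add_mono) auto
    finally show ?thesis by simp
  qed
  have G_le: "norm (G x) \<le> norm x" if x: "x \<in> D" for x
  proof -
    have "norm (G x) = t * norm (N x)" using G_apply[OF x] t by simp
    also have "\<dots> \<le> (1 / 8) * (2 * norm x)" using t N_le[OF x] by (intro mult_mono) auto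
    also have "\<dots> \<le> norm x" by simp
    finally show ?thesis .
  qed
  have G_sym: "cinner (G x) y = cinner x (G y)" if "x \<in> D" "y \<in> D" for x y
    using sym[OF that] that by (simp add: G_apply N_apply scaleR_scaleC cinner_simps)
  define r where "r = sqrt (1 - e\<^sup>2 / 4)"
  have "e\<^sup>2 \<le> 1\<^sup>2" using e by (intro power_mono) auto
  then have "0 \<le> 1 - e\<^sup>2 / 4" "1 - e\<^sup>2 / 4 < 1" using e by auto
  then have r: "0 \<le> r" "r < 1" "r\<^sup>2 = 1 - e\<^sup>2 / 4" by (auto simp: r_def)
  have r_le: "norm (x - G x) \<le> r * norm x" if x: "x \<in> H \<alpha>" for x
  proof -
    note xD = dom_unionI[OF x]
    have "Re (cinner (N x) x) = Re (cinner (W x) x) - e * (norm x)\<^sup>2"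
      unfolding N_apply[OF xD] by (simp add: scaleR_scaleC cinner_simps cinner_self)
    moreover have "2 * e * (norm x)\<^sup>2 \<le> c * (norm x)\<^sup>2" using e by (intro mult_right_mono) auto
    ultimately have N_coercive: "e * (norm x)\<^sup>2 \<le> Re (cinner (N x) x)" using coercive[OF x] by linarith
    have "(norm (x - G x))\<^sup>2 = (norm x)\<^sup>2 - 2 * t * Re (cinner (N x) x) + t\<^sup>2 * (norm (N x))\<^sup>2"
      unfolding G_apply[OF xD] norm_diff_square
      by (simp add: scaleR_scaleC cinner_simps power_mult_distrib cinner_commute[of x "N x"])
    also have "\<dots> \<le> (norm x)\<^sup>2 - 2 * t * (e * (norm x)\<^sup>2) + t\<^sup>2 * (2 * norm x)\<^sup>2"
      using N_coercive N_le[OF xD] t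
      by (intro add_mono diff_mono mult_left_mono power_mono) auto
    also have "\<dots> = (1 - e\<^sup>2 / 4) * (norm x)\<^sup>2"
      by (simp add: t_def power2_eq_square algebra_simps)
    also have "\<dots> = (r * norm x)\<^sup>2" by (simp only: power_mult_distrib r(3))
    finally show ?thesis by (rule power2_le_imp_le) (simp add: r(1))
  qed
  define X where "X = op_diff (op_id D) (G \<circ> G)"
  have X: "X \<in> gen_alg H T" unfolding X_def by (intro gen_alg_diff gen_alg_id gen_alg_comp G)
  have X_apply: "X x = x - G (G x)" if "x \<in> D" for x
    using that by (simp add: X_def op_diff_def op_id_apply)
  have X_le: "norm (X x) \<le> norm x" if x: "x \<in> D" for x
  proof (rule power2_le_imp_le)
    \<comment> \<open>Symmetry of \<open>G\<close> turns the cross term into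
      \<open>(norm (G x))^2\<close>, and contractivity lets it absorb the last summand.\<close>
    have "(norm (X x))\<^sup>2 = (norm x)\<^sup>2 - 2 * (norm (G x))\<^sup>2 + (norm (G (G x)))\<^sup>2"
    proof -
      have "Re (cinner x (G (G x))) = (norm (G x))\<^sup>2"
        using G_sym[OF x G_in(1)[OF x]] by (metis cinner_self Re_complex_of_real)
      then show ?thesis unfolding X_apply[OF x] norm_diff_square by simp
    qed
    moreover have "(norm (G (G x)))\<^sup>2 \<le> (norm (G x))\<^sup>2"
      by (intro power_mono G_le G_in x) simp
    ultimately show "(norm (X x))\<^sup>2 \<le> (norm x)\<^sup>2"
      using zero_le_power2[of "norm (G x)"] by linarith
  qed simp
  \<comment> \<open>A fixed point \<open>y\<close> of the step commuting with the unit satisfies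
    \<open>(1 - y)^2 = G^2\<close>: this is the classical square root iteration, started at 0 so
    that all iterates are contractions.\<close>
  define Y where "Y n = ((\<lambda>y. op_scale (1/2) (op_add X (y \<circ> y))) ^^ n) (op_scale 0 (op_id D))" for n
  have Y0: "Y 0 = op_scale 0 (op_id D)" and YSuc: "Y (Suc n) = op_scale (1/2) (op_add X (Y n \<circ> Y n))" for n
    by (simp_all add: Y_def)
  have Y: "Y n \<in> gen_alg H T" for n
    by (induction n) (auto simp: Y0 YSuc intro!: gen_alg_scale gen_alg_id gen_alg_add gen_alg_comp X)
  note Y_in = gen_alg_in[OF Y] and Y_diff = local_opsD(8)[OF gen_algD(1)[OF Y]]
  have half: "complex_of_real (1/2) = 1/2" by simp
  have YSuc_apply: "Y (Suc n) x = (1/2) *\<^sub>R (X x + Y n (Y n x))" for n x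
    unfolding YSuc op_scale_def op_add_def scaleR_scaleC half by simp
  \<comment> \<open>The same recursion with \<open>X\<close> replaced by its norm bound 1. It
    increases and stays below 1, and it dominates both the iterates and their increments.\<close>
  define a where "a n = ((\<lambda>r. (1 + r\<^sup>2) / 2) ^^ n) (0::real)" for n
  have a0: "a 0 = 0" and aSuc: "a (Suc n) = (1 + (a n)\<^sup>2) / 2" for n by (simp_all add: a_def)
  have a_bounds: "0 \<le> a n" "a n \<le> 1" for n
    by (induction n) (auto simp: a0 aSuc power_le_one add_nonneg_nonneg)
  have a_step: "a n \<le> a (Suc n)" for n
  proof -
    have "0 \<le> (a n - 1)\<^sup>2" by simp
    then show ?thesis by (simp add: aSuc power2_eq_square algebra_simps)
  qed
  have half_le: "norm ((1/2) *\<^sub>R (u + v)) \<le> (p + q) / 2" if "norm u \<le> p" "norm v \<le> q" for u v :: 'h and p q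
    using norm_triangle_ineq[of u v] that by simp
  have Y_le: "norm (Y n x) \<le> a n * norm x" if "x \<in> D" for n x
    using that
  proof (induction n arbitrary: x)
    case (Suc n)
    have "norm (Y n (Y n x)) \<le> a n * norm (Y n x)" by (intro Suc Y_in)
    also have "\<dots> \<le> a n * (a n * norm x)" using Suc a_bounds by (intro mult_left_mono) auto
    finally have "norm (Y (Suc n) x) \<le> (norm x + a n * (a n * norm x)) / 2"
      unfolding YSuc_apply by (intro half_le X_le Suc)
    then show ?case by (simp add: aSuc algebra_simps power2_eq_square)
  qed (simp add: Y0 op_scale_def a0)
  have Y_step: "norm (Y (Suc n) x - Y n x) \<le> (a (Suc n) - a n) * norm x" if "x \<in> D" for n x
    using that
  proof (induction n arbitrary: x)
    case 0
    then show ?case using X_le[OF 0] Y_le[OF 0, of 0] local_opsD(9)[OF gen_algD(1)[OF Y]]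
      by (simp add: YSuc_apply aSuc a0)
  next
    case (Suc n)
    let ?d = "a (Suc n) - a n"
    have d: "0 \<le> ?d" using a_step[of n] by simp
    \<comment> \<open>The difference of squares telescopes with the factors kept in order; the
      second summand is an increment evaluated at \<open>Y n x\<close>, which is why the induction
      leaves \<open>x\<close> arbitrary.\<close>
    have "Y (Suc (Suc n)) x - Y (Suc n) x
        = (1/2) *\<^sub>R (Y (Suc n) (Y (Suc n) x - Y n x) + (Y (Suc n) (Y n x) - Y n (Y n x)))"
      using Suc.prems Y_in by (simp add: YSuc_apply[of "Suc n"] Y_diff) (simp add: YSuc_apply[of n] algebra_simps)
    also have "norm \<dots> \<le> (a (Suc n) * (?d * norm x) + ?d * (a n * norm x)) / 2"
    proof (rule half_le)
      have "Y (Suc n) x - Y n x \<in> D"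
        using local_opsD(5)[OF gen_algD(1)[OF gen_alg_diff[OF Y Y]] Suc.prems] by (simp add: op_diff_def)
      then have "norm (Y (Suc n) (Y (Suc n) x - Y n x)) \<le> a (Suc n) * norm (Y (Suc n) x - Y n x)"
        by (rule Y_le)
      also have "\<dots> \<le> a (Suc n) * (?d * norm x)"
        using a_bounds Suc.IH[OF Suc.prems] by (intro mult_left_mono) auto
      finally show "norm (Y (Suc n) (Y (Suc n) x - Y n x)) \<le> a (Suc n) * (?d * norm x)" .
      have "norm (Y (Suc n) (Y n x) - Y n (Y n x)) \<le> ?d * norm (Y n x)"
        by (intro Suc.IH Y_in Suc.prems)
      also have "\<dots> \<le> ?d * (a n * norm x)" using d Y_le[OF Suc.prems] by (intro mult_left_mono)
      finally show "norm (Y (Suc n) (Y n x) - Y n (Y n x)) \<le> ?d * (a n * norm x)" .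
    qed
    also have "\<dots> = (((a (Suc n))\<^sup>2 - (a n)\<^sup>2) / 2) * norm x"
      by (simp add: power2_eq_square algebra_simps)
    also have "((a (Suc n))\<^sup>2 - (a n)\<^sup>2) / 2 = a (Suc (Suc n)) - a (Suc n)"
      by (simp only: aSuc[of "Suc n"] aSuc[of n]) (simp add: field_simps)
    finally show ?case .
  qed
  from a_step have "incseq a" by (rule incseq_SucI)
  then obtain l where l: "a \<longlonglongrightarrow> l" using incseq_convergent[of a 1] a_bounds by blast
  have Y_cauchy: "norm (Y m x - Y n x) \<le> (a m - a n) * norm x" if "n \<le> m" "x \<in> D" for m n x
    using that(1)
  proof (induction m rule: dec_induct)
    case (step m)
    have "norm (Y (Suc m) x - Y n x) \<le> norm (Y (Suc m) x - Y m x) + norm (Y m x - Y n x)"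
      using norm_triangle_ineq[of "Y (Suc m) x - Y m x" "Y m x - Y n x"] by simp
    also have "\<dots> \<le> (a (Suc m) - a m) * norm x + (a m - a n) * norm x"
      by (intro add_mono Y_step step that)
    finally show ?case by (simp add: algebra_simps)
  qed simp
  obtain L where L: "L \<in> gen_alg H T" "\<And>x. x \<in> D \<Longrightarrow> (\<lambda>n. Y n x) \<longlonglongrightarrow> L x"
    using gen_alg_uniform_limit[of Y a l, OF Y Y_cauchy l] by blast
  have L_le: "norm (L x) \<le> norm x" if x: "x \<in> D" for x
  proof (rule LIMSEQ_le_const2)
    show "(\<lambda>n. norm (Y n x)) \<longlonglongrightarrow> norm (L x)" by (intro tendsto_intros L x)
    have "norm (Y n x) \<le> norm x" for n
      using Y_le[OF x, of n] mult_right_mono[OF a_bounds(2)[of n], of "norm x"] by simp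
    then show "\<exists>N. \<forall>n\<ge>N. norm (Y n x) \<le> norm x" by blast
  qed
  \<comment> \<open>\<open>1 - G\<close> is itself a fixed point, so the error \<open>E\<close>
    evolves by \<open>((1 - G) E + E Y) / 2\<close>. On \<open>H \<alpha>\<close> the factor
    \<open>1 - G\<close> contributes \<open>r\<close> and \<open>Y\<close> contributes 1, hence the
    ratio \<open>(r + 1) / 2\<close>.\<close>
  have err: "norm (x - G x - Y n x) \<le> ((r + 1) / 2) ^ n * norm x" if "x \<in> H \<alpha>" for n x
    using that
  proof (induction n arbitrary: x)
    case 0
    then show ?case
      using r_le[OF 0] r mult_right_mono[of r 1 "norm x"] by (simp add: Y0 op_scale_def)
  next
    case (Suc n)
    note x = Suc.prems and xD = dom_unionI[OF Suc.prems]
    let ?q = "((r + 1) / 2) ^ n" and ?E = "x - G x - Y n x"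
    have q: "0 \<le> ?q" using r by simp
    have E: "?E \<in> H \<alpha>"
      using x G_in(2)[OF x] Y_in(2)[OF x] closed_csubspaceD(6)[OF closed_csubspace_H] by blast
    have G_E: "G ?E = G x - G (G x) - G (Y n x)"
      using xD G_in(1)[OF xD] Y_in(1)[OF xD]
        local_opsD(5)[OF gen_algD(1)[OF gen_alg_diff[OF gen_alg_id G]] xD]
      by (simp add: local_opsD(8)[OF gen_algD(1)[OF G]] op_diff_def op_id_apply)
    have double: "v = (1/2) *\<^sub>R u" if "v + v = u" for u v :: 'h
      using that by (metis scaleR_half_double)
    have "Y (Suc n) x + Y (Suc n) x = X x + Y n (Y n x)"
      unfolding YSuc_apply by (metis scaleR_half_double scaleR_add_right)
    then have "(x - G x - Y (Suc n) x) + (x - G x - Y (Suc n) x)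
        = (?E - G ?E) + (Y n x - G (Y n x) - Y n (Y n x))"
      unfolding X_apply[OF xD] G_E by (simp add: algebra_simps)
    then have "x - G x - Y (Suc n) x = (1/2) *\<^sub>R ((?E - G ?E) + (Y n x - G (Y n x) - Y n (Y n x)))"
      by (rule double)
    also have "norm \<dots> \<le> (r * (?q * norm x) + ?q * (1 * norm x)) / 2"
    proof (rule half_le)
      have "norm (?E - G ?E) \<le> r * norm ?E" by (rule r_le[OF E])
      also have "\<dots> \<le> r * (?q * norm x)" using r Suc.IH[OF x] by (intro mult_left_mono) auto
      finally show "norm (?E - G ?E) \<le> r * (?q * norm x)" .
      have "norm (Y n x - G (Y n x) - Y n (Y n x)) \<le> ?q * norm (Y n x)"
        by (intro Suc.IH Y_in x)
      also have "\<dots> \<le> ?q * (1 * norm x)"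
        using q Y_le[OF xD, of n] mult_right_mono[OF a_bounds(2)[of n], of "norm x"]
        by (intro mult_left_mono) auto
      finally show "norm (Y n x - G (Y n x) - Y n (Y n x)) \<le> ?q * (1 * norm x)" .
    qed
    also have "\<dots> = ((r + 1) / 2) ^ Suc n * norm x" by (simp add: algebra_simps)
    finally show ?case .
  qed
  have L_eq: "L x = x - G x" if x: "x \<in> H \<alpha>" for x
  proof -
    have "(\<lambda>n. ((r + 1) / 2) ^ n * norm x) \<longlonglongrightarrow> 0 * norm x"
      using r by (intro tendsto_intros LIMSEQ_realpow_zero) auto
    then have "(\<lambda>n. ((r + 1) / 2) ^ n * norm x) \<longlonglongrightarrow> 0" by simp
    then have "(\<lambda>n. x - G x - Y n x) \<longlonglongrightarrow> 0"
      by (rule tendsto_0_normI) (simp add: err[OF x])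
    moreover have "(\<lambda>n. x - G x - Y n x) \<longlonglongrightarrow> x - G x - L x"
      by (intro tendsto_intros L dom_unionI[OF x])
    ultimately have "x - G x - L x = 0" using LIMSEQ_unique by blast
    then show ?thesis by simp
  qed
  have "\<psi> L = \<psi> (op_diff (op_id D) G)"
    using L_eq dom_unionI
    by (intro char_eq L gen_alg_diff gen_alg_id G) (simp add: op_diff_def op_id_apply)
  also have "\<dots> = 1 + complex_of_real (t * e)"
    using \<open>\<psi> W = 0\<close> unfolding G_def N_def
    by (simp add: char_diff char_scale char_id gen_alg_diff gen_alg_scale gen_alg_id W)
  finally have \<psi>L: "\<psi> L = 1 + complex_of_real (t * e)" .
  \<comment> \<open>Killed by \<open>\<psi>\<close> by construction, yet coercive with constant
    \<open>t * e\<close> on all of \<open>D\<close>, because \<open>L\<close> is a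
    contraction.\<close>
  define U where "U = op_diff (op_scale (1 + complex_of_real (t * e)) (op_id D)) L"
  have "U \<in> gen_alg H T" unfolding U_def by (intro gen_alg_diff gen_alg_scale gen_alg_id L)
  moreover have "(t * e) * (norm x)\<^sup>2 \<le> Re (cinner (U x) x)" if x: "x \<in> D" for x
  proof -
    have "cinner (U x) x = complex_of_real ((1 + t * e) * (norm x)\<^sup>2) - cinner (L x) x"
      using x by (simp add: U_def op_diff_def op_scale_def op_id_apply cinner_simps cinner_self)
    then have "Re (cinner (U x) x) = (1 + t * e) * (norm x)\<^sup>2 - Re (cinner (L x) x)"
      by (simp only: minus_complex.sel Re_complex_of_real)
    moreover have "Re (cinner (L x) x) \<le> norm x * norm x"
      using Re_cinner_le[of "L x" x] mult_right_mono[OF L_le[OF x], of "norm x"] by simp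
    ultimately show ?thesis by (simp add: power2_eq_square algebra_simps)
  qed
  moreover have "t * e > 0" using t e by simp
  ultimately have "\<psi> U \<noteq> 0" by (intro char_coercive_nonzero[of U "t * e"])
  moreover have "\<psi> U = 0"
    unfolding U_def by (simp add: char_diff char_scale char_id gen_alg_scale gen_alg_id L \<psi>L)
  ultimately show False by contradiction
qed

text \<open>Reduces to the bounded case through \<open>W = S (1 + S)^-1\<close>: positivity makes
  \<open>1 + S\<close> coercive on the whole domain, hence invertible in the algebra, and
  \<open>\<psi> S = 0\<close> would force \<open>\<psi> W = 0\<close>.\<close>

lemma char_positive_nonzero:
  assumes S: "S \<in> gen_alg H T"
    and sym: "\<And>x y. x \<in> D \<Longrightarrow> y \<in> D \<Longrightarrow> cinner (S x) y = cinner x (S y)"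
    and pos: "\<And>x. x \<in> D \<Longrightarrow> 0 \<le> Re (cinner (S x) x)" and c: "c > 0"
    and coercive: "\<And>x. x \<in> H \<alpha> \<Longrightarrow> c * (norm x)\<^sup>2 \<le> Re (cinner (S x) x)"
  shows "\<psi> S \<noteq> 0"
proof
  assume "\<psi> S = 0"
  define U where "U = op_add (op_id D) S"
  have U: "U \<in> gen_alg H T" unfolding U_def by (intro gen_alg_add gen_alg_id S)
  have U_apply: "U x = x + S x" if "x \<in> D" for x using that by (simp add: U_def op_add_def op_id_apply)
  have "1 * (norm x)\<^sup>2 \<le> Re (cinner (U x) x)" if x: "x \<in> D" for x
    using pos[OF x] by (simp add: U_apply[OF x] cinner_simps cinner_self)
  then obtain V where V: "V \<in> gen_alg H T" "U \<circ> V = op_id D"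
    using gen_alg_inverse[OF U, of 1] by auto
  note V_in = gen_alg_in[OF V(1)]
  have split: "V x + S (V x) = x" if x: "x \<in> D" for x
    using fun_cong[OF V(2), of x] U_apply[OF V_in(1)[OF x]] x by (simp add: op_id_apply)
  define W where "W = S \<circ> V"
  have W: "W \<in> gen_alg H T" unfolding W_def by (intro gen_alg_comp S V)
  have "\<psi> W \<noteq> 0"
  proof (rule char_bounded_nonzero[OF W])
    fix x y assume xy: "x \<in> D" "y \<in> D"
    have "cinner (W x) y = cinner (S (V x)) (V y + S (V y))" by (simp add: W_def split xy)
    also have "\<dots> = cinner (V x + S (V x)) (S (V y))"
      using sym[OF V_in(1)[OF xy(1)] V_in(1)[OF xy(2)]] by (simp add: cinner_simps)
    finally show "cinner (W x) y = cinner x (W y)" by (simp add: W_def split xy)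
  next
    fix x assume x: "x \<in> D"
    have "(norm x)\<^sup>2 = (norm (V x))\<^sup>2 + 2 * Re (cinner (S (V x)) (V x)) + (norm (S (V x)))\<^sup>2"
      using norm_add_square[of "V x" "S (V x)"] split[OF x] cinner_commute[of "V x" "S (V x)"] by simp
    then have "(norm (W x))\<^sup>2 \<le> (norm x)\<^sup>2" using pos[OF V_in(1)[OF x]] by (simp add: W_def)
    then show "norm (W x) \<le> norm x" by (rule power2_le_imp_le) simp
  next
    \<comment> \<open>With \<open>y = V x\<close> one has \<open>x = y + S y\<close>, and the real
      part of \<open>cinner (W x) x\<close> is at least \<open>min c 1 * (\<parallel>y\<parallel>^2
      + \<parallel>S y\<parallel>^2)\<close>. The factor one half pays for
      \<open>\<parallel>x\<parallel>^2 \<le> 2 * (\<parallel>y\<parallel>^2 + \<parallel>S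
      y\<parallel>^2)\<close>.\<close>
    show "min c 1 / 2 > 0" using c by simp
    fix x assume x: "x \<in> H \<alpha>"
    let ?y = "V x"
    have "(norm x)\<^sup>2 \<le> 2 * ((norm ?y)\<^sup>2 + (norm (S ?y))\<^sup>2)"
    proof -
      have "(norm x)\<^sup>2 \<le> (norm ?y + norm (S ?y))\<^sup>2"
        using norm_triangle_ineq[of ?y "S ?y"] split[OF dom_unionI[OF x]] by (intro power_mono) auto
      also have "\<dots> \<le> 2 * ((norm ?y)\<^sup>2 + (norm (S ?y))\<^sup>2)"
        using zero_le_power2[of "norm ?y - norm (S ?y)"] by (simp add: power2_eq_square algebra_simps)
      finally show ?thesis .
    qed
    then have "min c 1 / 2 * (norm x)\<^sup>2 \<le> min c 1 / 2 * (2 * ((norm ?y)\<^sup>2 + (norm (S ?y))\<^sup>2))"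
      using c by (intro mult_left_mono) auto
    also have "\<dots> = min c 1 * (norm ?y)\<^sup>2 + min c 1 * (norm (S ?y))\<^sup>2" by (simp add: algebra_simps)
    also have "\<dots> \<le> c * (norm ?y)\<^sup>2 + 1 * (norm (S ?y))\<^sup>2"
      by (intro add_mono mult_right_mono) auto
    also have "\<dots> \<le> Re (cinner (S ?y) ?y) + (norm (S ?y))\<^sup>2"
      using coercive[OF V_in(2)[OF x]] by simp
    also have "\<dots> = Re (cinner (S ?y) (?y + S ?y))" by (simp add: cinner_simps cinner_self)
    finally show "min c 1 / 2 * (norm x)\<^sup>2 \<le> Re (cinner (W x) x)"
      by (simp add: W_def split[OF dom_unionI[OF x]])
  qed
  moreover have "\<psi> W = 0" unfolding W_def using char_comp[OF S V(1)] \<open>\<psi> S = 0\<close> by simp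
  ultimately show False by contradiction
qed

section \<open>Characters as joint approximate eigenvalues\<close>

text \<open>Were there no such vector, one of the two squares in the quadratic form of
  \<open>S\<close> would be at least \<open>d^2\<close> on every unit vector of
  \<open>H \<alpha>\<close>. The factor \<open>C R\<close> alone makes \<open>\<psi>\<close> vanish
  on \<open>Q R\<close>, whatever its value on the adjoint.\<close>

lemma char_joint_approx_eigenvector:
  assumes R: "R \<in> gen_alg H T" and d: "d > 0"
  obtains x where "x \<in> H \<alpha>" "norm x = 1" "norm (T x - \<psi> T *\<^sub>C x) < d" "norm (R x - \<psi> R *\<^sub>C x) < d"
proof (rule ccontr)
  assume none: "\<not> thesis"
  define C where "C R = op_diff R (op_scale (\<psi> R) (op_id D))" for R
  define Q where "Q R = local_adj H (C R) \<circ> C R" for R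
  have C: "C R \<in> gen_alg H T" "\<psi> (C R) = 0" if "R \<in> gen_alg H T" for R
    using that unfolding C_def
    by (simp_all add: gen_alg_diff gen_alg_scale gen_alg_id char_diff char_scale char_id)
  have C_apply: "C R x = R x - \<psi> R *\<^sub>C x" if "x \<in> D" for R x
    using that by (simp add: C_def op_diff_def op_scale_def op_id_apply)
  have Q: "Q R \<in> gen_alg H T" "\<psi> (Q R) = 0" if "R \<in> gen_alg H T" for R
    using C[OF that] unfolding Q_def by (simp_all add: gen_alg_comp gen_alg_adj char_comp)
  have Q_cinner: "cinner (Q R x) y = cinner (C R x) (C R y)" "cinner x (Q R y) = cinner (C R x) (C R y)"
    if R: "R \<in> gen_alg H T" and xy: "x \<in> D" "y \<in> D" for R x y
  proof -
    note CR = gen_algD(1)[OF C(1)[OF R]]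
    have *: "cinner x (Q R y) = cinner (C R x) (C R y)" if "x \<in> D" "y \<in> D" for x y
      using cinner_local_adj[OF CR that(1) local_opsD(5)[OF CR that(2)]] by (simp add: Q_def)
    show "cinner (Q R x) y = cinner (C R x) (C R y)" using *[OF xy(2,1)] by (metis cinner_commute)
    show "cinner x (Q R y) = cinner (C R x) (C R y)" by (rule *[OF xy])
  qed
  define S where "S = op_add (Q T) (Q R)"
  have S: "S \<in> gen_alg H T" unfolding S_def by (intro gen_alg_add Q gen_alg_self R)
  have S_cinner: "Re (cinner (S x) x) = (norm (C T x))\<^sup>2 + (norm (C R x))\<^sup>2" if "x \<in> D" for x
    using that by (simp add: S_def op_add_def cinner_simps Q_cinner gen_alg_self R cinner_self)
  have "\<psi> S \<noteq> 0"
  proof (rule char_positive_nonzero[OF S])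
    show "cinner (S x) y = cinner x (S y)" if "x \<in> D" "y \<in> D" for x y
      using that by (simp add: S_def op_add_def cinner_simps Q_cinner gen_alg_self R)
    show "0 \<le> Re (cinner (S x) x)" if "x \<in> D" for x using S_cinner[OF that] by simp
    show "d\<^sup>2 > 0" using d by simp
    fix x assume "x \<in> H \<alpha>"
    then show "d\<^sup>2 * (norm x)\<^sup>2 \<le> Re (cinner (S x) x)"
    proof (rule coercive_of_unit[OF closed_csubspace_H, rotated 2])
      fix r x assume "x \<in> H \<alpha>"
      then show "Re (cinner (S (complex_of_real r *\<^sub>C x)) (complex_of_real r *\<^sub>C x)) = r\<^sup>2 * Re (cinner (S x) x)"
        using local_opsD(7)[OF gen_algD(1)[OF S] dom_unionI]
        by (simp add: cinner_simps power2_eq_square)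
    next
      fix x assume x: "x \<in> H \<alpha>" "norm x = 1"
      have "d \<le> norm (C T x) \<or> d \<le> norm (C R x)"
        using none that[OF x] C_apply[OF dom_unionI[OF x(1)]] by force
      then have "d\<^sup>2 \<le> (norm (C T x))\<^sup>2 \<or> d\<^sup>2 \<le> (norm (C R x))\<^sup>2"
        using d by (auto intro: power_mono)
      then show "d\<^sup>2 \<le> Re (cinner (S x) x)"
        unfolding S_cinner[OF dom_unionI[OF x(1)]]
        using zero_le_power2[of "norm (C T x)"] zero_le_power2[of "norm (C R x)"] by linarith
    qed
  qed
  moreover have "\<psi> S = 0" unfolding S_def by (simp add: char_add Q gen_alg_self R)
  ultimately show False by contradiction
qed

lemma char_in_approx_spectrum: "\<psi> T \<in> approx_spectrum (H \<alpha>) (op_restrict (H \<alpha>) T)"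
proof (rule ccontr)
  assume "\<not> ?thesis"
  then obtain d where d: "d > 0" "\<And>x. x \<in> H \<alpha> \<Longrightarrow> d * norm x \<le> norm (op_restrict (H \<alpha>) T x - \<psi> T *\<^sub>C x)"
    unfolding notin_approx_spectrum_iff[OF closed_csubspace_H bounded_ops_linear[OF local_opsD(2)[OF T]]]
    by blast
  obtain x where "x \<in> H \<alpha>" "norm x = 1" "norm (T x - \<psi> T *\<^sub>C x) < d"
    using char_joint_approx_eigenvector[OF gen_alg_self d(1)] by blast
  then show False using d(2)[of x] by (simp add: op_restrict_apply)
qed

text \<open>Joint approximate eigenvectors reach into every member of the filter at
  \<open>\<psi> T\<close>, so the candidates \<open>\<psi> R\<close> and \<open>c\<close> can be
  compared on one unit vector.\<close>

lemma char_eq_approx_eigenvalue: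
  assumes R: "R \<in> gen_alg H T"
    and c: "approx_eigenvalue (H \<alpha>) (approx_eigenfilter (H \<alpha>) (op_restrict (H \<alpha>) T) (\<psi> T))
      (op_restrict (H \<alpha>) R) c"
  shows "\<psi> R = c"
proof (rule ccontr)
  assume "\<psi> R \<noteq> c"
  define e where "e = cmod (\<psi> R - c) / 2"
  have e: "e > 0" using \<open>\<psi> R \<noteq> c\<close> by (simp add: e_def)
  have "\<forall>\<^sub>F x in approx_eigenfilter (H \<alpha>) (op_restrict (H \<alpha>) T) (\<psi> T).
      dist (op_restrict (H \<alpha>) R x - c *\<^sub>C x) 0 < e"
    using c e unfolding approx_eigenvalue_def tendsto_iff by blast
  then obtain d where d: "d > 0" "\<And>x. x \<in> H \<alpha> \<Longrightarrow> norm x = 1 \<Longrightarrow> norm (T x - \<psi> T *\<^sub>C x) < d \<Longrightarrow> norm (R x - c *\<^sub>C x) < e"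
    unfolding eventually_approx_eigenfilter by (auto simp: op_restrict_apply)
  obtain x where x: "x \<in> H \<alpha>" "norm x = 1" "norm (T x - \<psi> T *\<^sub>C x) < min d e" "norm (R x - \<psi> R *\<^sub>C x) < min d e"
    using char_joint_approx_eigenvector[OF R, of "min d e"] d(1) e by auto
  have "cmod (\<psi> R - c) = norm ((\<psi> R - c) *\<^sub>C x)" using x by simp
  also have "(\<psi> R - c) *\<^sub>C x = (R x - c *\<^sub>C x) - (R x - \<psi> R *\<^sub>C x)" by (simp add: scaleC_simps)
  also have "norm \<dots> \<le> norm (R x - c *\<^sub>C x) + norm (R x - \<psi> R *\<^sub>C x)" by (rule norm_triangle_ineq4)
  also have "\<dots> < e + e" using d(2)[of x] x by (intro add_strict_mono) auto
  finally show False by (simp add: e_def)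
qed

end

end

context local_operator
begin

section \<open>The quotient algebras\<close>

text \<open>The seminorm enters the cosets only through its zero set, so congruence can be handled
  as agreement on \<open>H \<alpha>\<close>.\<close>

lemma null_ideal_iff: "R \<in> null_ideal H T \<alpha> \<longleftrightarrow> R \<in> gen_alg H T \<and> (\<forall>x\<in>H \<alpha>. R x = 0)"
proof -
  have "cstar_seminorm H \<alpha> R = 0 \<longleftrightarrow> (\<forall>x\<in>H \<alpha>. R x = 0)" if R: "R \<in> gen_alg H T"
  proof
    assume "cstar_seminorm H \<alpha> R = 0"
    then show "\<forall>x\<in>H \<alpha>. R x = 0"
      using norm_le_op_norm[OF closed_csubspace_H local_opsD(2)[OF gen_algD(1)[OF R]]]
      by (fastforce simp: cstar_seminorm_def op_restrict_apply)
  next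
    assume 0: "\<forall>x\<in>H \<alpha>. R x = 0"
    have "0 \<in> {x \<in> H \<alpha>. norm x \<le> 1}" using closed_csubspaceD(2)[OF closed_csubspace_H] by simp
    then have "{x \<in> H \<alpha>. norm x \<le> 1} \<noteq> {}" by blast
    moreover have "norm (op_restrict (H \<alpha>) R x) = 0" for x using 0 by (simp add: op_restrict_apply)
    ultimately show "cstar_seminorm H \<alpha> R = 0" by (simp add: cstar_seminorm_def op_norm_def)
  qed
  then show ?thesis by (auto simp: null_ideal_def)
qed

lemma quot_map_eq:
  "R \<in> gen_alg H T \<Longrightarrow> quot_map H T \<alpha> R = {S \<in> gen_alg H T. \<forall>x\<in>H \<alpha>. S x = R x}"
  by (auto simp: quot_map_def null_ideal_iff gen_alg_diff) (auto simp: op_diff_def)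

lemma quot_map_eqI:
  "R \<in> gen_alg H T \<Longrightarrow> S \<in> gen_alg H T \<Longrightarrow> (\<And>x. x \<in> H \<alpha> \<Longrightarrow> R x = S x) \<Longrightarrow>
    quot_map H T \<alpha> R = quot_map H T \<alpha> S"
  by (auto simp: quot_map_eq)

lemma quot_map_carrier: "R \<in> gen_alg H T \<Longrightarrow> quot_map H T \<alpha> R \<in> quot_carrier H T \<alpha>"
  by (simp add: quot_carrier_def)

lemma quot_add_map:
  assumes "R \<in> gen_alg H T" "S \<in> gen_alg H T"
  shows "quot_add H T \<alpha> (quot_map H T \<alpha> R) (quot_map H T \<alpha> S) = quot_map H T \<alpha> (op_add R S)"
  unfolding quot_add_def
  by (intro UN_eq_const quot_map_eqI gen_alg_add; use assms in \<open>auto simp: quot_map_eq op_add_def\<close>)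

lemma quot_mult_map:
  assumes "R \<in> gen_alg H T" "S \<in> gen_alg H T"
  shows "quot_mult H T \<alpha> (quot_map H T \<alpha> R) (quot_map H T \<alpha> S) = quot_map H T \<alpha> (R \<circ> S)"
  unfolding quot_mult_def
  by (intro UN_eq_const quot_map_eqI gen_alg_comp; use assms gen_alg_in(2) in \<open>auto simp: quot_map_eq\<close>)

lemma quot_scale_map:
  assumes "R \<in> gen_alg H T"
  shows "quot_scale H T \<alpha> c (quot_map H T \<alpha> R) = quot_map H T \<alpha> (op_scale c R)"
  unfolding quot_scale_def
  by (intro UN_eq_const quot_map_eqI gen_alg_scale; use assms in \<open>auto simp: quot_map_eq op_scale_def\<close>)

lemma quot_character_layer:
  assumes \<phi>: "\<phi> \<in> quot_characters H T \<alpha>"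
  shows "layer_character \<alpha> (\<lambda>R. \<phi> (quot_map H T \<alpha> R))"
proof -
  have add: "\<phi> (quot_add H T \<alpha> X Y) = \<phi> X + \<phi> Y" and mult: "\<phi> (quot_mult H T \<alpha> X Y) = \<phi> X * \<phi> Y"
    and scale: "\<phi> (quot_scale H T \<alpha> c X) = c * \<phi> X"
    if "X \<in> quot_carrier H T \<alpha>" "Y \<in> quot_carrier H T \<alpha>" for X Y c
    using \<phi> that by (auto simp: quot_characters_def)
  have scale': "\<phi> (quot_map H T \<alpha> (op_scale c R)) = c * \<phi> (quot_map H T \<alpha> R)" if "R \<in> gen_alg H T" for c R
    using scale[OF quot_map_carrier quot_map_carrier, OF that that] quot_scale_map[OF that] by simp
  have null: "\<phi> (quot_map H T \<alpha> R) = 0" if R: "R \<in> gen_alg H T" "\<forall>x\<in>H \<alpha>. R x = 0" for R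
  proof -
    \<comment> \<open>The zero coset is written as a scalar multiple, so that homogeneity of
      \<open>\<phi>\<close> applies.\<close>
    have "quot_map H T \<alpha> R = quot_map H T \<alpha> (op_scale 0 R)"
      using R by (intro quot_map_eqI gen_alg_scale) (auto simp: op_scale_def)
    then show ?thesis using scale'[OF R(1), of 0] by simp
  qed
  have nonzero: "\<exists>R\<in>gen_alg H T. \<phi> (quot_map H T \<alpha> R) \<noteq> 0"
    using \<phi> by (auto simp: quot_characters_def quot_carrier_def)
  show ?thesis
    unfolding layer_character_def
    using add[OF quot_map_carrier quot_map_carrier] mult[OF quot_map_carrier quot_map_carrier]
      quot_add_map quot_mult_map scale' null nonzero by simp
qed

text \<open>The functional induced on the quotient. For a layer character the chosen representative
  does not matter, since the character is constant on cosets.\<close>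

definition quot_rep :: "'l \<Rightarrow> (('h \<Rightarrow> 'h) \<Rightarrow> complex) \<Rightarrow> ('h \<Rightarrow> 'h) set \<Rightarrow> complex" where
  "quot_rep \<alpha> \<psi> = restrict (\<lambda>X. \<psi> (SOME R. R \<in> X)) (quot_carrier H T \<alpha>)"

lemma quot_rep_map:
  assumes \<psi>: "layer_character \<alpha> \<psi>" and R: "R \<in> gen_alg H T"
  shows "quot_rep \<alpha> \<psi> (quot_map H T \<alpha> R) = \<psi> R"
proof -
  have "R \<in> quot_map H T \<alpha> R" using R by (simp add: quot_map_eq)
  then have "(SOME S. S \<in> quot_map H T \<alpha> R) \<in> quot_map H T \<alpha> R"
    by (rule someI[where P = "\<lambda>S. S \<in> quot_map H T \<alpha> R"])
  then have "\<psi> (SOME S. S \<in> quot_map H T \<alpha> R) = \<psi> R"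
    using R by (intro char_eq[OF \<psi>]) (auto simp: quot_map_eq)
  then show ?thesis using quot_map_carrier[OF R] by (simp add: quot_rep_def)
qed

lemma quot_rep_character:
  assumes \<psi>: "layer_character \<alpha> \<psi>"
  shows "quot_rep \<alpha> \<psi> \<in> quot_characters H T \<alpha>"
  unfolding quot_characters_def
proof (intro CollectI conjI ballI allI)
  show "quot_rep \<alpha> \<psi> \<in> extensional (quot_carrier H T \<alpha>)" by (simp add: quot_rep_def)
  note rep = quot_rep_map[OF \<psi>]
  fix X Y assume "X \<in> quot_carrier H T \<alpha>" "Y \<in> quot_carrier H T \<alpha>"
  then obtain R S where RS: "R \<in> gen_alg H T" "S \<in> gen_alg H T"
    and XY: "X = quot_map H T \<alpha> R" "Y = quot_map H T \<alpha> S" by (auto simp: quot_carrier_def)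
  show "quot_rep \<alpha> \<psi> (quot_add H T \<alpha> X Y) = quot_rep \<alpha> \<psi> X + quot_rep \<alpha> \<psi> Y"
    using RS by (simp add: XY quot_add_map rep gen_alg_add char_add[OF \<psi>])
  show "quot_rep \<alpha> \<psi> (quot_mult H T \<alpha> X Y) = quot_rep \<alpha> \<psi> X * quot_rep \<alpha> \<psi> Y"
    using RS by (simp add: XY quot_mult_map rep gen_alg_comp char_comp[OF \<psi>])
next
  fix c X assume "X \<in> quot_carrier H T \<alpha>"
  then obtain R where R: "R \<in> gen_alg H T" and X: "X = quot_map H T \<alpha> R" by (auto simp: quot_carrier_def)
  show "quot_rep \<alpha> \<psi> (quot_scale H T \<alpha> c X) = c * quot_rep \<alpha> \<psi> X"
    using R by (simp add: X quot_scale_map quot_rep_map[OF \<psi>] gen_alg_scale char_scale[OF \<psi>])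
next
  show "\<exists>X\<in>quot_carrier H T \<alpha>. quot_rep \<alpha> \<psi> X \<noteq> 0"
    using quot_map_carrier[OF gen_alg_id] quot_rep_map[OF \<psi> gen_alg_id] char_id[OF \<psi>]
    by (intro bexI[of _ "quot_map H T \<alpha> (op_id D)"]) auto
qed

lemma char_pullback_apply:
  "R \<in> gen_alg H T \<Longrightarrow> char_pullback H T \<alpha> \<phi> R = \<phi> (quot_map H T \<alpha> R)"
  by (simp add: char_pullback_def compose_def)

lemma layer_character_cong:
  assumes "\<And>R. R \<in> gen_alg H T \<Longrightarrow> \<psi> R = \<psi>' R"
  shows "layer_character \<alpha> \<psi> \<longleftrightarrow> layer_character \<alpha> \<psi>'"
  unfolding layer_character_def
  by (simp add: assms gen_alg_add gen_alg_comp gen_alg_scale cong: ball_cong bex_cong)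

text \<open>Factoring through the quotient amounts to vanishing on the null ideal;
  \<open>quot_rep\<close> recovers the factor.\<close>

lemma char_layer_eq:
  "char_layer H T \<alpha> = {\<psi> \<in> extensional (gen_alg H T). layer_character \<alpha> \<psi>}"
proof safe
  fix \<psi> assume "\<psi> \<in> char_layer H T \<alpha>"
  then obtain \<phi> where \<phi>: "\<phi> \<in> quot_characters H T \<alpha>" "\<psi> = char_pullback H T \<alpha> \<phi>"
    by (auto simp: char_layer_def)
  show "\<psi> \<in> extensional (gen_alg H T)" by (simp add: \<phi>(2) char_pullback_def compose_def)
  show "layer_character \<alpha> \<psi>"
    using quot_character_layer[OF \<phi>(1)] layer_character_cong[of \<psi>, OF char_pullback_apply[of _ \<alpha> \<phi>, folded \<phi>(2)]]
    by simp
next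
  fix \<psi> assume \<psi>: "\<psi> \<in> extensional (gen_alg H T)" "layer_character \<alpha> \<psi>"
  have "\<psi> = char_pullback H T \<alpha> (quot_rep \<alpha> \<psi>)"
  proof (rule extensionalityI[OF \<psi>(1)])
    show "char_pullback H T \<alpha> (quot_rep \<alpha> \<psi>) \<in> extensional (gen_alg H T)"
      by (simp add: char_pullback_def compose_def)
  qed (simp add: char_pullback_apply quot_rep_map[OF \<psi>(2)])
  then show "\<psi> \<in> char_layer H T \<alpha>"
    using quot_rep_character[OF \<psi>(2)] unfolding char_layer_def by blast
qed

text \<open>Null ideals shrink as the index grows, so vanishing on the ideal of
  \<open>\<alpha>\<close> implies vanishing on that of \<open>\<beta>\<close>.\<close>

lemma char_layer_mono:
  assumes "\<alpha> \<le> \<beta>"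
  shows "char_layer H T \<alpha> \<subseteq> char_layer H T \<beta>"
proof -
  have "layer_character \<beta> \<psi>" if \<psi>: "layer_character \<alpha> \<psi>" for \<psi>
  proof -
    have "\<psi> R = 0" if "R \<in> gen_alg H T" "\<forall>x\<in>H \<beta>. R x = 0" for R
      using that H_mono[OF assms] by (intro char_null[OF \<psi>]) auto
    with \<psi> show ?thesis by (simp add: layer_character_def)
  qed
  then show ?thesis unfolding char_layer_eq by blast
qed

lemma topspace_weak_star_topology: "topspace (weak_star_topology H T \<alpha>) = quot_characters H T \<alpha>"
  by (auto simp: weak_star_topology_def quot_characters_def PiE_def)

end

section \<open>The homeomorphism\<close>

locale normal_local_operator = local_operator H T
  for H :: "'l::order \<Rightarrow> 'h::complex_hilbert_space set" and T :: "'h \<Rightarrow> 'h" +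
  assumes normal: "local_normal H T"
begin

abbreviation "layer_spectrum \<alpha> \<equiv> approx_spectrum (H \<alpha>) (op_restrict (H \<alpha>) T)"

abbreviation "layer_eigenfilter \<alpha> \<equiv> approx_eigenfilter (H \<alpha>) (op_restrict (H \<alpha>) T)"

lemma layer_normal:
  assumes x: "x \<in> H \<alpha>"
  shows "op_restrict (H \<alpha>) T (op_adj (H \<alpha>) (op_restrict (H \<alpha>) T) x)
    = op_adj (H \<alpha>) (op_restrict (H \<alpha>) T) (op_restrict (H \<alpha>) T x)"
  using fun_cong[OF normal[unfolded local_normal_def], of x] x
    local_opsD(4)[OF T x] local_opsD(4)[OF local_adj_in[OF T] x]
  unfolding op_restrict_local_adj[OF T, symmetric] by (simp add: op_restrict_apply)

lemma spectrum_at_eq: "spectrum_at H T \<alpha> = layer_spectrum \<alpha>"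
  unfolding spectrum_at_def
  by (rule spectrum_eq_approx_spectrum[OF closed_csubspace_H local_opsD(2)[OF T] layer_normal])

section \<open>The Gelfand transform on a layer\<close>

text \<open>For \<open>R\<close> in the algebra, the choice is unambiguous on
  \<open>layer_spectrum \<alpha>\<close>, where approximate eigenvalues are unique; its values
  elsewhere are arbitrary.\<close>

definition gelfand :: "'l \<Rightarrow> ('h \<Rightarrow> 'h) \<Rightarrow> complex \<Rightarrow> complex" where
  "gelfand \<alpha> R = (SOME f. continuous_on (layer_spectrum \<alpha>) f \<and>
     (\<forall>z\<in>layer_spectrum \<alpha>. approx_eigenvalue (H \<alpha>) (layer_eigenfilter \<alpha> z) (op_restrict (H \<alpha>) R) (f z)))"

lemma gelfand:
  assumes R: "R \<in> gen_alg H T"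
  shows gelfand_continuous: "continuous_on (layer_spectrum \<alpha>) (gelfand \<alpha> R)"
    and gelfand_eigenvalue: "\<And>z. z \<in> layer_spectrum \<alpha> \<Longrightarrow>
      approx_eigenvalue (H \<alpha>) (layer_eigenfilter \<alpha> z) (op_restrict (H \<alpha>) R) (gelfand \<alpha> R z)"
  using someI_ex[OF gelfand_symbol[OF closed_csubspace_H local_opsD(2)[OF T] layer_normal gen_algD(2)[OF R]]]
  unfolding gelfand_def by blast+

lemma gelfand_eqI:
  assumes R: "R \<in> gen_alg H T" and z: "z \<in> layer_spectrum \<alpha>"
    and lim: "((\<lambda>x. op_restrict (H \<alpha>) R x - c *\<^sub>C x) \<longlongrightarrow> 0) (layer_eigenfilter \<alpha> z)"
  shows "gelfand \<alpha> R z = c"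
proof -
  have "cmod (gelfand \<alpha> R z - c) \<le> 0"
    using z gelfand_eigenvalue[OF R z] lim
    by (intro approx_eigenvalue_dist_le[OF closed_csubspace_H _ eventually_unit_approx_eigenfilter, of \<alpha> "op_restrict (H \<alpha>) T" z])
      (auto simp: approx_spectrum_def approx_eigenvalue_def)
  then show ?thesis by simp
qed

text \<open>Approximate eigenvalues along one filter add, multiply and scale; uniqueness turns these
  limit rules into equations for the chosen symbols.\<close>

lemma layer_character_gelfand:
  assumes z: "z \<in> layer_spectrum \<alpha>"
  shows "layer_character \<alpha> (\<lambda>R. gelfand \<alpha> R z)"
proof -
  let ?F = "layer_eigenfilter \<alpha> z"
  note unit = eventually_unit_approx_eigenfilter[of "H \<alpha>" "op_restrict (H \<alpha>) T" z]
  have lim: "((\<lambda>x. op_restrict (H \<alpha>) R x - gelfand \<alpha> R z *\<^sub>C x) \<longlongrightarrow> 0) ?F" if "R \<in> gen_alg H T" for R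
    using gelfand_eigenvalue[OF that z] by (simp add: approx_eigenvalue_def)
  have add: "gelfand \<alpha> (op_add R S) z = gelfand \<alpha> R z + gelfand \<alpha> S z"
    if "R \<in> gen_alg H T" "S \<in> gen_alg H T" for R S
  proof (intro gelfand_eqI[OF _ z] gen_alg_add that)
    have "op_restrict (H \<alpha>) (op_add R S) x = op_restrict (H \<alpha>) R x + op_restrict (H \<alpha>) S x" for x
      by (simp add: op_restrict_apply op_add_def)
    then show "((\<lambda>x. op_restrict (H \<alpha>) (op_add R S) x - (gelfand \<alpha> R z + gelfand \<alpha> S z) *\<^sub>C x) \<longlongrightarrow> 0) ?F"
      using tendsto_add[OF lim[OF that(1)] lim[OF that(2)]] by (simp add: scaleC_simps algebra_simps)
  qed
  have comp: "gelfand \<alpha> (R \<circ> S) z = gelfand \<alpha> R z * gelfand \<alpha> S z"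
    if "R \<in> gen_alg H T" "S \<in> gen_alg H T" for R S
    using approx_eigenvalue_comp[OF closed_csubspace_H unit local_opsD(2)[OF gen_algD(1)[OF that(1)]]
        local_opsD(2)[OF gen_algD(1)[OF that(2)]] lim[OF that(1)] lim[OF that(2)]] that
    by (intro gelfand_eqI[OF _ z] gen_alg_comp) (simp_all add: op_restrict_comp gen_algD(1))
  have scale: "gelfand \<alpha> (op_scale c R) z = c * gelfand \<alpha> R z" if R: "R \<in> gen_alg H T" for c R
  proof (intro gelfand_eqI[OF _ z] gen_alg_scale R)
    have "((\<lambda>x. cmod c * norm (op_restrict (H \<alpha>) R x - gelfand \<alpha> R z *\<^sub>C x)) \<longlongrightarrow> 0) ?F"
      using tendsto_mult_left[OF tendsto_norm[OF lim[OF R]], of "cmod c"] by simp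
    then show "((\<lambda>x. op_restrict (H \<alpha>) (op_scale c R) x - (c * gelfand \<alpha> R z) *\<^sub>C x) \<longlongrightarrow> 0) ?F"
    proof (rule tendsto_0_normI)
      have "op_restrict (H \<alpha>) (op_scale c R) x - (c * gelfand \<alpha> R z) *\<^sub>C x
          = c *\<^sub>C (op_restrict (H \<alpha>) R x - gelfand \<alpha> R z *\<^sub>C x)" for x
        by (simp add: op_restrict_scale) (simp add: op_scale_def scaleC_simps)
      then show "\<forall>\<^sub>F x in ?F. norm (op_restrict (H \<alpha>) (op_scale c R) x - (c * gelfand \<alpha> R z) *\<^sub>C x)
          \<le> cmod c * norm (op_restrict (H \<alpha>) R x - gelfand \<alpha> R z *\<^sub>C x)"
        by simp
    qed
  qed
  have "gelfand \<alpha> (op_id D) z = 1"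
  proof (intro gelfand_eqI[OF _ z] gen_alg_id)
    have "\<forall>\<^sub>F x in ?F. norm (op_restrict (H \<alpha>) (op_id D) x - 1 *\<^sub>C x) \<le> 0"
      using unit by eventually_elim (simp add: op_restrict_id op_id_apply scaleC_one)
    then show "((\<lambda>x. op_restrict (H \<alpha>) (op_id D) x - 1 *\<^sub>C x) \<longlongrightarrow> 0) ?F"
      by (rule tendsto_0_normI[OF tendsto_const])
  qed
  then have nonzero: "\<exists>R\<in>gen_alg H T. gelfand \<alpha> R z \<noteq> 0"
    using gen_alg_id by (metis zero_neq_one)
  have null: "gelfand \<alpha> R z = 0" if "R \<in> gen_alg H T" "\<forall>x\<in>H \<alpha>. R x = 0" for R
  proof (rule gelfand_eqI[OF that(1) z])
    have "op_restrict (H \<alpha>) R x - 0 *\<^sub>C x = 0" for x using that(2) by (simp add: op_restrict_apply)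
    then show "((\<lambda>x. op_restrict (H \<alpha>) R x - 0 *\<^sub>C x) \<longlongrightarrow> 0) ?F" by simp
  qed
  show ?thesis unfolding layer_character_def using add comp scale nonzero null by blast
qed

lemma gelfand_self: "z \<in> layer_spectrum \<alpha> \<Longrightarrow> gelfand \<alpha> T z = z"
  using approx_eigenvalue_self[OF closed_csubspace_H local_opsD(2)[OF T] layer_normal]
  by (intro gelfand_eqI gen_alg_self) (auto simp: approx_eigenvalue_def)

lemma layer_character_eq_gelfand:
  assumes \<psi>: "layer_character \<alpha> \<psi>" and R: "R \<in> gen_alg H T"
  shows "\<psi> R = gelfand \<alpha> R (\<psi> T)"
  by (rule char_eq_approx_eigenvalue[OF \<psi> R gelfand_eigenvalue[OF R char_in_approx_spectrum[OF \<psi>]]])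

text \<open>Evaluation is a coordinate projection, hence continuous for pointwise convergence. In
  the other direction every coordinate is the symbol of an element of the algebra, and symbols are
  continuous on the spectrum.\<close>

lemma weak_star_homeomorphic_maps:
  "homeomorphic_maps (weak_star_topology H T \<alpha>) (top_of_set (layer_spectrum \<alpha>))
     (\<lambda>\<phi>. \<phi> (quot_map H T \<alpha> T)) (\<lambda>z. quot_rep \<alpha> (\<lambda>R. gelfand \<alpha> R z))"
  unfolding homeomorphic_maps_def
proof (intro conjI ballI)
  show "continuous_map (weak_star_topology H T \<alpha>) (top_of_set (layer_spectrum \<alpha>)) (\<lambda>\<phi>. \<phi> (quot_map H T \<alpha> T))"
  proof (rule continuous_map_into_subtopology)
    show "continuous_map (weak_star_topology H T \<alpha>) euclidean (\<lambda>\<phi>. \<phi> (quot_map H T \<alpha> T))"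
      unfolding weak_star_topology_def
      by (intro continuous_map_from_subtopology continuous_map_product_projection[of _ _ "\<lambda>_. euclidean"]
          quot_map_carrier gen_alg_self)
    show "(\<lambda>\<phi>. \<phi> (quot_map H T \<alpha> T)) \<in> topspace (weak_star_topology H T \<alpha>) \<rightarrow> layer_spectrum \<alpha>"
      unfolding topspace_weak_star_topology
      using char_in_approx_spectrum[OF quot_character_layer] by blast
  qed
  show "continuous_map (top_of_set (layer_spectrum \<alpha>)) (weak_star_topology H T \<alpha>)
      (\<lambda>z. quot_rep \<alpha> (\<lambda>R. gelfand \<alpha> R z))"
    unfolding weak_star_topology_def
  proof (rule continuous_map_into_subtopology)
    show "continuous_map (top_of_set (layer_spectrum \<alpha>)) (product_topology (\<lambda>_. euclidean) (quot_carrier H T \<alpha>))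
        (\<lambda>z. quot_rep \<alpha> (\<lambda>R. gelfand \<alpha> R z))"
      unfolding continuous_map_componentwise
    proof (intro conjI ballI)
      show "(\<lambda>z. quot_rep \<alpha> (\<lambda>R. gelfand \<alpha> R z)) ` topspace (top_of_set (layer_spectrum \<alpha>))
          \<subseteq> extensional (quot_carrier H T \<alpha>)"
        by (auto simp: quot_rep_def)
      fix X assume "X \<in> quot_carrier H T \<alpha>"
      then obtain R where R: "R \<in> gen_alg H T" and X: "X = quot_map H T \<alpha> R" by (auto simp: quot_carrier_def)
      have "continuous_on (layer_spectrum \<alpha>) (\<lambda>z. quot_rep \<alpha> (\<lambda>R. gelfand \<alpha> R z) X)"
        using gelfand_continuous[OF R]
        by (rule continuous_on_eq) (simp add: X quot_rep_map[OF layer_character_gelfand R])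
      then show "continuous_map (top_of_set (layer_spectrum \<alpha>)) euclidean (\<lambda>z. quot_rep \<alpha> (\<lambda>R. gelfand \<alpha> R z) X)"
        by simp
    qed
    show "(\<lambda>z. quot_rep \<alpha> (\<lambda>R. gelfand \<alpha> R z)) \<in> topspace (top_of_set (layer_spectrum \<alpha>)) \<rightarrow> quot_characters H T \<alpha>"
      using quot_rep_character[OF layer_character_gelfand] by auto
  qed
next
  fix \<phi> assume "\<phi> \<in> topspace (weak_star_topology H T \<alpha>)"
  then have \<phi>: "\<phi> \<in> quot_characters H T \<alpha>" by (simp add: topspace_weak_star_topology)
  note layer = quot_character_layer[OF \<phi>]
  have z: "\<phi> (quot_map H T \<alpha> T) \<in> layer_spectrum \<alpha>" using char_in_approx_spectrum[OF layer] .
  show "quot_rep \<alpha> (\<lambda>R. gelfand \<alpha> R (\<phi> (quot_map H T \<alpha> T))) = \<phi>"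
  proof (rule extensionalityI[of _ "quot_carrier H T \<alpha>"])
    fix X assume "X \<in> quot_carrier H T \<alpha>"
    then obtain R where R: "R \<in> gen_alg H T" and X: "X = quot_map H T \<alpha> R" by (auto simp: quot_carrier_def)
    show "quot_rep \<alpha> (\<lambda>R. gelfand \<alpha> R (\<phi> (quot_map H T \<alpha> T))) X = \<phi> X"
      unfolding X quot_rep_map[OF layer_character_gelfand[OF z] R]
      using layer_character_eq_gelfand[OF layer R] by simp
  qed (use \<phi> in \<open>simp_all add: quot_rep_def quot_characters_def\<close>)
next
  fix z assume "z \<in> topspace (top_of_set (layer_spectrum \<alpha>))"
  then have z: "z \<in> layer_spectrum \<alpha>" by simp
  show "quot_rep \<alpha> (\<lambda>R. gelfand \<alpha> R z) (quot_map H T \<alpha> T) = z"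
    unfolding quot_rep_map[OF layer_character_gelfand[OF z] gen_alg_self] by (rule gelfand_self[OF z])
qed

section \<open>Passage from the layers to the inductive limits\<close>

abbreviation eval_T :: "(('h \<Rightarrow> 'h) \<Rightarrow> complex) \<Rightarrow> complex" where
  "eval_T \<psi> \<equiv> \<psi> T"

lemma weak_star_homeomorphic_map:
  "homeomorphic_map (weak_star_topology H T \<alpha>) (top_of_set (layer_spectrum \<alpha>)) (\<lambda>\<phi>. \<phi> (quot_map H T \<alpha> T))"
  using weak_star_homeomorphic_maps by (auto simp: homeomorphic_map_maps)

lemma eval_image_char_layer: "eval_T ` char_layer H T \<alpha> = layer_spectrum \<alpha>"
  using homeomorphic_imp_surjective_map[OF weak_star_homeomorphic_map[of \<alpha>]]
  by (simp add: char_layer_def image_image char_pullback_apply gen_alg_self topspace_weak_star_topology)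

lemma eval_inj: "inj_on eval_T (character_space H T)"
proof (rule inj_onI)
  fix \<psi> \<psi>' assume "\<psi> \<in> character_space H T" "\<psi>' \<in> character_space H T" and eq: "\<psi> T = \<psi>' T"
  then obtain \<alpha> \<beta> where "\<psi> \<in> char_layer H T \<alpha>" "\<psi>' \<in> char_layer H T \<beta>"
    by (auto simp: character_space_def)
  moreover obtain \<gamma> where "\<alpha> \<le> \<gamma>" "\<beta> \<le> \<gamma>" by (rule upper_boundE)
  ultimately have "\<psi> \<in> char_layer H T \<gamma>" "\<psi>' \<in> char_layer H T \<gamma>" using char_layer_mono by blast+
  then have *: "\<psi> \<in> extensional (gen_alg H T)" "\<psi>' \<in> extensional (gen_alg H T)"
    "layer_character \<gamma> \<psi>" "layer_character \<gamma> \<psi>'" unfolding char_layer_eq by auto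
  show "\<psi> = \<psi>'"
    by (rule extensionalityI[OF *(1,2)])
      (simp add: layer_character_eq_gelfand[OF *(3)] layer_character_eq_gelfand[OF *(4)] eq)
qed

text \<open>The layer topology is transported along the injection \<open>char_pullback\<close>, so
  openness can be tested on the unique preimage \<open>U\<close>, where the weak* homeomorphism
  applies.\<close>

lemma openin_char_layer_iff:
  assumes S: "S \<subseteq> char_layer H T \<alpha>"
  shows "openin (char_layer_topology H T \<alpha>) S \<longleftrightarrow> openin (top_of_set (layer_spectrum \<alpha>)) (eval_T ` S)"
proof -
  let ?h = "\<lambda>\<phi>. \<phi> (quot_map H T \<alpha> T)" and ?p = "char_pullback H T \<alpha>"
  have h: "eval_T ` ?p ` U = ?h ` U" for U
    by (simp add: image_image char_pullback_apply gen_alg_self)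
  have open_iff: "openin (top_of_set (layer_spectrum \<alpha>)) (?h ` U) \<longleftrightarrow> openin (weak_star_topology H T \<alpha>) U"
    if "U \<subseteq> quot_characters H T \<alpha>" for U
    using homeomorphic_map_openness[OF weak_star_homeomorphic_map, of U \<alpha>] that
    by (simp add: topspace_weak_star_topology)
  obtain U where U: "U \<subseteq> quot_characters H T \<alpha>" "S = ?p ` U"
    using S unfolding char_layer_def by (meson subset_imageE)
  have "openin (char_layer_topology H T \<alpha>) S \<longleftrightarrow> (\<exists>U'. openin (weak_star_topology H T \<alpha>) U' \<and> S = ?p ` U')"
    unfolding char_layer_topology_def by (rule openin_image_topology[OF inj_on_char_pullback])
  also have "\<dots> \<longleftrightarrow> openin (weak_star_topology H T \<alpha>) U"
  proof
    assume "\<exists>U'. openin (weak_star_topology H T \<alpha>) U' \<and> S = ?p ` U'"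
    then obtain U' where U': "openin (weak_star_topology H T \<alpha>) U'" "S = ?p ` U'" by blast
    have "U' = U"
      using U U' openin_subset[OF U'(1)] inj_on_char_pullback[of H T \<alpha>]
      unfolding topspace_weak_star_topology by (metis inj_on_image_eq_iff)
    then show "openin (weak_star_topology H T \<alpha>) U" using U' by simp
  qed (use U in blast)
  also have "\<dots> \<longleftrightarrow> openin (top_of_set (layer_spectrum \<alpha>)) (eval_T ` S)"
    unfolding U(2) h using open_iff[OF U(1)] by simp
  finally show ?thesis .
qed

lemma topspace_local_spectrum_topology: "topspace (local_spectrum_topology H T) = local_spectrum H T"
proof
  show "topspace (local_spectrum_topology H T) \<subseteq> local_spectrum H T"
    using openin_topspace[of "local_spectrum_topology H T"]
    unfolding local_spectrum_topology_def openin_inductive_limit_topology by blast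
  have "local_spectrum H T \<inter> spectrum_at H T \<alpha> = spectrum_at H T \<alpha>" for \<alpha>
    using local_spectrum_eq[OF T] by blast
  then have "openin (local_spectrum_topology H T) (local_spectrum H T)"
    by (simp add: local_spectrum_topology_def openin_inductive_limit_topology)
  then show "local_spectrum H T \<subseteq> topspace (local_spectrum_topology H T)" by (rule openin_subset)
qed

lemma eval_image_character_space: "eval_T ` character_space H T = local_spectrum H T"
  unfolding local_spectrum_eq[OF T] spectrum_at_eq character_space_def
  by (simp add: image_UN eval_image_char_layer)

lemma eval_openin_iff:
  assumes S: "S \<subseteq> character_space H T"
  shows "openin (local_spectrum_topology H T) (eval_T ` S) \<longleftrightarrow> openin (character_space_topology H T) S"
proof -
  \<comment> \<open>Injectivity on the whole union, not merely on each layer, is what lets images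
    commute with these intersections and the two limit topologies match layer by layer.\<close>
  have "eval_T ` S \<inter> layer_spectrum \<alpha> = eval_T ` (S \<inter> char_layer H T \<alpha>)" for \<alpha>
    unfolding eval_image_char_layer[symmetric]
    by (rule inj_on_image_Int[OF eval_inj S, symmetric]) (auto simp: character_space_def)
  moreover have "eval_T ` S \<subseteq> local_spectrum H T"
    using S eval_image_character_space by blast
  ultimately have "openin (local_spectrum_topology H T) (eval_T ` S) \<longleftrightarrow>
      (\<forall>\<alpha>. openin (char_layer_topology H T \<alpha>) (S \<inter> char_layer H T \<alpha>))"
    by (simp add: local_spectrum_topology_def openin_inductive_limit_topology spectrum_at_eq
        openin_char_layer_iff)
  also have "\<dots> \<longleftrightarrow> openin (character_space_topology H T) S"
    using S by (simp add: character_space_topology_def openin_inductive_limit_topology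
        topspace_char_layer_topology)
  finally show ?thesis .
qed

lemma eval_homeomorphic_map:
  "homeomorphic_map (character_space_topology H T) (local_spectrum_topology H T) eval_T"
proof (rule bijective_open_imp_homeomorphic_map)
  show "continuous_map (character_space_topology H T) (local_spectrum_topology H T) eval_T"
    unfolding continuous_map_def topspace_character_space_topology topspace_local_spectrum_topology
  proof (intro conjI allI impI)
    show "eval_T \<in> character_space H T \<rightarrow> local_spectrum H T"
      unfolding eval_image_character_space[symmetric] by simp
    fix U assume U: "openin (local_spectrum_topology H T) U"
    then have "U \<subseteq> local_spectrum H T"
      unfolding topspace_local_spectrum_topology[symmetric] by (rule openin_subset)
    then have "U \<subseteq> eval_T ` character_space H T" unfolding eval_image_character_space .
    then have "eval_T ` {\<psi> \<in> character_space H T. \<psi> T \<in> U} = U" by auto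
    with U show "openin (character_space_topology H T) {\<psi> \<in> character_space H T. \<psi> T \<in> U}"
      using eval_openin_iff[of "{\<psi> \<in> character_space H T. \<psi> T \<in> U}"] by auto
  qed
  show "open_map (character_space_topology H T) (local_spectrum_topology H T) eval_T"
    unfolding open_map_def
  proof (intro allI impI)
    fix U assume U: "openin (character_space_topology H T) U"
    then have "U \<subseteq> character_space H T"
      unfolding topspace_character_space_topology[symmetric] by (rule openin_subset)
    with U show "openin (local_spectrum_topology H T) (eval_T ` U)" by (simp add: eval_openin_iff)
  qed
qed (simp_all add: topspace_character_space_topology topspace_local_spectrum_topology
    eval_image_character_space eval_inj)

end

theorem theorem3p10:
  fixes H :: "'l::order \<Rightarrow> 'h::complex_hilbert_space set"
    and T :: "'h \<Rightarrow> 'h"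
  assumes "directed_family H"
    and "T \<in> local_ops H"
    and "local_normal H T"
  shows "character_space_topology H T homeomorphic_space local_spectrum_topology H T"
proof -
  interpret normal_local_operator H T by unfold_locales (rule assms)+
  show ?thesis using eval_homeomorphic_map by (rule homeomorphic_map_imp_homeomorphic_space)
qed

end
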